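(* There are algorithms that, respectively, compute all minimal models of a given 2-CNF theory, all stable models of a given normal 2-program, and all answer sets of a given disjunctive 2-program, each running in time $O(m\,3^{n/3}) = O(m\cdot 1.4422\ldots^n)$, where $n$ is the number of atoms and $m$ the size of the input theory or program.
   Context: A $t$-CNF theory is a finite set of propositional clauses, each containing at most $t$ literals; clauses contain no repeated literal and no pair of complementary literals. A normal program clause has the form $a \leftarrow b_1,\ldots,b_r,\mathbf{not}(c_1),\ldots,\mathbf{not}(c_s)$ and a disjunctive program clause has the form $a_1\vee\cdots\vee a_p \leftarrow b_1,\ldots,b_r,\mathbf{not}(c_1),\ldots,\mathbf{not}(c_s)$ (all $a_i,b_j,c_k$ atoms); a (normal or disjunctive) $t$-program is a finite set of such clauses each containing at most $t$ literals (head atoms plus body literals). Models, stable models and answer sets are represented as the sets of atoms true in them. A model of a theory is minimal if no proper subset is a model. Stable models of normal programs are in the sense of Gelfond–Lifschitz; an answer set of a disjunctive program $P$ is a set $M$ of atoms that is a minimal model of the reduct $P^M$ (obtained by deleting every clause with some $\mathbf{not}(c)$, $c\in M$, in its body and deleting all remaining negated body literals). For an input theory or program, $n$ denotes the number of atoms occurring in it and $m$ its size, i.e. the total number of atom occurrences. *)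

theory Defs
  imports Complex_Main
begin

section \<open>Propositional theories\<close>

datatype lit = Pos nat | Neg nat

fun lit_atom :: "lit \<Rightarrow> nat" where
  "lit_atom (Pos a) = a"
| "lit_atom (Neg a) = a"

fun lit_true :: "nat set \<Rightarrow> lit \<Rightarrow> bool" where
  "lit_true M (Pos a) \<longleftrightarrow> a \<in> M"
| "lit_true M (Neg a) \<longleftrightarrow> a \<notin> M"

definition t_cnf :: "nat \<Rightarrow> lit set set \<Rightarrow> bool" where
  "t_cnf t T \<longleftrightarrow> finite T \<and>
     (\<forall>c\<in>T. finite c \<and> card c \<le> t \<and> (\<forall>a. \<not> (Pos a \<in> c \<and> Neg a \<in> c)))"

definition cnf_model :: "lit set set \<Rightarrow> nat set \<Rightarrow> bool" where
  "cnf_model T M \<longleftrightarrow> (\<forall>c\<in>T. \<exists>l\<in>c. lit_true M l)"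

definition cnf_atoms :: "lit set set \<Rightarrow> nat set" where
  "cnf_atoms T = (\<Union>c\<in>T. lit_atom ` c)"

definition cnf_size :: "lit set set \<Rightarrow> nat" where
  "cnf_size T = (\<Sum>c\<in>T. card c)"

definition minimal :: "(nat set \<Rightarrow> bool) \<Rightarrow> nat set \<Rightarrow> bool" where
  "minimal Q M \<longleftrightarrow> Q M \<and> (\<forall>N. N \<subset> M \<longrightarrow> \<not> Q N)"

definition least :: "(nat set \<Rightarrow> bool) \<Rightarrow> nat set \<Rightarrow> bool" where
  "least Q M \<longleftrightarrow> Q M \<and> (\<forall>N. Q N \<longrightarrow> M \<subseteq> N)"


section \<open>Logic programs\<close>

text \<open>A rule consists of a head, the atoms \<open>b\<^sub>j\<close> of the positive body literals and the atoms
  \<open>c\<^sub>k\<close> of the literals \<open>not(c\<^sub>k)\<close>. Normal rules have type \<open>nat rule\<close>; disjunctive rules have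
  type \<open>nat set rule\<close>, the empty head being allowed.\<close>

datatype 'h rule = Rule (hd_of: 'h) (pos_of: "nat set") (neg_of: "nat set")

definition reduct :: "'h rule set \<Rightarrow> nat set \<Rightarrow> 'h rule set" where
  "reduct P M = {Rule h B {} | h B C. Rule h B C \<in> P \<and> C \<inter> M = {}}"

definition body_true :: "nat set \<Rightarrow> 'h rule \<Rightarrow> bool" where
  "body_true M r \<longleftrightarrow> pos_of r \<subseteq> M \<and> neg_of r \<inter> M = {}"

definition normal_program :: "nat \<Rightarrow> nat rule set \<Rightarrow> bool" where
  "normal_program t P \<longleftrightarrow> finite P \<and>
     (\<forall>r\<in>P. finite (pos_of r) \<and> finite (neg_of r) \<and>
        1 + card (pos_of r) + card (neg_of r) \<le> t)"

definition normal_model :: "nat rule set \<Rightarrow> nat set \<Rightarrow> bool" where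
  "normal_model P M \<longleftrightarrow> (\<forall>r\<in>P. body_true M r \<longrightarrow> hd_of r \<in> M)"

definition stable_model :: "nat rule set \<Rightarrow> nat set \<Rightarrow> bool" where
  "stable_model P M \<longleftrightarrow> least (normal_model (reduct P M)) M"

definition normal_atoms :: "nat rule set \<Rightarrow> nat set" where
  "normal_atoms P = (\<Union>r\<in>P. {hd_of r} \<union> pos_of r \<union> neg_of r)"

definition normal_size :: "nat rule set \<Rightarrow> nat" where
  "normal_size P = (\<Sum>r\<in>P. 1 + card (pos_of r) + card (neg_of r))"

definition disj_program :: "nat \<Rightarrow> nat set rule set \<Rightarrow> bool" where
  "disj_program t P \<longleftrightarrow> finite P \<and>
     (\<forall>r\<in>P. finite (hd_of r) \<and> finite (pos_of r) \<and> finite (neg_of r) \<and>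
        card (hd_of r) + card (pos_of r) + card (neg_of r) \<le> t)"

definition disj_model :: "nat set rule set \<Rightarrow> nat set \<Rightarrow> bool" where
  "disj_model P M \<longleftrightarrow> (\<forall>r\<in>P. body_true M r \<longrightarrow> hd_of r \<inter> M \<noteq> {})"

definition answer_set :: "nat set rule set \<Rightarrow> nat set \<Rightarrow> bool" where
  "answer_set P M \<longleftrightarrow> minimal (disj_model (reduct P M)) M"

definition disj_atoms :: "nat set rule set \<Rightarrow> nat set" where
  "disj_atoms P = (\<Union>r\<in>P. hd_of r \<union> pos_of r \<union> neg_of r)"

definition disj_size :: "nat set rule set \<Rightarrow> nat" where
  "disj_size P = (\<Sum>r\<in>P. card (hd_of r) + card (pos_of r) + card (neg_of r))"


section \<open>Random access machines\<close>

text \<open>Uniform-cost random access machine with structured control flow. A state has scalar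
  registers and arrays, all holding natural numbers; a program refers to registers and arrays by
  fixed numbers, so it uses only finitely many of them, and only array indices are computed.
  The arithmetic is addition and truncated subtraction. Every elementary instruction and every
  evaluation of a test costs one time unit.\<close>

record ram_state =
  reg :: "nat \<Rightarrow> nat"
  arr :: "nat \<Rightarrow> nat \<Rightarrow> nat"

datatype test = Less nat nat | Equal nat nat

fun holds :: "test \<Rightarrow> ram_state \<Rightarrow> bool" where
  "holds (Less x y) s \<longleftrightarrow> reg s x < reg s y"
| "holds (Equal x y) s \<longleftrightarrow> reg s x = reg s y"

datatype instr =
    Const nat nat
  | Copy nat nat
  | Add nat nat nat
  | Sub nat nat nat
  | Load nat nat nat
  | Store nat nat nat

fun step :: "instr \<Rightarrow> ram_state \<Rightarrow> ram_state" where
  "step (Const x k) s = s\<lparr>reg := (reg s)(x := k)\<rparr>"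
| "step (Copy x y) s = s\<lparr>reg := (reg s)(x := reg s y)\<rparr>"
| "step (Add x y z) s = s\<lparr>reg := (reg s)(x := reg s y + reg s z)\<rparr>"
| "step (Sub x y z) s = s\<lparr>reg := (reg s)(x := reg s y - reg s z)\<rparr>"
| "step (Load x A i) s = s\<lparr>reg := (reg s)(x := arr s A (reg s i))\<rparr>"
| "step (Store A i x) s = s\<lparr>arr := (arr s)(A := (arr s A)(reg s i := reg s x))\<rparr>"

datatype prog =
    Skip
  | Instr instr
  | Seq prog prog
  | Cond test prog prog
  | While test prog

text \<open>\<open>exec c s t s'\<close>: started in \<open>s\<close>, the program \<open>c\<close> halts in \<open>s'\<close> after exactly \<open>t\<close> time
  units.\<close>

inductive exec :: "prog \<Rightarrow> ram_state \<Rightarrow> nat \<Rightarrow> ram_state \<Rightarrow> bool" where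
  Skip: "exec Skip s 1 s"
| Instr: "exec (Instr i) s 1 (step i s)"
| Seq: "exec c1 s1 t1 s2 \<Longrightarrow> exec c2 s2 t2 s3 \<Longrightarrow> exec (Seq c1 c2) s1 (t1 + t2) s3"
| CondTrue: "holds b s \<Longrightarrow> exec c1 s t s' \<Longrightarrow> exec (Cond b c1 c2) s (1 + t) s'"
| CondFalse: "\<not> holds b s \<Longrightarrow> exec c2 s t s' \<Longrightarrow> exec (Cond b c1 c2) s (1 + t) s'"
| WhileFalse: "\<not> holds b s \<Longrightarrow> exec (While b c) s 1 s"
| WhileTrue: "holds b s1 \<Longrightarrow> exec c s1 t1 s2 \<Longrightarrow> exec (While b c) s2 t2 s3 \<Longrightarrow>
    exec (While b c) s1 (1 + t1 + t2) s3"

inductive_cases SkipE: "exec Skip s t s'"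
inductive_cases InstrE: "exec (Instr i) s t s'"
inductive_cases SeqE: "exec (Seq c1 c2) s t s'"
inductive_cases CondE: "exec (Cond b c1 c2) s t s'"
inductive_cases WhileE: "exec (While b c) s t s'"

lemma exec_deterministic:
  "exec c s t s' \<Longrightarrow> exec c s u s'' \<Longrightarrow> u = t \<and> s'' = s'"
proof (induction arbitrary: u s'' rule: exec.induct)
  case Skip
  then show ?case by (auto elim: SkipE)
next
  case Instr
  then show ?case by (auto elim: InstrE)
next
  case Seq
  from Seq.prems show ?case by (rule SeqE) (metis Seq.IH)
next
  case CondTrue
  from CondTrue.prems show ?case by (rule CondE) (auto simp: CondTrue.hyps(1) dest: CondTrue.IH)
next
  case CondFalse
  from CondFalse.prems show ?case by (rule CondE) (auto simp: CondFalse.hyps(1) dest: CondFalse.IH)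
next
  case WhileFalse
  from WhileFalse.prems show ?case by (rule WhileE) (auto simp: WhileFalse.hyps)
next
  case WhileTrue
  from WhileTrue.prems show ?case by (rule WhileE) (auto simp: WhileTrue.hyps(1) dest!: WhileTrue.IH)
qed

text \<open>The input is in array 0 and its length in register 0, everything else being 0; the output
  is read from array 1, its length from register 1.\<close>

definition init_state :: "nat list \<Rightarrow> ram_state" where
  "init_state xs =
     \<lparr>reg = (\<lambda>_. 0)(0 := length xs),
      arr = (\<lambda>_ _. 0)(0 := (\<lambda>i. if i < length xs then xs ! i else 0))\<rparr>"

definition output_of :: "ram_state \<Rightarrow> nat list" where
  "output_of s = map (arr s 1) [0..<reg s 1]"


section \<open>Representation of inputs and outputs\<close>

definition lists_family :: "'a list list \<Rightarrow> 'a set set \<Rightarrow> bool" where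
  "lists_family xss S \<longleftrightarrow>
     (\<forall>xs\<in>set xss. distinct xs) \<and> distinct (map set xss) \<and> set (map set xss) = S"

text \<open>A literal takes two cells, its sign and its atom. Each innermost list of
  literals or atoms is preceded by its length, so the codes can be parsed from left to right.\<close>

fun code_lit :: "lit \<Rightarrow> nat list" where
  "code_lit (Pos a) = [1, a]"
| "code_lit (Neg a) = [0, a]"

definition code_cnf :: "lit list list \<Rightarrow> nat list" where
  "code_cnf xss = concat (map (\<lambda>xs. length xs # concat (map code_lit xs)) xss)"

definition code_atom_lists :: "nat list list \<Rightarrow> nat list" where
  "code_atom_lists xss = concat (map (\<lambda>xs. length xs # xs) xss)"

definition lists_normal :: "(nat \<times> nat list \<times> nat list) list \<Rightarrow> nat rule set \<Rightarrow> bool" where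
  "lists_normal rs P \<longleftrightarrow>
     (let rules = map (\<lambda>(a, bs, cs). Rule a (set bs) (set cs)) rs in
      (\<forall>(a, bs, cs)\<in>set rs. distinct bs \<and> distinct cs) \<and> distinct rules \<and> set rules = P)"

definition code_normal :: "(nat \<times> nat list \<times> nat list) list \<Rightarrow> nat list" where
  "code_normal rs = concat (map (\<lambda>(a, bs, cs). a # code_atom_lists [bs, cs]) rs)"

definition lists_disj ::
  "(nat list \<times> nat list \<times> nat list) list \<Rightarrow> nat set rule set \<Rightarrow> bool" where
  "lists_disj rs P \<longleftrightarrow>
     (let rules = map (\<lambda>(as, bs, cs). Rule (set as) (set bs) (set cs)) rs in
      (\<forall>(as, bs, cs)\<in>set rs. distinct as \<and> distinct bs \<and> distinct cs) \<and>
      distinct rules \<and> set rules = P)"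

definition code_disj :: "(nat list \<times> nat list \<times> nat list) list \<Rightarrow> nat list" where
  "code_disj rs = concat (map (\<lambda>(as, bs, cs). code_atom_lists [as, bs, cs]) rs)"

text \<open>On the given input, \<open>c\<close> halts after \<open>t\<close> time units having output the members of \<open>S\<close>, each
  exactly once.\<close>

definition computes_all :: "prog \<Rightarrow> nat list \<Rightarrow> nat set set \<Rightarrow> nat \<Rightarrow> bool" where
  "computes_all c inp S t \<longleftrightarrow>
     (\<exists>s yss. exec c (init_state inp) t s \<and> output_of s = code_atom_lists yss \<and>
        lists_family yss S)"

text \<open>The bound \<open>t = O(m 3\<^bsup>n/3\<^esup>)\<close> with constant \<open>K\<close>. It says nothing for \<open>m = 0\<close>, where no
  running time could meet it.\<close>

definition time_bound :: "real \<Rightarrow> nat \<Rightarrow> nat \<Rightarrow> nat \<Rightarrow> bool" where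
  "time_bound K m n t \<longleftrightarrow> (m > 0 \<longrightarrow> real t \<le> K * (real m * 3 powr (real n / 3)))"

end

theory Submission
  imports Defs
begin

text \<open>A clause or rule with at most two literals is a pair of items, so all three problems ask for the
  sets \<open>M\<close> that are minimal models of the reduct, with respect to \<open>M\<close>, of a set of pairs. Such an \<open>M\<close>
  is a model each of whose atoms \<open>a\<close> is supported: unconditionally, or by some \<open>x \<notin> M\<close> such that
  falsity of \<open>x\<close> yields an atom from which \<open>a\<close> is reached by rules \<open>a \<leftarrow> b\<close>. The support relation is
  computed in polynomial time, and \<open>(x, a)\<close> in it entails \<open>x \<or> a\<close>. Hence the complement of \<open>M\<close> is a
  maximal independent set of the symmetrized support relation.

  These sets are enumerated by branching over the closed neighbourhood of an undecided vertex of
  minimal degree, forbidding in each branch the vertices of the earlier ones, which excludes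
  repetitions. With \<open>j\<close> undecided vertices and a neighbourhood of size \<open>s\<close> there are at most \<open>s\<close>
  branches, each with at most \<open>j - s\<close> undecided vertices, and \<open>s \<le> 3\<^bsup>s/3\<^esup>\<close>. A node costs
  \<open>O(m (j + 1)\<^sup>2)\<close>, and as \<open>\<Sum>j. (j + 1)\<^sup>2 / 3\<^bsup>j/3\<^esup>\<close> converges the leaves, at cost \<open>O(m)\<close> each,
  dominate.\<close>

section \<open>Loop programs with syntactic time bounds\<close>

text \<open>The bound leaves no room for a polynomial factor in \<open>n\<close>, and this shapes
  the algorithm. Work of cubic cost is done once, before the search, where 3^(n/3) absorbs it.
  Within the search a node may pay for powers of the number of its own undecided vertices, but for
  everything else only one factor that is linear in the input. Being a maximal independent set is
  necessary but not sufficient: symmetrizing forgets which of two neighbours supports the other, and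
  rules without a head atom give no support at all. So every leaf still tests directed support and
  the rules themselves. Both tests are linear because the supported vertices are carried along each
  branch as a vector instead of being recomputed. The exponent counts the atoms that occur, while
  atoms are arbitrary numbers; they are therefore renumbered before any matrix is laid out. The
  vertex 0, which stands for unconditional support, belongs to every independent set and is decided
  at the root, so it adds nothing to the exponent.\<close>

datatype cmd =
    Nop
  | Do instr
  | Then cmd cmd (infixr \<open>;;\<close> 60)
  | Branch test cmd cmd
  | For nat nat cmd

definition set_reg :: "nat \<Rightarrow> nat \<Rightarrow> ram_state \<Rightarrow> ram_state" where
  "set_reg x v s = s\<lparr>reg := (reg s)(x := v)\<rparr>"

definition set_arr :: "nat \<Rightarrow> nat \<Rightarrow> nat \<Rightarrow> ram_state \<Rightarrow> ram_state" where
  "set_arr A i v s = s\<lparr>arr := (arr s)(A := (arr s A)(i := v))\<rparr>"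

lemma set_simps [simp]:
  "reg (set_reg x v s) y = (if y = x then v else reg s y)"
  "arr (set_reg x v s) = arr s"
  "arr (set_arr A i v s) B = (if B = A then (arr s A)(i := v) else arr s B)"
  "reg (set_arr A i v s) = reg s"
  by (simp_all add: set_reg_def set_arr_def)

declare step.simps [simp del]

lemma step_simps [simp]:
  "step (Const x k) s = set_reg x k s"
  "step (Copy x y) s = set_reg x (reg s y) s"
  "step (Add x y z) s = set_reg x (reg s y + reg s z) s"
  "step (Sub x y z) s = set_reg x (reg s y - reg s z) s"
  "step (Load x A i) s = set_reg x (arr s A (reg s i)) s"
  "step (Store A i x) s = set_arr A (reg s i) (reg s x) s"
  by (simp_all add: step.simps set_reg_def set_arr_def)

text \<open>The compiled increment passes through register 2, so its effect on that register belongs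
  to the semantics.\<close>

definition bump :: "nat \<Rightarrow> ram_state \<Rightarrow> ram_state" where
  "bump i s = set_reg i (reg s i + 1) (set_reg 2 1 s)"

primrec compile :: "cmd \<Rightarrow> prog" where
  "compile Nop = Skip"
| "compile (Do i) = Instr i"
| "compile (c ;; d) = Seq (compile c) (compile d)"
| "compile (Branch b c d) = Cond b (compile c) (compile d)"
| "compile (For i n c) = Seq (Instr (Const i 0))
     (While (Less i n) (Seq (compile c) (Seq (Instr (Const 2 1)) (Instr (Add i i 2)))))"

text \<open>The number of rounds of a \<open>For\<close> is read once, on entry, so the semantics is
  a total function and correctness needs no termination argument. The compiled loop tests the bound
  again in every round; the two agree when bound registers are never written.\<close>

primrec sem :: "cmd \<Rightarrow> ram_state \<Rightarrow> ram_state" where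
  "sem Nop s = s"
| "sem (Do i) s = step i s"
| "sem (c ;; d) s = sem d (sem c s)"
| "sem (Branch b c d) s = (if holds b s then sem c s else sem d s)"
| "sem (For i n c) s = ((\<lambda>s. bump i (sem c s)) ^^ reg s n) (step (Const i 0) s)"

fun instr_regs :: "instr \<Rightarrow> nat set" where
  "instr_regs (Store A i x) = {}"
| "instr_regs (Const x k) = {x}"
| "instr_regs (Copy x y) = {x}"
| "instr_regs (Add x y z) = {x}"
| "instr_regs (Sub x y z) = {x}"
| "instr_regs (Load x A i) = {x}"

fun instr_arrs :: "instr \<Rightarrow> nat set" where
  "instr_arrs (Store A i x) = {A}"
| "instr_arrs i = {}"

primrec regs :: "cmd \<Rightarrow> nat set" where
  "regs Nop = {}"
| "regs (Do i) = instr_regs i"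
| "regs (c ;; d) = regs c \<union> regs d"
| "regs (Branch b c d) = regs c \<union> regs d"
| "regs (For i n c) = insert 2 (insert i (regs c))"

primrec arrs :: "cmd \<Rightarrow> nat set" where
  "arrs Nop = {}"
| "arrs (Do i) = instr_arrs i"
| "arrs (c ;; d) = arrs c \<union> arrs d"
| "arrs (Branch b c d) = arrs c \<union> arrs d"
| "arrs (For i n c) = arrs c"

primrec bounds :: "cmd \<Rightarrow> nat set" where
  "bounds Nop = {}"
| "bounds (Do i) = {}"
| "bounds (c ;; d) = bounds c \<union> bounds d"
| "bounds (Branch b c d) = bounds c \<union> bounds d"
| "bounds (For i n c) = insert n (bounds c)"

primrec counters_ok :: "cmd \<Rightarrow> bool" where
  "counters_ok Nop = True"
| "counters_ok (Do i) = True"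
| "counters_ok (c ;; d) = (counters_ok c \<and> counters_ok d)"
| "counters_ok (Branch b c d) = (counters_ok c \<and> counters_ok d)"
| "counters_ok (For i n c) = (counters_ok c \<and> i \<noteq> 2 \<and> i \<notin> regs c)"

text \<open>\<open>\<rho>\<close> values the loop bounds. A branch is charged both alternatives
  instead of their maximum, so that unfolding yields a polynomial. The 2 of a loop is the
  initialisation and the failing test, the 3 of a round its test and the two instructions of the
  increment.\<close>

primrec cost :: "cmd \<Rightarrow> (nat \<Rightarrow> nat) \<Rightarrow> nat" where
  "cost Nop \<rho> = 1"
| "cost (Do i) \<rho> = 1"
| "cost (c ;; d) \<rho> = cost c \<rho> + cost d \<rho>"
| "cost (Branch b c d) \<rho> = 1 + cost c \<rho> + cost d \<rho>"
| "cost (For i n c) \<rho> = 2 + \<rho> n * (3 + cost c \<rho>)"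

lemma step_frame:
  "r \<notin> instr_regs i \<Longrightarrow> reg (step i s) r = reg s r"
  "A \<notin> instr_arrs i \<Longrightarrow> arr (step i s) A = arr s A"
  by (cases i; simp)+

lemma bump_simps [simp]:
  "reg (bump i s) r = (if r = i then reg s i + 1 else if r = 2 then 1 else reg s r)"
  "arr (bump i s) = arr s"
  by (auto simp: bump_def)

lemma sem_reg_frame: "r \<notin> regs c \<Longrightarrow> reg (sem c s) r = reg s r"
proof (induction c arbitrary: s)
  case (For i n c)
  have "reg (((\<lambda>s. bump i (sem c s)) ^^ k) t) r = reg t r" for k t
    using For by (induction k) auto
  then show ?case using For by simp
qed (auto simp: step_frame)

lemma sem_arr_frame: "A \<notin> arrs c \<Longrightarrow> arr (sem c s) A = arr s A"
proof (induction c arbitrary: s)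
  case (For i n c)
  have "arr (((\<lambda>s. bump i (sem c s)) ^^ k) t) A = arr t A" for k t
    using For by (induction k) auto
  then show ?case using For by simp
qed (auto simp: step_frame)

text \<open>Disjointness of \<open>bounds c\<close> and \<open>regs c\<close> freezes all loop
  bounds, so one valuation serves at every depth and in every round. The price is that a program
  which computes a loop bound and then uses it has to be compiled in pieces.\<close>

lemma exec_compile:
  assumes "counters_ok c" "bounds c \<inter> regs c = {}" "\<forall>n\<in>bounds c. reg s n = \<rho> n"
  shows "\<exists>t\<le>cost c \<rho>. exec (compile c) s t (sem c s)"
  using assms
proof (induction c arbitrary: s)
  case Nop
  then show ?case by (auto intro!: exI[of _ 1] exec.Skip)
next
  case (Do i)
  then show ?case by (auto intro!: exI[of _ 1] exec.Instr)
next
  case (Then c d)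
  have dis: "bounds c \<inter> regs c = {}" "bounds d \<inter> regs d = {}" "bounds d \<inter> regs c = {}"
    using Then.prems(2) by auto
  obtain t where t: "t \<le> cost c \<rho>" "exec (compile c) s t (sem c s)"
    using Then.IH(1)[of s] Then.prems dis by auto
  have "\<forall>n\<in>bounds d. reg (sem c s) n = \<rho> n"
    using Then.prems(3) dis(3) by (auto simp: disjoint_iff sem_reg_frame)
  then obtain u where "u \<le> cost d \<rho>" "exec (compile d) (sem c s) u (sem d (sem c s))"
    using Then.IH(2)[of "sem c s"] Then.prems dis by auto
  with t show ?case by (auto intro!: exI[of _ "t + u"] exec.Seq)
next
  case (Branch b c d)
  have dis: "bounds c \<inter> regs c = {}" "bounds d \<inter> regs d = {}"
    using Branch.prems(2) by auto
  show ?case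
  proof (cases "holds b s")
    case True
    then obtain t where "t \<le> cost c \<rho>" "exec (compile c) s t (sem c s)"
      using Branch.IH(1)[of s] Branch.prems dis by auto
    with True show ?thesis by (auto intro!: exI[of _ "1 + t"] exec.CondTrue)
  next
    case False
    then obtain t where "t \<le> cost d \<rho>" "exec (compile d) s t (sem d s)"
      using Branch.IH(2)[of s] Branch.prems dis by auto
    with False show ?thesis by (auto intro!: exI[of _ "1 + t"] exec.CondFalse)
  qed
next
  case (For i n c)
  let ?f = "\<lambda>s. bump i (sem c s)"
  let ?w = "While (Less i n) (Seq (compile c) (Seq (Instr (Const 2 1)) (Instr (Add i i 2))))"
  have inc: "exec (Seq (Instr (Const 2 1)) (Instr (Add i i 2))) t 2 (bump i t)" for t
  proof -
    have "exec (Seq (Instr (Const 2 1)) (Instr (Add i i 2))) t (1 + 1)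
        (step (Add i i 2) (step (Const 2 1) t))"
      by (rule exec.Seq[OF exec.Instr exec.Instr])
    moreover have "step (Add i i 2) (step (Const 2 1) t) = bump i t"
      using For.prems(1) by (simp add: bump_def)
    ultimately show ?thesis by (simp add: numeral_2_eq_2)
  qed
  have loop: "\<exists>t\<le>1 + k * (3 + cost c \<rho>). exec ?w u t ((?f ^^ k) u)"
    if "\<forall>n\<in>bounds (For i n c). reg u n = \<rho> n" "reg u i + k = \<rho> n" for k u
    using that
  proof (induction k arbitrary: u)
    case 0
    then show ?case by (auto intro!: exI[of _ 1] exec.WhileFalse)
  next
    case (Suc k)
    obtain t where t: "t \<le> cost c \<rho>" "exec (compile c) u t (sem c u)"
      using For.IH[of u] For.prems Suc.prems by auto
    have fr: "reg (?f u) m = reg u m" if "m \<in> bounds (For i n c)" for m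
      using that For.prems(2) by (auto simp: sem_reg_frame disjoint_iff)
    moreover have "reg (?f u) i = reg u i + 1"
      using For.prems(1) by (simp add: sem_reg_frame)
    ultimately obtain t' where t': "t' \<le> 1 + k * (3 + cost c \<rho>)" "exec ?w (?f u) t' ((?f ^^ k) (?f u))"
      using Suc.IH[of "?f u"] Suc.prems by auto
    have "exec ?w u (1 + (t + 2) + t') ((?f ^^ k) (?f u))"
      using Suc.prems by (intro exec.WhileTrue[OF _ exec.Seq[OF t(2) inc] t'(2)]) auto
    moreover have "(?f ^^ k) (?f u) = (?f ^^ Suc k) u"
      by (simp only: funpow_Suc_right o_apply)
    ultimately show ?case using t t'
      by (auto intro!: exI[of _ "1 + (t + 2) + t'"])
  qed
  have "\<forall>m\<in>bounds (For i n c). reg (step (Const i 0) s) m = \<rho> m"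
    using For.prems by auto
  moreover have "reg (step (Const i 0) s) i + reg s n = \<rho> n"
    using For.prems by simp
  ultimately obtain t where "t \<le> 1 + reg s n * (3 + cost c \<rho>)"
    "exec ?w (step (Const i 0) s) t ((?f ^^ reg s n) (step (Const i 0) s))"
    using loop by blast
  then show ?case
    using For.prems(3) by (auto intro!: exI[of _ "1 + t"] exec.Seq exec.Instr)
qed

text \<open>The step may assume that the counter equals the round number and that everything outside
  the write sets still has its entry value. Providing these facts here keeps them out of all later
  invariants.\<close>

lemma For_rule:
  assumes ok: "i \<notin> regs c" "i \<noteq> 2" "n \<notin> regs (For i n c)"
    and init: "P 0 (set_reg i 0 s)"
    and step: "\<And>k t. k < reg s n \<Longrightarrow> P k t \<Longrightarrow> reg t i = k \<Longrightarrow>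
      (\<And>r. r \<notin> regs (For i n c) \<Longrightarrow> reg t r = reg s r) \<Longrightarrow>
      (\<And>A. A \<notin> arrs c \<Longrightarrow> arr t A = arr s A) \<Longrightarrow> P (Suc k) (bump i (sem c t))"
  shows "P (reg s n) (sem (For i n c) s)"
proof -
  let ?f = "\<lambda>s. bump i (sem c s)" and ?s = "set_reg i 0 s"
  have "P k ((?f ^^ k) ?s) \<and> reg ((?f ^^ k) ?s) i = k \<and>
      (\<forall>r. r \<notin> regs (For i n c) \<longrightarrow> reg ((?f ^^ k) ?s) r = reg s r) \<and>
      (\<forall>A. A \<notin> arrs c \<longrightarrow> arr ((?f ^^ k) ?s) A = arr s A)" if "k \<le> reg s n" for k
    using that
  proof (induction k)
    case 0
    show ?case using init by simp
  next
    case (Suc k)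
    let ?t = "(?f ^^ k) ?s"
    from Suc have IH: "P k ?t" "reg ?t i = k" "\<And>r. r \<notin> regs (For i n c) \<Longrightarrow> reg ?t r = reg s r"
      "\<And>A. A \<notin> arrs c \<Longrightarrow> arr ?t A = arr s A" by auto
    have "P (Suc k) (?f ?t)"
      using step[of k ?t] IH Suc.prems by auto
    moreover have "reg (?f ?t) i = Suc k"
      using IH(2) ok by (simp add: sem_reg_frame)
    moreover have "reg (?f ?t) r = reg s r" if "r \<notin> regs (For i n c)" for r
      using IH(3)[OF that] that by (simp add: sem_reg_frame)
    moreover have "arr (?f ?t) A = arr s A" if "A \<notin> arrs c" for A
      using IH(4)[OF that] that by (simp add: sem_arr_frame)
    ultimately show ?case by simp
  qed
  then show ?thesis by simp
qed

text \<open>The potential drops by at least one per iteration, so it also bounds the number of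
  iterations and no separate termination measure is needed.\<close>

lemma exec_While_potential:
  fixes pot :: "'a \<Rightarrow> real"
  assumes "invar x s" "\<And>x s. invar x s \<Longrightarrow> 0 \<le> pot x"
    and "\<And>x s. invar x s \<Longrightarrow> holds b s \<Longrightarrow>
      \<exists>t s' x'. exec c s t s' \<and> invar x' s' \<and> 1 + real t + pot x' \<le> pot x"
  shows "\<exists>t s' x'. exec (While b c) s t s' \<and> invar x' s' \<and> \<not> holds b s' \<and> real t \<le> 1 + pot x"
  using assms(1)
proof (induction "nat \<lfloor>pot x\<rfloor>" arbitrary: x s rule: less_induct)
  case less
  show ?case
  proof (cases "holds b s")
    case False
    then show ?thesis
      using less.prems assms(2)[of x s] by (auto intro!: exI[of _ 1] exI[of _ s] exec.WhileFalse)
  next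
    case True
    then obtain t s' x' where t: "exec c s t s'" "invar x' s'" "1 + real t + pot x' \<le> pot x"
      using assms(3)[of x s] less.prems by blast
    have "nat \<lfloor>pot x'\<rfloor> < nat \<lfloor>pot x\<rfloor>"
      using t(3) assms(2)[OF t(2)] by linarith
    from less.hyps[OF this t(2)] obtain u s'' x'' where
      u: "exec (While b c) s' u s''" "invar x'' s''" "\<not> holds b s''" "real u \<le> 1 + pot x'" by blast
    have "exec (While b c) s (1 + t + u) s''"
      by (rule exec.WhileTrue[OF True t(1) u(1)])
    moreover have "real (1 + t + u) \<le> 1 + pot x" using t(3) u(4) by simp
    ultimately show ?thesis using u by blast
  qed
qed

text \<open>Register and array 1 must keep the form in which they occur in programs.\<close>

declare One_nat_def [simp del]

text \<open>Register 4 is never written, so it holds 0; registers 2 and 3 are scratch, register 7 holds the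
  number \<open>n\<close> of vertices and register 5 the number of stored pairs of items. Since the machine cannot
  multiply, array 8 tabulates the offsets \<open>i * n\<close> of the rows of the matrices in arrays 9 to 13.\<close>

abbreviation "get x A i j \<equiv> Do (Load 3 8 i) ;; Do (Add 3 3 j) ;; Do (Load x A 3)"
abbreviation "put A i j x \<equiv> Do (Load 3 8 i) ;; Do (Add 3 3 j) ;; Do (Store A 3 x)"
abbreviation "when_nz x c \<equiv> Branch (Less 4 x) c Nop"


section \<open>Supported models and independent sets\<close>

text \<open>An item is a pair (kind, atom), and a set of pairs of items is read as a set of two-literal
  rules. Kind 1 marks a head atom, kind 0 a positive body atom, every other kind the atom of a
  \<open>not\<close>-literal, which is evaluated in the set \<open>M\<close> defining the reduct.\<close>

definition item_true :: "nat set \<Rightarrow> nat set \<Rightarrow> nat \<times> nat \<Rightarrow> bool" where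
  "item_true M N x \<longleftrightarrow> (if fst x = 0 then snd x \<notin> N else if fst x = 1 then snd x \<in> N else snd x \<in> M)"

definition red_model :: "((nat \<times> nat) \<times> (nat \<times> nat)) set \<Rightarrow> nat set \<Rightarrow> nat set \<Rightarrow> bool" where
  "red_model Q M N \<longleftrightarrow> (\<forall>(x, y)\<in>Q. item_true M N x \<or> item_true M N y)"

definition imps :: "((nat \<times> nat) \<times> (nat \<times> nat)) set \<Rightarrow> nat rel" where
  "imps Q = {(b, a). ((1, a), (0, b)) \<in> Q}"

text \<open>\<open>(x, y) \<in> founds Q\<close>: the atom \<open>y\<close> has external support as soon as \<open>x\<close> is false. The vertex 0
  is no atom and counts as false; it stands for unconditional support.\<close>

definition founds :: "((nat \<times> nat) \<times> (nat \<times> nat)) set \<Rightarrow> nat rel" where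
  "founds Q = {(x, y). \<exists>k. k \<noteq> 0 \<and> ((1, y), (k, x)) \<in> Q} \<union>
     {(0, u) | u v. ((1, u), (1, v)) \<in> Q \<and> (u, v) \<in> (imps Q)\<^sup>* \<and> (v, u) \<in> (imps Q)\<^sup>*}"

definition supports :: "((nat \<times> nat) \<times> (nat \<times> nat)) set \<Rightarrow> nat rel" where
  "supports Q = founds Q O (imps Q)\<^sup>*"

lemma red_model_imps:
  assumes "red_model Q M N" "(b, a) \<in> (imps Q)\<^sup>*" "b \<in> N"
  shows "a \<in> N"
  using assms(2,3)
proof (induction rule: rtrancl_induct)
  case (step y z)
  then have "((1, z), (0, y)) \<in> Q" by (simp add: imps_def)
  then show ?case using assms(1) step by (auto simp: red_model_def item_true_def)
qed

text \<open>An \<open>x\<close> outside \<open>M\<close> falsifies a head item of \<open>x\<close>,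
  because \<open>N \<subseteq> M\<close>, and likewise an item for \<open>not(x)\<close>, because
  that one is evaluated in \<open>M\<close>; the other item, a head, must then hold. Support thus
  forces atoms into every model of the reduct below \<open>M\<close>, which is why supported models
  are minimal.\<close>

lemma red_model_supports:
  assumes "red_model Q M N" "N \<subseteq> M" "(x, a) \<in> supports Q" "x \<notin> M"
  shows "a \<in> N"
proof -
  obtain y where y: "(x, y) \<in> founds Q" "(y, a) \<in> (imps Q)\<^sup>*"
    using assms(3) by (auto simp: supports_def)
  have "y \<in> N"
    using y(1) unfolding founds_def
  proof
    assume "(x, y) \<in> {(x, y). \<exists>k. k \<noteq> 0 \<and> ((1, y), (k, x)) \<in> Q}"
    then obtain k where "k \<noteq> 0" "((1, y), (k, x)) \<in> Q" by auto
    then show ?thesis using assms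
      by (fastforce simp: red_model_def item_true_def split: if_splits)
  next
    assume "(x, y) \<in> {(0, u) | u v. ((1, u), (1, v)) \<in> Q \<and> (u, v) \<in> (imps Q)\<^sup>* \<and> (v, u) \<in> (imps Q)\<^sup>*}"
    then obtain v where v: "((1, y), (1, v)) \<in> Q" "(v, y) \<in> (imps Q)\<^sup>*" by auto
    then have "y \<in> N \<or> v \<in> N" using assms(1) by (fastforce simp: red_model_def item_true_def)
    then show ?thesis using red_model_imps[OF assms(1) v(2)] by blast
  qed
  then show ?thesis using red_model_imps[OF assms(1) y(2)] by blast
qed

text \<open>If some atom of \<open>M\<close> lacks support, then so does an initial strongly connected component of
  the implications inside \<open>M\<close>, and this component can be removed from \<open>M\<close>.\<close>

theorem minimal_red_model_iff:
  assumes "sym Q" "finite M" "0 \<notin> M"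
  shows "minimal (red_model Q M) M \<longleftrightarrow>
    red_model Q M M \<and> (\<forall>a\<in>M. \<exists>x. x \<notin> M \<and> (x, a) \<in> supports Q)"
proof (intro iffI conjI ballI)
  assume min: "minimal (red_model Q M) M"
  then show mod: "red_model Q M M" by (simp add: minimal_def)
  fix a assume "a \<in> M"
  let ?G = "(imps Q)\<^sup>*"
  let ?F = "\<lambda>a. {b \<in> M. (b, a) \<in> ?G}"
  show "\<exists>x. x \<notin> M \<and> (x, a) \<in> supports Q"
  proof (rule ccontr)
    assume no: "\<nexists>x. x \<notin> M \<and> (x, a) \<in> supports Q"
    \<comment> \<open>A predecessor of \<open>a\<close> with the fewest predecessors lies in an
      initial component: each of its predecessors has the same predecessor set and is therefore
      reachable from it.\<close>
    obtain b where b: "b \<in> ?F a" and bmin: "\<And>c. c \<in> ?F a \<Longrightarrow> card (?F b) \<le> card (?F c)"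
      using arg_min_nat_lemma[of "\<lambda>b. b \<in> ?F a" a "\<lambda>b. card (?F b)"] \<open>a \<in> M\<close> by blast
    have scc: "(b, c) \<in> ?G \<and> c \<in> M \<and> (c, a) \<in> ?G" if c: "c \<in> ?F b" for c
    proof -
      have sub: "?F c \<subseteq> ?F b" using c by (auto intro: rtrancl_trans)
      have "c \<in> ?F a" using b c by (auto intro: rtrancl_trans)
      then have "?F c = ?F b"
        using bmin[of c] sub assms(2) by (intro card_seteq) auto
      then show ?thesis using b c \<open>c \<in> ?F a\<close> by blast
    qed
    have "red_model Q M (M - ?F b)"
    proof -
      have "item_true M (M - ?F b) x \<or> item_true M (M - ?F b) y" if xy: "(x, y) \<in> Q" for x y
      proof -
        \<comment> \<open>A rule with a removed head \<open>u\<close> must hold by its other item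
          \<open>q\<close>. If \<open>q\<close> failed, it would be a body atom left in
          \<open>M\<close>, which precedes \<open>u\<close> and so was removed as well; or an atom
          outside \<open>M\<close>, which supports \<open>a\<close>; or another removed head, and
          mutual reachability with \<open>u\<close> gives unconditional support.\<close>
        have key: False
          if pq: "((1, u), q) \<in> Q" "u \<in> ?F b" "\<not> item_true M (M - ?F b) q" for u q
        proof -
          obtain k v where q: "q = (k, v)" by fastforce
          have ua: "(u, a) \<in> ?G" using scc[OF pq(2)] by blast
          consider "k = 0" | "k \<noteq> 0" "v \<notin> M" | "k = 1" "v \<in> M" "v \<in> ?F b"
            using pq(3) q by (auto simp: item_true_def split: if_splits)
          then show False
          proof cases
            case 1
            then have "v \<in> M" "v \<notin> ?F b" using pq(3) q by (auto simp: item_true_def)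
            moreover have "(v, u) \<in> ?G" using pq(1) q 1 by (auto simp: imps_def)
            ultimately show False using pq(2) by (auto intro: rtrancl_trans)
          next
            case 2
            then have "(v, a) \<in> supports Q"
              using pq(1) q ua by (auto simp: supports_def founds_def)
            with 2 no show False by blast
          next
            case 3
            have "(u, v) \<in> ?G" "(v, u) \<in> ?G"
              using scc[OF pq(2)] scc[OF 3(3)] 3 pq(2) by (auto intro: rtrancl_trans)
            then have "(0, u) \<in> founds Q"
              using pq(1) q 3 by (auto simp: founds_def)
            then have "(0, a) \<in> supports Q"
              using ua by (auto simp: supports_def)
            with assms(3) no show False by blast
          qed
        qed
        have "item_true M M x \<or> item_true M M y"
          using mod xy by (auto simp: red_model_def)
        moreover have "(y, x) \<in> Q" using assms(1) xy by (meson symD)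
        \<comment> \<open>Shrinking the set falsifies no items except head items of removed
          atoms.\<close>
        moreover have "(fst x = 1 \<and> snd x \<in> ?F b) \<or> item_true M (M - ?F b) x" if "item_true M M x" for x
          using that by (auto simp: item_true_def split: if_splits)
        moreover have "item_true M (M - ?F b) q" if "(p, q) \<in> Q" "fst p = 1" "snd p \<in> ?F b" for p q
          using key[of "snd p" q] that by (cases p) auto
        ultimately show ?thesis
          using xy by blast
      qed
      then show ?thesis by (auto simp: red_model_def)
    qed
    moreover have "M - ?F b \<subset> M" using b by auto
    ultimately show False using min by (auto simp: minimal_def)
  qed
next
  assume "red_model Q M M \<and> (\<forall>a\<in>M. \<exists>x. x \<notin> M \<and> (x, a) \<in> supports Q)"
  then show "minimal (red_model Q M) M"
    using red_model_supports unfolding minimal_def by (meson psubsetE subsetI)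
qed

section \<open>Independent sets and branching\<close>

definition neighbours :: "((nat \<times> nat) \<times> (nat \<times> nat)) set \<Rightarrow> nat rel" where
  "neighbours Q = Id \<union> supports Q \<union> (supports Q)\<inverse>"

text \<open>Candidates are represented by their complements in \<open>{..<n}\<close>, which are independent sets of
  \<open>neighbours Q\<close> containing the vertex 0.\<close>

definition good :: "((nat \<times> nat) \<times> (nat \<times> nat)) set \<Rightarrow> nat \<Rightarrow> nat set \<Rightarrow> bool" where
  "good Q n J \<longleftrightarrow> 0 \<in> J \<and> J \<subseteq> {..<n} \<and> red_model Q ({..<n} - J) ({..<n} - J) \<and>
     (\<forall>a<n. a \<notin> J \<longrightarrow> (\<exists>x\<in>J. (x, a) \<in> supports Q))"

text \<open>If both ends of a support were false, \<open>red_model_supports\<close> would force the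
  supported one into the model.\<close>

lemma good_independent:
  assumes "good Q n J" "x \<in> J" "a \<in> J" "(x, a) \<in> neighbours Q"
  shows "x = a"
proof -
  have "b \<notin> J" if "(y, b) \<in> supports Q" "y \<in> J" for y b
    using red_model_supports[of Q "{..<n} - J" "{..<n} - J" y b] assms(1) that by (simp add: good_def)
  then show ?thesis using assms(2-4) unfolding neighbours_def by blast
qed

definition undecided :: "((nat \<times> nat) \<times> (nat \<times> nat)) set \<Rightarrow> nat \<Rightarrow> nat set \<Rightarrow> nat set" where
  "undecided Q n I = {a. a < n \<and> a \<notin> neighbours Q `` I}"

text \<open>The answers for which a node of the search tree is responsible; \<open>I\<close> holds
  its chosen and \<open>F\<close> its forbidden vertices.\<close>

definition extensions ::
  "((nat \<times> nat) \<times> (nat \<times> nat)) set \<Rightarrow> nat \<Rightarrow> nat set \<times> nat set \<Rightarrow> nat set set" where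
  "extensions Q n = (\<lambda>(I, F). {J. good Q n J \<and> I \<subseteq> J \<and> J \<inter> F = {}})"

definition children :: "nat set \<times> nat set \<Rightarrow> nat list \<Rightarrow> (nat set \<times> nat set) list" where
  "children = (\<lambda>(I, F) us. map (\<lambda>i. (insert (us ! i) I, F \<union> set (take i us))) [0..<length us])"

lemma children_Nil [simp]: "children f [] = []"
  by (simp add: children_def split: prod.split)

lemma children_snoc:
  "children (I, F) (us @ [u]) = children (I, F) us @ [(insert u I, F \<union> set us)]"
  by (auto simp: children_def nth_append)

text \<open>With nothing undecided, a vertex of \<open>J\<close> outside \<open>I\<close> would be
  adjacent to a member of \<open>I\<close>, against independence. Neither the model property nor
  directed support follows, hence the case distinction.\<close>

lemma extensions_leaf:
  assumes "undecided Q n I = {}" "0 \<in> I" "I \<subseteq> {..<n}" "I \<inter> F = {}"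
  shows "extensions Q n (I, F) = (if good Q n I then {I} else {})"
proof -
  have "J = I" if J: "good Q n J" "I \<subseteq> J" for J
  proof -
    have "a \<in> I" if "a \<in> J" for a
    proof -
      have "a < n" using J that by (auto simp: good_def)
      then obtain u where "u \<in> I" "(u, a) \<in> neighbours Q" using assms(1) by (auto simp: undecided_def)
      then show ?thesis using good_independent[of Q n J u a] J that by auto
    qed
    then show ?thesis using J by blast
  qed
  then show ?thesis using assms by (auto simp: extensions_def)
qed

text \<open>Branching over one closed neighbourhood is complete: if \<open>v\<close> is not in
  \<open>J\<close>, it is a true atom with a supporter in \<open>J\<close>. The supporter is
  adjacent to \<open>v\<close>, it is not in \<open>I\<close> because \<open>v\<close> is uncovered,
  and so by independence it is itself undecided.\<close>

lemma good_meets_neighbourhood: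
  assumes "good Q n J" "I \<subseteq> J" "v \<in> undecided Q n I"
  shows "\<exists>u\<in>J. u \<in> undecided Q n I \<and> (v, u) \<in> neighbours Q"
proof -
  have J: "a \<in> undecided Q n I" if "a \<in> J" "a \<notin> I" for a
  proof -
    have "a < n" using assms(1) that by (auto simp: good_def)
    moreover have "a \<notin> neighbours Q `` I"
      using good_independent[OF assms(1) _ that(1)] assms(2) that(2) by blast
    ultimately show ?thesis by (simp add: undecided_def)
  qed
  have "v \<notin> I" using assms(3) by (auto simp: undecided_def neighbours_def)
  show ?thesis
  proof (cases "v \<in> J")
    case True
    then show ?thesis using assms(3) by (auto simp: neighbours_def)
  next
    case False
    then obtain x where x: "x \<in> J" "(x, v) \<in> supports Q"
      using assms(1,3) by (auto simp: good_def undecided_def)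
    then have "x \<notin> I" using assms(3) by (auto simp: undecided_def neighbours_def)
    then show ?thesis using J x by (auto simp: neighbours_def)
  qed
qed

text \<open>\<open>J\<close> belongs only to the child of the first member of \<open>us\<close> that
  it contains: earlier children choose vertices outside \<open>J\<close>, later ones forbid that
  member. Counting children, rather than asking for one, also excludes repetitions.\<close>

lemma count_children:
  assumes "distinct us" "set us \<inter> F = {}"
  shows "length (filter (\<lambda>f. J \<in> extensions Q n f) (children (I, F) us)) =
    (if J \<in> extensions Q n (I, F) \<and> J \<inter> set us \<noteq> {} then 1 else 0)"
  using assms
proof (induction us rule: rev_induct)
  case (snoc u us)
  then show ?case by (auto simp: children_snoc extensions_def)
qed auto

lemma card_undecided_insert:
  assumes "u \<in> undecided Q n I"
  shows "card (undecided Q n (insert u I)) =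
    card (undecided Q n I) - card {w \<in> undecided Q n I. (u, w) \<in> neighbours Q}"
proof -
  have "undecided Q n (insert u I) = undecided Q n I - {w \<in> undecided Q n I. (u, w) \<in> neighbours Q}"
    by (auto simp: undecided_def)
  moreover have "finite (undecided Q n I)" by (simp add: undecided_def)
  ultimately show ?thesis by (simp add: card_Diff_subset)
qed

section \<open>The base of the exponential and the cost recurrence\<close>

abbreviation (input) growth :: real where "growth \<equiv> root 3 3"

lemma growth_bounds: "1.4422 \<le> growth" "growth < 1.4423"
proof -
  have "(1.4422::real) ^ 3 \<le> 3" "(3::real) < 1.4423 ^ 3" by (simp_all add: power3_eq_cube)
  then show "1.4422 \<le> growth" "growth < 1.4423"
    using real_root_le_mono[of 3 "1.4422 ^ 3" 3] real_root_less_mono[of 3 3 "1.4423 ^ 3"]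
    by (simp_all add: real_root_power_cancel)
qed

lemma growth_power: "3 powr (real n / 3) = growth ^ n"
  by (simp add: root_powr_inverse powr_powr flip: powr_realpow)

text \<open>The worst branching number is 3, where equality holds; this dictates the base. Raising
  \<open>s\<close> by 3 triples the right side, and s + 3 \<le> 3s from s = 2 on, so the values 0 to
  4 start the induction.\<close>

lemma nat_le_growth_power: "real s \<le> growth ^ s"
proof -
  have cube: "growth ^ 3 = 3" by simp
  have 3: "real s \<le> growth ^ s \<Longrightarrow> s \<ge> 2 \<Longrightarrow> real (s + 3) \<le> growth ^ (s + 3)" for s
    by (simp only: power_add cube)
  show ?thesis
  proof (induction s rule: less_induct)
    case (less s)
    have g2: "1.4422 * 1.4422 \<le> growth * growth"
      using growth_bounds by (intro mult_mono) auto
    consider "s = 0" | "s = 1" | "s = 2" | "s = 3" | "s = 4" | "s \<ge> 5" by linarith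
    then show ?case
    proof cases
      case 5
      have "growth ^ 4 = growth ^ 3 * growth" by (simp only: power_add[symmetric] power_Suc2[symmetric]) simp
      then show ?thesis using 5 cube growth_bounds by simp
    next
      case 6
      then show ?thesis using less[of "s - 3"] 3[of "s - 3"] by simp
    qed (use growth_bounds g2 cube in \<open>auto simp: power2_eq_square\<close>)
  qed
qed

text \<open>The solution of
  \<open>potential (Suc j) = (j + 2)\<^sup>2 + growth * potential j\<close> with initial value 1. It
  bounds the cost of the subtree below a node with \<open>j\<close> undecided vertices, in units of
  the linear factor.\<close>

definition potential :: "nat \<Rightarrow> real" where
  "potential j = (\<Sum>i\<le>j. (real i + 1)\<^sup>2 * growth ^ (j - i))"

lemma potential_0: "potential 0 = 1"
  by (simp add: potential_def)

lemma potential_Suc: "potential (Suc j) = (real j + 2)\<^sup>2 + growth * potential j"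
proof -
  have "(\<Sum>i\<le>j. (real i + 1)\<^sup>2 * growth ^ (Suc j - i)) = growth * potential j"
    unfolding potential_def sum_distrib_left by (intro sum.cong) (auto simp: Suc_diff_le)
  then show ?thesis by (simp add: potential_def add.commute)
qed

lemma potential_nonneg: "0 \<le> potential j"
  unfolding potential_def by (intro sum_nonneg) auto

lemma potential_growth: "growth ^ s * potential j \<le> potential (s + j)"
proof (induction s)
  case (Suc s)
  have "growth ^ Suc s * potential j \<le> growth * potential (s + j)"
    using Suc by (simp add: mult.assoc)
  then show ?case by (simp add: potential_Suc add_increasing)
qed simp

lemma potential_mono: "i \<le> j \<Longrightarrow> potential i \<le> potential j"
proof -
  assume "i \<le> j"
  have "1 * potential i \<le> growth ^ (j - i) * potential i"
    using growth_bounds(1) by (intro mult_right_mono one_le_power potential_nonneg) auto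
  then show ?thesis using potential_growth[of "j - i" i] \<open>i \<le> j\<close> by simp
qed

text \<open>Of the \<open>s\<close> factors in \<open>growth ^ s\<close>, all but one lift
  \<open>potential (j - s)\<close> to \<open>potential (j - 1)\<close>; the last one is used up by
  the recurrence, which pays for the node itself.\<close>

lemma potential_branch:
  assumes "1 \<le> s" "s \<le> j"
  shows "(real j + 1)\<^sup>2 + real s * potential (j - s) \<le> potential j"
proof -
  obtain i where j: "j = Suc i" using assms by (cases j) auto
  have "real s * potential (j - s) \<le> growth ^ s * potential (j - s)"
    by (intro mult_right_mono nat_le_growth_power potential_nonneg)
  also have "\<dots> = growth * (growth ^ (s - 1) * potential (i - (s - 1)))"
    using assms j by (cases s) auto
  also have "\<dots> \<le> growth * potential i"
    using potential_growth[of "s - 1" "i - (s - 1)"] assms j by (intro mult_left_mono) auto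
  finally show ?thesis by (simp add: j potential_Suc add.commute)
qed

lemma potential_le: "potential j \<le> 71 * growth ^ j"
proof -
  \<comment> \<open>The induction needs a reserve q(j) = 3j^2 + 23j + 70 with (j + 2)^2 + q(j + 1)
    \<le> 1.4422 q(j). The sum then grows at most by the factor \<open>growth\<close> per step, and
    71 is its value at 0.\<close>
  have "potential j + (3 * real j ^ 2 + 23 * real j + 70) \<le> 71 * growth ^ j"
  proof (induction j)
    case (Suc j)
    let ?q = "3 * real j ^ 2 + 23 * real j + 70"
    have "1.4422 * ?q \<le> growth * ?q"
      using growth_bounds by (intro mult_right_mono) auto
    moreover have "growth * (potential j + ?q) \<le> growth * (71 * growth ^ j)"
      using Suc by (intro mult_left_mono) auto
    moreover have "(real j + 2)\<^sup>2 + (3 * (real (Suc j))\<^sup>2 + 23 * real (Suc j) + 70) \<le> 1.4422 * ?q"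
      by (simp add: power2_eq_square algebra_simps)
    ultimately show ?case by (simp add: potential_Suc algebra_simps)
  qed (simp add: potential_0)
  moreover have "0 \<le> 3 * real j ^ 2 + 23 * real j + 70" by simp
  ultimately show ?thesis by linarith
qed

text \<open>Absorbs the cubic cost of building the graph. The cube of 10/9 is still below
  \<open>growth\<close>, and Bernoulli's inequality compares powers of 10/9 with a linear function;
  729 is 9^3.\<close>

lemma cube_le_growth: "(real n + 1) ^ 3 \<le> 729 * growth ^ n"
proof -
  have "1 + real n * (1 / 9) \<le> (1 + 1 / 9) ^ n"
    by (rule Bernoulli_inequality) simp
  then have "real n + 1 \<le> 9 * (10 / 9) ^ n" by simp
  then have "(real n + 1) ^ 3 \<le> (9 * (10 / 9) ^ n) ^ 3"
    by (intro power_mono) auto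
  also have "\<dots> = 729 * ((10 / 9) ^ 3) ^ n"
    by (simp add: power_mult_distrib mult.commute flip: power_mult)
  also have "\<dots> \<le> 729 * growth ^ n"
    using growth_bounds by (intro mult_left_mono power_mono) (auto simp: power3_eq_cube)
  finally show ?thesis .
qed


section \<open>Building the graph\<close>

definition rel :: "(nat \<Rightarrow> nat) \<Rightarrow> nat \<Rightarrow> nat rel" where
  "rel f n = {(i, j). i < n \<and> j < n \<and> f (i * n + j) \<noteq> 0}"

lemma row_major_inject:
  fixes i j n i' j' :: nat
  assumes "j < n" "j' < n"
  shows "i * n + j = i' * n + j' \<longleftrightarrow> i = i' \<and> j = j'"
proof
  assume eq: "i * n + j = i' * n + j'"
  then have "(i * n + j) div n = (i' * n + j') div n" by simp
  with assms have "i = i'" by simp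
  with eq show "i = i' \<and> j = j'" by simp
qed simp

lemma rel_upd:
  assumes "i < n" "j < n" "v \<noteq> 0"
  shows "rel (f(i * n + j := v)) n = insert (i, j) (rel f n)"
  using assms by (auto simp: rel_def row_major_inject)

lemma rel_upd_row0:
  assumes "j < n" "v \<noteq> 0"
  shows "rel (f(j := v)) n = insert (0, j) (rel f n)"
  using rel_upd[of 0 n j v f] assms by simp

lemma rel_zero: "(\<And>i. f i = 0) \<Longrightarrow> rel f n = {}"
  by (auto simp: rel_def)

definition offsets :: "ram_state \<Rightarrow> bool" where
  "offsets s \<longleftrightarrow> (\<forall>i<reg s 7. arr s 8 i = i * reg s 7)"

text \<open>For loops that only add matrix entries, where the contribution \<open>D k\<close> of a
  round is determined before the loop. Warshall's loops read the matrix that they write and need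
  their own argument.\<close>

lemma For_union:
  assumes ok: "i \<notin> regs c" "i \<noteq> 2" "n \<notin> regs (For i n c)"
    and step: "\<And>k t. k < reg s n \<Longrightarrow> reg t i = k \<Longrightarrow>
      (\<And>r. r \<notin> regs (For i n c) \<Longrightarrow> reg t r = reg s r) \<Longrightarrow>
      (\<And>A. A \<notin> arrs c \<Longrightarrow> arr t A = arr s A) \<Longrightarrow>
      rel (arr (sem c t) A) N = rel (arr t A) N \<union> D k"
  shows "rel (arr (sem (For i n c) s) A) N = rel (arr s A) N \<union> (\<Union>k<reg s n. D k)"
proof (rule For_rule[where P = "\<lambda>k t. rel (arr t A) N = rel (arr s A) N \<union> (\<Union>k<k. D k)", OF ok])
  fix k and t :: ram_state
  assume a: "k < reg s n" "rel (arr t A) N = rel (arr s A) N \<union> (\<Union>k<k. D k)" "reg t i = k"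
      "\<And>r. r \<notin> regs (For i n c) \<Longrightarrow> reg t r = reg s r" "\<And>A. A \<notin> arrs c \<Longrightarrow> arr t A = arr s A"
  show "rel (arr (bump i (sem c t)) A) N = rel (arr s A) N \<union> (\<Union>k<Suc k. D k)"
    using step[of k t] a by (auto simp: lessThan_Suc)
qed simp

text \<open>Numbers are given in the order of first occurrence and start at 1: a 0 in array 6 means
  not yet seen, and 0 stays free for the extra vertex. Scanning first items suffices, since every
  pair is stored in both orders.\<close>

definition index_atoms :: cmd where
  "index_atoms = For 10 5 (Do (Load 11 3 10) ;; Do (Load 12 6 11) ;;
     Branch (Equal 12 4)
       (Do (Const 12 1) ;; Do (Add 7 7 12) ;; Do (Store 6 11 7) ;; Do (Store 7 7 11)) Nop)"

definition set_offsets :: cmd where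
  "set_offsets = Do (Const 11 0) ;;
     For 10 7 (Do (Store 8 10 11) ;; Do (Add 11 11 7))"

definition diagonal :: "nat \<Rightarrow> cmd" where
  "diagonal A = Do (Const 15 1) ;; For 10 7 (put A 10 10 15)"

text \<open>Matrix 9 receives \<open>imps\<close>, matrix 10 the first part of
  \<open>founds\<close>, matrix 11 the pairs of two heads. The row is that of the second atom, the
  source of the edge. A head in second place is treated when the converse pair is read.\<close>

definition read_pairs :: cmd where
  "read_pairs = For 10 5 (Do (Load 11 3 10) ;; Do (Load 11 6 11) ;; Do (Load 12 5 10) ;;
     Do (Load 12 6 12) ;; Do (Load 13 2 10) ;; Do (Load 14 4 10) ;; Do (Const 15 1) ;;
     Branch (Equal 13 15)
       (Branch (Equal 14 4) (put 9 12 11 15)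
          (put 10 12 11 15 ;; Branch (Equal 14 15) (put 11 12 11 15) Nop)) Nop)"

definition warshall :: cmd where
  "warshall = For 10 7 (For 11 7 (For 12 7 (get 13 9 11 10 ;; get 14 9 10 12 ;;
     when_nz 13 (when_nz 14 (Do (Const 15 1) ;; put 9 11 12 15)))))"

text \<open>Register 4 holds 0, so \<open>put 10 4 10 16\<close> writes into row 0, the row of
  unconditional support.\<close>

definition mark_mutual :: cmd where
  "mark_mutual = For 10 7 (For 11 7 (get 13 11 10 11 ;; get 14 9 10 11 ;; get 15 9 11 10 ;;
     when_nz 13 (when_nz 14 (when_nz 15 (Do (Const 16 1) ;; put 10 4 10 16)))))"

definition compose_supports :: cmd where
  "compose_supports = For 10 7 (For 11 7 (For 12 7 (get 13 10 10 11 ;; get 14 9 11 12 ;;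
     when_nz 13 (when_nz 14 (Do (Const 15 1) ;; put 12 10 12 15)))))"

definition symmetrize :: cmd where
  "symmetrize = For 10 7 (For 11 7 (get 13 12 10 11 ;; Do (Const 15 1) ;;
     when_nz 13 (put 13 10 11 15 ;; put 13 11 10 15)))"

text \<open>The final increment counts the vertex 0. This program is kept apart from
  \<open>build_graph\<close>, where register 7 is a loop bound and must not be written.\<close>

definition number_atoms :: cmd where
  "number_atoms = index_atoms ;; Do (Const 12 1) ;; Do (Add 7 7 12)"

definition build_graph :: cmd where
  "build_graph = set_offsets ;; diagonal 9 ;; read_pairs ;; warshall ;; mark_mutual ;;
     compose_supports ;; diagonal 13 ;; symmetrize"

definition stored :: "((nat \<times> nat) \<times> (nat \<times> nat)) list \<Rightarrow> ram_state \<Rightarrow> bool" where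
  "stored ql s \<longleftrightarrow> reg s 5 = length ql \<and>
     (\<forall>i<length ql. ql ! i = ((arr s 2 i, arr s 3 i), (arr s 4 i, arr s 5 i)))"

definition indexed :: "nat set \<Rightarrow> nat \<Rightarrow> (nat \<Rightarrow> nat) \<Rightarrow> (nat \<Rightarrow> nat) \<Rightarrow> bool" where
  "indexed X n v w \<longleftrightarrow> bij_betw v X {1..n} \<and> (\<forall>a\<in>X. w (v a) = a) \<and> (\<forall>a. a \<notin> X \<longrightarrow> v a = 0)"

lemma indexed_insert:
  assumes "indexed X n v w" "a \<notin> X"
  shows "indexed (insert a X) (Suc n) (v(a := Suc n)) (w(Suc n := a))"
proof -
  have bij: "bij_betw v X {1..n}" using assms(1) by (simp add: indexed_def)
  then have mem: "v b \<in> {1..n}" if "b \<in> X" for b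
    using that by (rule bij_betwE[THEN bspec])
  have "bij_betw (v(a := Suc n)) X {1..n}"
    using bij assms(2) by (subst bij_betw_cong[where g = v]) auto
  moreover have "bij_betw (v(a := Suc n)) {a} {Suc n}"
    by (simp add: bij_betw_def)
  ultimately have "bij_betw (v(a := Suc n)) (insert a X) (insert (Suc n) {1..n})"
    using bij_betw_combine[of _ "{a}" "{Suc n}" X] by simp
  moreover have "insert (Suc n) {1..n} = {1..Suc n}" by auto
  moreover have "(w(Suc n := a)) ((v(a := Suc n)) b) = b" if "b \<in> insert a X" for b
  proof (cases "b = a")
    case False
    then have "v b \<noteq> Suc n" "w (v b) = b"
      using mem[of b] that assms(1) by (auto simp: indexed_def)
    then show ?thesis using False by simp
  qed simp
  ultimately show ?thesis using assms(1) by (auto simp: indexed_def)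
qed

lemma index_atoms_sem:
  assumes "stored ql s" "reg s 4 = 0" "reg s 7 = 0" "\<And>i. arr s 6 i = 0"
  defines "t \<equiv> sem index_atoms s"
  shows "indexed ((snd \<circ> fst) ` set ql) (reg t 7) (arr t 6) (arr t 7)"
proof -
  let ?X = "\<lambda>k. (\<lambda>q. snd (fst q)) ` set (take k ql)"
  have "indexed (?X (reg s 5)) (reg t 7) (arr t 6) (arr t 7)"
    unfolding t_def index_atoms_def
  proof (rule For_rule[where P = "\<lambda>k t. indexed (?X k) (reg t 7) (arr t 6) (arr t 7)"])
    fix k and t :: ram_state
    let ?c = "Do (Load 11 3 10) ;; Do (Load 12 6 11) ;; Branch (Equal 12 4)
       (Do (Const 12 1) ;; Do (Add 7 7 12) ;; Do (Store 6 11 7) ;; Do (Store 7 7 11)) Nop"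
    assume a: "k < reg s 5" "indexed (?X k) (reg t 7) (arr t 6) (arr t 7)" "reg t 10 = k"
      "\<And>r. r \<notin> regs (For 10 5 ?c) \<Longrightarrow> reg t r = reg s r" "\<And>A. A \<notin> arrs ?c \<Longrightarrow> arr t A = arr s A"
    let ?a = "arr s 3 k"
    have k: "k < length ql" "snd (fst (ql ! k)) = ?a" using a(1) assms(1) by (auto simp: stored_def)
    then have X: "?X (Suc k) = insert ?a (?X k)" by (simp add: take_Suc_conv_app_nth)
    have z: "reg t 4 = 0" using a(4)[of 4] assms(2) by simp
    have l: "arr t 3 = arr s 3" using a(5)[of 3] by simp
    show "indexed (?X (Suc k)) (reg (bump 10 (sem ?c t)) 7) (arr (bump 10 (sem ?c t)) 6)
       (arr (bump 10 (sem ?c t)) 7)"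
    proof (cases "arr t 6 ?a = 0")
      case False
      then have "?a \<in> ?X k" using a(2) by (auto simp: indexed_def)
      then have "?X (Suc k) = ?X k" unfolding X by blast
      then show ?thesis using False a(2,3) z l by simp
    next
      case True
      then have "?a \<notin> ?X k"
        using a(2) bij_betwE[of "arr t 6" "?X k" "{1..reg t 7}"] by (force simp: indexed_def)
      from indexed_insert[OF a(2) this]
      have "indexed (?X (Suc k)) (Suc (reg t 7)) ((arr t 6)(?a := Suc (reg t 7)))
          ((arr t 7)(Suc (reg t 7) := ?a))"
        unfolding X .
      then show ?thesis using True a(3) z l by (simp add: Suc_eq_plus1)
    qed
  qed (use assms in \<open>auto simp: indexed_def bij_betw_def\<close>)
  then show ?thesis using assms(1) by (simp add: stored_def comp_def)
qed

lemma set_offsets_sem: "offsets (sem set_offsets s)"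
proof -
  let ?c = "Do (Store 8 10 11) ;; Do (Add 11 11 7)"
  have "(\<forall>i<reg s 7. arr (sem (For 10 7 ?c) s) 8 i = i * reg s 7) \<and>
      reg (sem (For 10 7 ?c) s) 11 = reg s 7 * reg s 7" if "reg s 11 = 0" for s
    by (rule For_rule[where P = "\<lambda>k t. (\<forall>i<k. arr t 8 i = i * reg s 7) \<and> reg t 11 = k * reg s 7"])
      (auto simp: less_Suc_eq that)
  from this[of "set_reg 11 0 s"] show ?thesis
    unfolding offsets_def set_offsets_def by (simp add: sem_reg_frame del: sem.simps(5))
qed

lemma diagonal_sem:
  assumes "offsets s" "A \<noteq> 8"
  shows "rel (arr (sem (diagonal A) s) A) (reg s 7) = rel (arr s A) (reg s 7) \<union> Id_on {..<reg s 7}"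
proof -
  let ?s = "set_reg 15 1 s"
  have "rel (arr (sem (For 10 7 (put A 10 10 15)) ?s) A) (reg s 7) =
      rel (arr ?s A) (reg s 7) \<union> (\<Union>k<reg ?s 7. {(k, k)})"
    by (rule For_union) (use assms in \<open>auto simp: offsets_def rel_upd\<close>)
  then show ?thesis by (simp add: diagonal_def Id_on_def del: sem.simps(5))
qed

text \<open>The closure is cut to the square because it contains the identity on all numbers; inside
  the square, reflexivity comes from the diagonal set beforehand.\<close>

lemma warshall_sem:
  assumes "offsets s" "reg s 4 = 0" "Id_on {..<reg s 7} \<subseteq> rel (arr s 9) (reg s 7)"
  shows "rel (arr (sem warshall s) 9) (reg s 7) =
    (rel (arr s 9) (reg s 7))\<^sup>* \<inter> {..<reg s 7} \<times> {..<reg s 7}"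
proof -
  define n where "n = reg s 7"
  let ?c = "get 13 9 11 10 ;; get 14 9 10 12 ;;
     when_nz 13 (when_nz 14 (Do (Const 15 1) ;; put 9 11 12 15))"
  let ?R = "\<lambda>s. rel (arr s 9) n"
  let ?A = "\<lambda>s. offsets s \<and> reg s 4 = 0 \<and> reg s 7 = n"
  let ?D = "\<lambda>s i j k. {(x, y). x = i \<and> y = j \<and> (i, k) \<in> ?R s \<and> (k, j) \<in> ?R s}"
  have body: "?R (sem ?c s) = ?R s \<union> ?D s i j k"
    if "?A s" "reg s 10 = k" "reg s 11 = i" "reg s 12 = j" "i < n" "j < n" "k < n" for s i j k
  proof -
    have off: "arr s 8 i = i * n" "arr s 8 k = k * n" using that by (auto simp: offsets_def)
    have "(x, y) \<in> ?R s \<longleftrightarrow> arr s 9 (x * n + y) \<noteq> 0" if "x < n" "y < n" for x y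
      using that by (simp add: rel_def)
    then have mem: "(i, k) \<in> ?R s \<longleftrightarrow> 0 < arr s 9 (i * n + k)" "(k, j) \<in> ?R s \<longleftrightarrow> 0 < arr s 9 (k * n + j)"
      using that by simp_all
    show ?thesis
    proof (cases "(i, k) \<in> ?R s \<and> (k, j) \<in> ?R s")
      case True
      then have "arr (sem ?c s) 9 = (arr s 9)(i * n + j := 1)" using mem that off by simp
      then show ?thesis using True that by (auto simp: rel_upd simp del: sem.simps)
    next
      case False
      then have "arr (sem ?c s) 9 = arr s 9" using mem that off by auto
      then show ?thesis using False by (auto simp del: sem.simps)
    qed
  qed
  have A: "?A t" if "?A s" "\<And>r. r = 7 \<or> r = 4 \<Longrightarrow> reg t r = reg s r" "arr t 8 = arr s 8" for s t :: ram_state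
    using that by (auto simp: offsets_def)
  have row: "?R (sem (For 12 7 ?c) s) = ?R s \<union> (\<Union>j<n. ?D s i j k)"
    if s: "?A s" "reg s 10 = k" "reg s 11 = i" "i < n" "k < n" for s i k
  proof -
    have "?R (sem (For 12 7 ?c) s) = ?R s \<union> (\<Union>j<reg s 7. ?D s i j k)"
    proof (rule For_rule[where P = "\<lambda>m t. ?R t = ?R s \<union> (\<Union>j<m. ?D s i j k)"])
      fix m and t :: ram_state
      assume a: "m < reg s 7" "?R t = ?R s \<union> (\<Union>j<m. ?D s i j k)" "reg t 12 = m"
        "\<And>r. r \<notin> regs (For 12 7 ?c) \<Longrightarrow> reg t r = reg s r" "\<And>A. A \<notin> arrs ?c \<Longrightarrow> arr t A = arr s A"
      have "?A t" by (rule A[OF s(1)]) (auto simp: a(4,5))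
      then have "?R (sem ?c t) = ?R t \<union> ?D t i m k"
        using s a(1,3) by (intro body) (auto simp: a(4))
      \<comment> \<open>The update is in place, but round \<open>k\<close> leaves row and column
        \<open>k\<close> unchanged: a new pair (i, k) or (k, j) would have to be its own
        premise.\<close>
      moreover have "?D t i m k \<subseteq> ?D s i m k" "?D s i m k \<subseteq> ?D t i m k" using a(2) by auto
      ultimately show "?R (bump 12 (sem ?c t)) = ?R s \<union> (\<Union>j<Suc m. ?D s i j k)"
        using a(2) by (auto simp: lessThan_Suc simp del: sem.simps)
    qed auto
    then show ?thesis using s by simp
  qed
  have round: "?R (sem (For 11 7 (For 12 7 ?c)) s) = ?R s \<union> (\<Union>i<n. \<Union>j<n. ?D s i j k)"
    if s: "?A s" "reg s 10 = k" "k < n" for s k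
  proof -
    have "?R (sem (For 11 7 (For 12 7 ?c)) s) = ?R s \<union> (\<Union>i<reg s 7. \<Union>j<n. ?D s i j k)"
    proof (rule For_rule[where P = "\<lambda>m t. ?R t = ?R s \<union> (\<Union>i<m. \<Union>j<n. ?D s i j k)"])
      fix m and t :: ram_state
      assume a: "m < reg s 7" "?R t = ?R s \<union> (\<Union>i<m. \<Union>j<n. ?D s i j k)" "reg t 11 = m"
        "\<And>r. r \<notin> regs (For 11 7 (For 12 7 ?c)) \<Longrightarrow> reg t r = reg s r"
        "\<And>A. A \<notin> arrs (For 12 7 ?c) \<Longrightarrow> arr t A = arr s A"
      have "?A t" by (rule A[OF s(1)]) (auto simp: a(4,5))
      then have "?R (sem (For 12 7 ?c) t) = ?R t \<union> (\<Union>j<n. ?D t m j k)"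
        using s a(1,3) by (intro row) (auto simp: a(4))
      moreover have "?D t m j k = ?D s m j k" for j using a(2) by auto
      ultimately show "?R (bump 11 (sem (For 12 7 ?c) t)) = ?R s \<union> (\<Union>i<Suc m. \<Union>j<n. ?D s i j k)"
        using a(2) by (auto simp: lessThan_Suc simp del: sem.simps)
    qed auto
    then show ?thesis using s by simp
  qed
  let ?W = "For 11 7 (For 12 7 ?c)"
  \<comment> \<open>Closure under composition at every intermediate vertex below \<open>m\<close>
    avoids talking about paths; after the last round it is transitivity within the square.\<close>
  let ?P = "\<lambda>m t. ?R s \<subseteq> ?R t \<and> ?R t \<subseteq> (?R s)\<^sup>* \<and>
    (\<forall>l<m. \<forall>i j. (i, l) \<in> ?R t \<longrightarrow> (l, j) \<in> ?R t \<longrightarrow> (i, j) \<in> ?R t)"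
  have s: "?A s" using assms by (simp add: n_def)
  have "?P (reg s 7) (sem (For 10 7 ?W) s)"
  proof (rule For_rule[where P = ?P])
    fix m and t :: ram_state
    assume a: "m < reg s 7" "?P m t" "reg t 10 = m"
      "\<And>r. r \<notin> regs (For 10 7 ?W) \<Longrightarrow> reg t r = reg s r" "\<And>A. A \<notin> arrs ?W \<Longrightarrow> arr t A = arr s A"
    have "?A t" by (rule A[OF s]) (auto simp: a(4,5))
    then have "?R (sem ?W t) = ?R t \<union> (\<Union>i<n. \<Union>j<n. ?D t i j m)"
      using s a(1,3) by (intro round) auto
    also have "\<dots> = ?R t \<union> {(i, j). (i, m) \<in> ?R t \<and> (m, j) \<in> ?R t}"
      by (auto simp: rel_def)
    finally have eq: "?R (bump 10 (sem ?W t)) = ?R t \<union> {(i, j). (i, m) \<in> ?R t \<and> (m, j) \<in> ?R t}"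
      by (simp del: sem.simps)
    have sound: "{(i, j). (i, m) \<in> ?R t \<and> (m, j) \<in> ?R t} \<subseteq> (?R s)\<^sup>*"
      using a(2) by (auto intro: rtrancl_trans)
    have trans: "(i, j) \<in> ?R (bump 10 (sem ?W t))"
      if "l < Suc m" "(i, l) \<in> ?R (bump 10 (sem ?W t))" "(l, j) \<in> ?R (bump 10 (sem ?W t))" for i j l
    proof -
      have IH: "(i, j) \<in> ?R t" if "l < m" "(i, l) \<in> ?R t" "(l, j) \<in> ?R t" for i j l
        using a(2) that by blast
      show ?thesis using that IH unfolding eq less_Suc_eq by blast
    qed
    show "?P (Suc m) (bump 10 (sem ?W t))"
    proof (intro conjI allI impI)
      show "?R s \<subseteq> ?R (bump 10 (sem ?W t))" "?R (bump 10 (sem ?W t)) \<subseteq> (?R s)\<^sup>*"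
        using a(2) sound unfolding eq by blast+
    qed (rule trans)
  qed auto
  then have P: "?P n (sem warshall s)" unfolding n_def warshall_def .
  have box: "?R t \<subseteq> {..<n} \<times> {..<n}" for t :: ram_state by (auto simp: rel_def)
  have "(i, j) \<in> ?R (sem warshall s)" if "(i, j) \<in> (?R s)\<^sup>*" "i < n" for i j
    using that
  proof (induction rule: rtrancl_induct)
    case base
    then show ?case using P assms(3) by (auto simp: n_def)
  next
    case (step y z)
    then show ?case using P box[of s] by blast
  qed
  then show ?thesis using P box[of "sem warshall s"] unfolding n_def by auto
qed

lemma mark_mutual_sem:
  assumes "offsets s" "reg s 4 = 0"
  defines "R \<equiv> \<lambda>A. rel (arr s A) (reg s 7)"
  shows "rel (arr (sem mark_mutual s) 10) (reg s 7) =
    R 10 \<union> {(0, u) | u v. (u, v) \<in> R 11 \<and> (u, v) \<in> R 9 \<and> (v, u) \<in> R 9}"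
proof -
  let ?c = "get 13 11 10 11 ;; get 14 9 10 11 ;; get 15 9 11 10 ;;
     when_nz 13 (when_nz 14 (when_nz 15 (Do (Const 16 1) ;; put 10 4 10 16)))"
  let ?D = "\<lambda>i j. {(0, u) | u v. u = i \<and> v = j \<and> (u, v) \<in> R 11 \<and> (u, v) \<in> R 9 \<and> (v, u) \<in> R 9}"
  have row: "rel (arr (sem (For 11 7 ?c) t) 10) (reg s 7) = rel (arr t 10) (reg s 7) \<union> (\<Union>j<reg t 7. ?D i j)"
    if "i < reg s 7" "reg t 10 = i" "reg t 7 = reg s 7" "reg t 4 = 0" "arr t 8 = arr s 8"
      "arr t 9 = arr s 9" "arr t 11 = arr s 11" for i t
    using that assms by (intro For_union) (auto simp: R_def offsets_def rel_upd_row0, auto simp: rel_def)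
  have "rel (arr (sem mark_mutual s) 10) (reg s 7) = rel (arr s 10) (reg s 7) \<union> (\<Union>i<reg s 7. \<Union>j<reg s 7. ?D i j)"
    unfolding mark_mutual_def
    by (rule For_union) (use assms in \<open>auto simp: row simp del: sem.simps(5)\<close>)
  then show ?thesis by (auto simp: R_def rel_def)
qed

lemma compose_supports_sem:
  assumes "offsets s" "reg s 4 = 0"
  defines "R \<equiv> \<lambda>A. rel (arr s A) (reg s 7)"
  shows "rel (arr (sem compose_supports s) 12) (reg s 7) = R 12 \<union> R 10 O R 9"
proof -
  let ?c = "get 13 10 10 11 ;; get 14 9 11 12 ;;
     when_nz 13 (when_nz 14 (Do (Const 15 1) ;; put 12 10 12 15))"
  let ?D = "\<lambda>i j k. {(x, z). x = i \<and> z = k \<and> (i, j) \<in> R 10 \<and> (j, k) \<in> R 9}"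
  let ?ok = "\<lambda>t. reg t 7 = reg s 7 \<and> reg t 4 = 0 \<and> arr t 8 = arr s 8 \<and> arr t 9 = arr s 9 \<and> arr t 10 = arr s 10"
  have 1: "rel (arr (sem (For 12 7 ?c) t) 12) (reg s 7) = rel (arr t 12) (reg s 7) \<union> (\<Union>k<reg t 7. ?D i j k)"
    if "i < reg s 7" "j < reg s 7" "reg t 10 = i" "reg t 11 = j" "?ok t" for i j t
    using that assms by (intro For_union) (auto simp: R_def offsets_def rel_upd, auto simp: rel_def)
  have 2: "rel (arr (sem (For 11 7 (For 12 7 ?c)) t) 12) (reg s 7) =
      rel (arr t 12) (reg s 7) \<union> (\<Union>j<reg t 7. \<Union>k<reg s 7. ?D i j k)"
    if "i < reg s 7" "reg t 10 = i" "?ok t" for i t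
    using that assms by (intro For_union) (auto simp: 1 simp del: sem.simps(5))
  have "rel (arr (sem compose_supports s) 12) (reg s 7) =
      rel (arr s 12) (reg s 7) \<union> (\<Union>i<reg s 7. \<Union>j<reg s 7. \<Union>k<reg s 7. ?D i j k)"
    unfolding compose_supports_def
    by (rule For_union) (use assms in \<open>auto simp: 2 simp del: sem.simps(5)\<close>)
  then show ?thesis by (auto simp: R_def rel_def)
qed

definition index_pairs ::
  "(nat \<Rightarrow> nat) \<Rightarrow> ((nat \<times> nat) \<times> (nat \<times> nat)) list \<Rightarrow> ((nat \<times> nat) \<times> (nat \<times> nat)) set" where
  "index_pairs v ql = (\<lambda>((k, a), (l, b)). ((k, v a), (l, v b))) ` set ql"

lemma index_pairs_iff:
  assumes "stored ql s"
  shows "((k, x), (l, y)) \<in> index_pairs v ql \<longleftrightarrow>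
    (\<exists>i<reg s 5. k = arr s 2 i \<and> x = v (arr s 3 i) \<and> l = arr s 4 i \<and> y = v (arr s 5 i))"
  using assms unfolding index_pairs_def stored_def
  by (force simp: image_iff in_set_conv_nth)

lemma read_pairs_sem:
  assumes "stored ql s" "offsets s" "reg s 4 = 0" "\<And>a. arr s 6 a < reg s 7"
  defines "Q \<equiv> index_pairs (arr s 6) ql"
  shows "rel (arr (sem read_pairs s) 9) (reg s 7) = rel (arr s 9) (reg s 7) \<union> imps Q"
    and "rel (arr (sem read_pairs s) 10) (reg s 7) =
      rel (arr s 10) (reg s 7) \<union> {(x, y). \<exists>k. k \<noteq> 0 \<and> ((1, y), (k, x)) \<in> Q}"
    and "rel (arr (sem read_pairs s) 11) (reg s 7) =
      rel (arr s 11) (reg s 7) \<union> {(x, y). ((1, y), (1, x)) \<in> Q}"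
proof -
  let ?q = "\<lambda>i. ((arr s 2 i, arr s 6 (arr s 3 i)), (arr s 4 i, arr s 6 (arr s 5 i)))"
  have Q: "q \<in> Q \<longleftrightarrow> (\<exists>i<reg s 5. q = ?q i)" for q
    unfolding Q_def by (cases q) (auto simp: index_pairs_iff[OF assms(1)])
  have "rel (arr (sem read_pairs s) 9) (reg s 7) =
      rel (arr s 9) (reg s 7) \<union> (\<Union>i<reg s 5. {(x, y). ((1, y), (0, x)) = ?q i})"
    unfolding read_pairs_def
    by (rule For_union) (use assms(2-4) in \<open>auto simp: offsets_def rel_upd\<close>)
  then show "rel (arr (sem read_pairs s) 9) (reg s 7) = rel (arr s 9) (reg s 7) \<union> imps Q"
    by (auto simp: imps_def Q)
  have "rel (arr (sem read_pairs s) 10) (reg s 7) = rel (arr s 10) (reg s 7) \<union>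
      (\<Union>i<reg s 5. {(x, y). \<exists>k. k \<noteq> 0 \<and> ((1, y), (k, x)) = ?q i})"
    unfolding read_pairs_def
    by (rule For_union) (use assms(2-4) in \<open>auto simp: offsets_def rel_upd\<close>)
  then show "rel (arr (sem read_pairs s) 10) (reg s 7) =
      rel (arr s 10) (reg s 7) \<union> {(x, y). \<exists>k. k \<noteq> 0 \<and> ((1, y), (k, x)) \<in> Q}"
    by (auto simp: Q)
  have "rel (arr (sem read_pairs s) 11) (reg s 7) =
      rel (arr s 11) (reg s 7) \<union> (\<Union>i<reg s 5. {(x, y). ((1, y), (1, x)) = ?q i})"
    unfolding read_pairs_def
    by (rule For_union) (use assms(2-4) in \<open>auto simp: offsets_def rel_upd\<close>)
  then show "rel (arr (sem read_pairs s) 11) (reg s 7) =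
      rel (arr s 11) (reg s 7) \<union> {(x, y). ((1, y), (1, x)) \<in> Q}"
    by (auto simp: Q)
qed

lemma symmetrize_sem:
  assumes "offsets s" "reg s 4 = 0"
  defines "R \<equiv> \<lambda>A. rel (arr s A) (reg s 7)"
  shows "rel (arr (sem symmetrize s) 13) (reg s 7) = R 13 \<union> R 12 \<union> (R 12)\<inverse>"
proof -
  let ?c = "get 13 12 10 11 ;; Do (Const 15 1) ;; when_nz 13 (put 13 10 11 15 ;; put 13 11 10 15)"
  let ?D = "\<lambda>i j. {(x, y). (i, j) \<in> R 12 \<and> (x = i \<and> y = j \<or> x = j \<and> y = i)}"
  have row: "rel (arr (sem (For 11 7 ?c) t) 13) (reg s 7) = rel (arr t 13) (reg s 7) \<union> (\<Union>j<reg t 7. ?D i j)"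
    if "i < reg s 7" "reg t 10 = i" "reg t 7 = reg s 7" "reg t 4 = 0" "arr t 8 = arr s 8"
      "arr t 12 = arr s 12" for i t
    using that assms by (intro For_union) (auto simp: R_def offsets_def rel_upd, auto simp: rel_def)
  have "rel (arr (sem symmetrize s) 13) (reg s 7) = rel (arr s 13) (reg s 7) \<union> (\<Union>i<reg s 7. \<Union>j<reg s 7. ?D i j)"
    unfolding symmetrize_def
    by (rule For_union) (use assms in \<open>auto simp: row simp del: sem.simps(5)\<close>)
  then show ?thesis by (auto simp: R_def rel_def)
qed

lemma index_pairs_bounds:
  assumes "\<And>a. v a < n" "((k, x), (l, y)) \<in> index_pairs v ql"
  shows "x < n" "y < n"
  using assms by (auto simp: index_pairs_def)

lemma sym_index_pairs:
  assumes "sym (set ql)"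
  shows "sym (index_pairs v ql)"
proof (rule symI)
  fix x y assume "(x, y) \<in> index_pairs v ql"
  then obtain k a l b where "((k, a), (l, b)) \<in> set ql" and xy: "x = (k, v a)" "y = (l, v b)"
    by (auto simp: index_pairs_def)
  then have "((l, b), (k, a)) \<in> set ql" using assms by (meson symD)
  then show "(y, x) \<in> index_pairs v ql"
    unfolding index_pairs_def xy by (rule rev_image_eqI) simp
qed

text \<open>Support is represented exactly, since it starts at 0 or at a numbered atom and never
  leaves the numbered vertices. The neighbourhood relation has to be cut to the square because of
  its identity part.\<close>

lemma build_graph_sem:
  assumes "stored ql s" "reg s 4 = 0" "\<And>a. arr s 6 a < reg s 7" "\<And>A i. A \<ge> 8 \<Longrightarrow> arr s A i = 0"
    and sym: "sym (set ql)"
  defines "t \<equiv> sem build_graph s" and "Q \<equiv> index_pairs (arr s 6) ql"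
  shows "offsets t" "rel (arr t 12) (reg s 7) = supports Q"
    "rel (arr t 13) (reg s 7) = neighbours Q \<inter> {..<reg s 7} \<times> {..<reg s 7}"
proof -
  define n where "n = reg s 7"
  define s1 where "s1 = sem set_offsets s"
  define s2 where "s2 = sem (diagonal 9) s1"
  define s3 where "s3 = sem read_pairs s2"
  define s4 where "s4 = sem warshall s3"
  define s5 where "s5 = sem mark_mutual s4"
  define s6 where "s6 = sem compose_supports s5"
  define s7 where "s7 = sem (diagonal 13) s6"
  have t: "t = sem symmetrize s7"
    by (simp add: t_def build_graph_def s1_def s2_def s3_def s4_def s5_def s6_def s7_def)
  note defs = set_offsets_def diagonal_def read_pairs_def warshall_def mark_mutual_def
    compose_supports_def symmetrize_def
  have fr1r: "reg s1 r = reg s r" if "r \<in> {4, 5, 7}" for r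
    using that unfolding s1_def by (auto simp: defs sem_reg_frame simp del: sem.simps)
  have fr1a: "arr s1 A = arr s A" if "A \<noteq> 8" for A
    using that unfolding s1_def by (auto simp: defs sem_arr_frame simp del: sem.simps)
  have fr2r: "reg s2 r = reg s1 r" if "r \<in> {4, 5, 7}" for r
    using that unfolding s2_def by (auto simp: defs sem_reg_frame simp del: sem.simps)
  have fr2a: "arr s2 A = arr s1 A" if "A \<noteq> 9" for A
    using that unfolding s2_def by (auto simp: defs sem_arr_frame simp del: sem.simps)
  have fr3r: "reg s3 r = reg s2 r" if "r \<in> {4, 5, 7}" for r
    using that unfolding s3_def by (auto simp: defs sem_reg_frame simp del: sem.simps)
  have fr3a: "arr s3 A = arr s2 A" if "A \<notin> {9, 10, 11}" for A
    using that unfolding s3_def by (auto simp: defs sem_arr_frame simp del: sem.simps)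
  have fr4r: "reg s4 r = reg s3 r" if "r \<in> {4, 5, 7}" for r
    using that unfolding s4_def by (auto simp: defs sem_reg_frame simp del: sem.simps)
  have fr4a: "arr s4 A = arr s3 A" if "A \<noteq> 9" for A
    using that unfolding s4_def by (auto simp: defs sem_arr_frame simp del: sem.simps)
  have fr5r: "reg s5 r = reg s4 r" if "r \<in> {4, 5, 7}" for r
    using that unfolding s5_def by (auto simp: defs sem_reg_frame simp del: sem.simps)
  have fr5a: "arr s5 A = arr s4 A" if "A \<noteq> 10" for A
    using that unfolding s5_def by (auto simp: defs sem_arr_frame simp del: sem.simps)
  have fr6r: "reg s6 r = reg s5 r" if "r \<in> {4, 5, 7}" for r
    using that unfolding s6_def by (auto simp: defs sem_reg_frame simp del: sem.simps)
  have fr6a: "arr s6 A = arr s5 A" if "A \<noteq> 12" for A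
    using that unfolding s6_def by (auto simp: defs sem_arr_frame simp del: sem.simps)
  have fr7r: "reg s7 r = reg s6 r" if "r \<in> {4, 5, 7}" for r
    using that unfolding s7_def by (auto simp: defs sem_reg_frame simp del: sem.simps)
  have fr7a: "arr s7 A = arr s6 A" if "A \<noteq> 13" for A
    using that unfolding s7_def by (auto simp: defs sem_arr_frame simp del: sem.simps)
  have fr8r: "reg t r = reg s7 r" if "r \<in> {4, 5, 7}" for r
    using that unfolding t by (auto simp: defs sem_reg_frame simp del: sem.simps)
  have fr8a: "arr t A = arr s7 A" if "A \<noteq> 13" for A
    using that unfolding t by (auto simp: defs sem_arr_frame simp del: sem.simps)
  note fr = fr1r fr1a fr2r fr2a fr3r fr3a fr4r fr4a fr5r fr5a fr6r fr6a fr7r fr7a fr8r fr8a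
  have o1: "offsets s1" unfolding s1_def by (rule set_offsets_sem)
  then have o: "offsets s2" "offsets s3" "offsets s4" "offsets s5" "offsets s6" "offsets s7" "offsets t"
    by (simp_all add: offsets_def fr)
  then show "offsets t" by blast
  have n: "reg s1 7 = n" "reg s2 7 = n" "reg s3 7 = n" "reg s4 7 = n" "reg s5 7 = n" "reg s6 7 = n"
      "reg s7 7 = n" and z: "reg s1 4 = 0" "reg s2 4 = 0" "reg s3 4 = 0" "reg s4 4 = 0" "reg s5 4 = 0"
      "reg s6 4 = 0" "reg s7 4 = 0"
    using assms(2) by (simp_all add: n_def fr)
  let ?box = "{..<n} \<times> {..<n}"
  have Qb: "x < n \<and> y < n" if "((k, x), (l, y)) \<in> Q" for k x l y
    using index_pairs_bounds[OF assms(3)] that by (auto simp: Q_def n_def)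
  have ib: "imps Q \<subseteq> ?box" using Qb by (auto simp: imps_def)
  have st: "stored ql s2" using assms(1) by (simp add: stored_def fr)
  have Q2: "index_pairs (arr s2 6) ql = Q" by (simp add: Q_def fr)
  have v2: "arr s2 6 a < reg s2 7" for a using assms(3)[of a] by (simp add: n fr n_def)
  have r2: "rel (arr s2 9) n = Id_on {..<n}"
    using diagonal_sem[OF o1, of 9] assms(4) by (simp add: s2_def[symmetric] n fr rel_zero)
  note rp = read_pairs_sem[OF st o(1) z(2) v2, folded s3_def, unfolded n Q2]
  have "rel (arr s3 9) n = Id_on {..<n} \<union> imps Q" using rp(1) r2 by simp
  moreover have "(Id_on {..<n} \<union> imps Q)\<^sup>* = (imps Q)\<^sup>*"
    by (rule rtrancl_subset) auto
  ultimately have G4: "rel (arr s4 9) n = (imps Q)\<^sup>* \<inter> ?box"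
    using warshall_sem[OF o(2) z(3)] by (simp add: n s4_def[symmetric])
  have S3: "rel (arr s3 10) n = {(x, y). \<exists>k. k \<noteq> 0 \<and> ((1, y), (k, x)) \<in> Q}"
    "rel (arr s3 11) n = {(x, y). ((1, y), (1, x)) \<in> Q}"
    using rp(2,3) assms(4) by (simp_all add: fr rel_zero)
  have symQ: "((1, u), (1, v)) \<in> Q" if "((1, v), (1, u)) \<in> Q" for u v
    using that sym_index_pairs[OF sym] unfolding Q_def by (meson symD)
  have "rel (arr s5 10) n = founds Q"
  proof -
    let ?S = "{(x, y). \<exists>k. k \<noteq> 0 \<and> ((1, y), (k, x)) \<in> Q}"
    have "rel (arr s5 10) n = ?S \<union> {(0, u) | u v. (u, v) \<in> {(x, y). ((1, y), (1, x)) \<in> Q} \<and>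
        (u, v) \<in> (imps Q)\<^sup>* \<inter> ?box \<and> (v, u) \<in> (imps Q)\<^sup>* \<inter> ?box}"
      using mark_mutual_sem[OF o(3) z(4)] unfolding n s5_def[symmetric] G4
      by (simp add: fr4a S3)
    \<comment> \<open>Matrix 11 holds the head pairs transposed; symmetry of \<open>Q\<close>
      reconciles this with the order used in \<open>founds\<close>.\<close>
    moreover have "(u, v) \<in> {(x, y). ((1, y), (1, x)) \<in> Q} \<and> (u, v) \<in> (imps Q)\<^sup>* \<inter> ?box \<and>
        (v, u) \<in> (imps Q)\<^sup>* \<inter> ?box \<longleftrightarrow>
        ((1, u), (1, v)) \<in> Q \<and> (u, v) \<in> (imps Q)\<^sup>* \<and> (v, u) \<in> (imps Q)\<^sup>*" for u v
      using symQ Qb by auto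
    ultimately show ?thesis by (simp only: founds_def)
  qed
  then have "rel (arr s6 12) n = founds Q O ((imps Q)\<^sup>* \<inter> ?box)"
    using compose_supports_sem[OF o(4) z(5)] assms(4) unfolding n s6_def[symmetric]
    by (simp add: fr G4 rel_zero)
  \<comment> \<open>The pairs of \<open>founds\<close> end inside the square and implications do not
    leave it, so cutting the closure loses no composed pair.\<close>
  moreover have "supports Q \<subseteq> founds Q O ((imps Q)\<^sup>* \<inter> ?box)"
  proof -
    have "z < n" if "(y, z) \<in> (imps Q)\<^sup>*" "y < n" for y z
      using that ib by (induction rule: rtrancl_induct) auto
    moreover have "y < n" if "(x, y) \<in> founds Q" for x y
      using that Qb by (auto simp: founds_def)
    ultimately show ?thesis unfolding supports_def by blast
  qed
  ultimately have S6: "rel (arr s6 12) n = supports Q" by (auto simp: supports_def)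
  then show "rel (arr t 12) (reg s 7) = supports Q" by (simp add: fr n_def)
  have "rel (arr s7 13) n = Id_on {..<n}"
    using diagonal_sem[OF o(5), of 13] assms(4) by (simp add: s7_def[symmetric] n fr rel_zero)
  moreover have "supports Q \<subseteq> ?box" using S6 by (auto simp: rel_def)
  ultimately show "rel (arr t 13) (reg s 7) = neighbours Q \<inter> {..<reg s 7} \<times> {..<reg s 7}"
    using symmetrize_sem[OF o(6) z(7)] unfolding n t[symmetric] fr S6 n_def[symmetric]
    by (auto simp: fr S6 neighbours_def)
qed


section \<open>Nodes of the search tree\<close>

text \<open>Arrays 18 to 21 are a stack of frames of \<open>n\<close> cells each, with register 8
  pointing behind the last one. The popped frame is copied to arrays 14 to 17 because its children
  are pushed over it.\<close>

definition pop_frame :: cmd where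
  "pop_frame = Do (Sub 8 8 7) ;; For 10 7 (Do (Add 3 8 10) ;;
     Do (Load 11 18 3) ;; Do (Store 14 10 11) ;; Do (Load 11 19 3) ;; Do (Store 15 10 11) ;;
     Do (Load 11 20 3) ;; Do (Store 16 10 11) ;; Do (Load 11 21 3) ;; Do (Store 17 10 11))"

definition collect_undecided :: cmd where
  "collect_undecided = Do (Const 9 0) ;; For 10 7 (Do (Load 11 15 10) ;;
     Branch (Equal 11 4) (Do (Store 22 9 10) ;; Do (Const 11 1) ;; Do (Add 9 9 11)) Nop)"

definition check_support :: cmd where
  "check_support = For 10 7 (Do (Load 12 14 10) ;; Do (Load 13 16 10) ;; Do (Add 12 12 13) ;;
     Branch (Equal 12 4) (Do (Const 11 0)) Nop)"

text \<open>Array 14 marks the false atoms. A positive body item is true when its atom is marked;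
  for the other kinds the truncated difference of 1 and the mark is the truth value. Heads and
  \<open>not\<close>-literals are treated alike here, because the tested set is the one defining the
  reduct.\<close>

definition check_model :: cmd where
  "check_model = For 10 5 (
     Do (Load 12 3 10) ;; Do (Load 12 6 12) ;; Do (Load 12 14 12) ;; Do (Load 14 2 10) ;;
     Branch (Less 4 14) (Do (Sub 12 16 12)) Nop ;;
     Do (Load 13 5 10) ;; Do (Load 13 6 13) ;; Do (Load 13 14 13) ;; Do (Load 14 4 10) ;;
     Branch (Less 4 14) (Do (Sub 13 16 13)) Nop ;;
     Do (Add 12 12 13) ;; Branch (Equal 12 4) (Do (Const 11 0)) Nop)"

text \<open>The cell at the old end of the output is reserved until the length is known. The vertex
  0 is chosen in every node and thus never output.\<close>

definition emit_model :: cmd where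
  "emit_model = Do (Add 12 1 16) ;;
     For 10 7 (Do (Load 13 14 10) ;;
       Branch (Equal 13 4) (Do (Load 13 7 10) ;; Do (Store 1 12 13) ;; Do (Add 12 12 16)) Nop) ;;
     Do (Sub 13 12 1) ;; Do (Sub 13 13 16) ;; Do (Store 1 1 13) ;; Do (Copy 1 12)"

text \<open>Register 6 is nonzero after an empty clause or rule, which no set satisfies; the
  starting value of the flag in register 11 then suppresses all output.\<close>

definition leaf :: cmd where
  "leaf = Do (Const 16 1) ;; Do (Sub 11 16 6) ;; check_support ;; check_model ;; when_nz 11 emit_model"

text \<open>Degrees count undecided neighbours only, so the quadratic cost is in the number of
  undecided vertices. The sentinel \<open>n + 1\<close> in register 11 exceeds every degree.\<close>

definition choose_vertex :: cmd where
  "choose_vertex = Do (Const 16 1) ;; Do (Add 11 7 16) ;; For 10 9 (Do (Load 12 22 10) ;; Do (Const 13 0) ;;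
     For 14 9 (Do (Load 15 22 14) ;; get 15 13 12 15 ;; when_nz 15 (Do (Add 13 13 16))) ;;
     Branch (Less 13 11) (Do (Copy 11 13) ;; Do (Copy 17 12)) Nop)"

text \<open>Membership in a vector means being nonzero, so adding a matrix row forms a
  union.\<close>

definition push_frame :: cmd where
  "push_frame = For 11 7 (Do (Add 18 8 11) ;; Do (Load 14 14 11) ;; Do (Store 18 18 14) ;;
       Do (Load 14 15 11) ;; get 15 13 12 11 ;; Do (Add 14 14 15) ;; Do (Store 19 18 14) ;;
       Do (Load 14 16 11) ;; get 15 12 12 11 ;; Do (Add 14 14 15) ;; Do (Store 20 18 14) ;;
       Do (Load 14 17 11) ;; Do (Store 21 18 14)) ;;
     Do (Add 18 8 12) ;; Do (Store 18 18 16) ;; Do (Add 8 8 7)"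

text \<open>Once its child is pushed, a vertex enters the forbidden vector of the current frame,
  which the later children copy.\<close>

definition expand_node :: cmd where
  "expand_node = For 10 9 (Do (Load 12 22 10) ;; get 13 13 17 12 ;; Do (Load 14 17 12) ;;
     when_nz 13 (Branch (Equal 14 4) (push_frame ;; Do (Store 17 12 16)) Nop))"

section \<open>Correctness of the programs for a single node\<close>

definition ready ::
  "((nat \<times> nat) \<times> (nat \<times> nat)) list \<Rightarrow> ((nat \<times> nat) \<times> (nat \<times> nat)) set \<Rightarrow> nat \<Rightarrow> ram_state \<Rightarrow> bool" where
  "ready ql Q n s \<longleftrightarrow> reg s 7 = n \<and> reg s 4 = 0 \<and> offsets s \<and> stored ql s \<and>
     indexed ((snd \<circ> fst) ` set ql) (n - 1) (arr s 6) (arr s 7) \<and> Q = index_pairs (arr s 6) ql \<and>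
     rel (arr s 12) n = supports Q \<and> rel (arr s 13) n = neighbours Q \<inter> {..<n} \<times> {..<n} \<and>
     (\<forall>a. arr s 6 a < n)"

lemma ready_cong:
  assumes "ready ql Q n s" "\<And>r. r \<in> {4, 5, 7} \<Longrightarrow> reg t r = reg s r"
    "\<And>A. A \<in> {2, 3, 4, 5, 6, 7, 8, 12, 13} \<Longrightarrow> arr t A = arr s A"
  shows "ready ql Q n t"
  using assms unfolding ready_def offsets_def stored_def by simp

lemma ready_simps:
  assumes "ready ql Q n s"
  shows "reg s 7 = n" "reg s 4 = 0" "a < n \<Longrightarrow> arr s 8 a = a * n"
    "a < n \<Longrightarrow> b < n \<Longrightarrow> arr s 12 (a * n + b) = 0 \<longleftrightarrow> (a, b) \<notin> supports Q"
    "a < n \<Longrightarrow> b < n \<Longrightarrow> arr s 13 (a * n + b) = 0 \<longleftrightarrow> (a, b) \<notin> neighbours Q"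
proof -
  show "reg s 7 = n" "reg s 4 = 0" "a < n \<Longrightarrow> arr s 8 a = a * n"
    using assms by (auto simp: ready_def offsets_def)
  assume "a < n" "b < n"
  then have "(a, b) \<in> rel (arr s A) n \<longleftrightarrow> arr s A (a * n + b) \<noteq> 0" for A
    by (simp add: rel_def)
  with assms \<open>a < n\<close> \<open>b < n\<close> show "arr s 12 (a * n + b) = 0 \<longleftrightarrow> (a, b) \<notin> supports Q"
    "arr s 13 (a * n + b) = 0 \<longleftrightarrow> (a, b) \<notin> neighbours Q"
    unfolding ready_def by (metis, blast)
qed

definition encodes :: "(nat \<Rightarrow> nat) \<Rightarrow> nat \<Rightarrow> nat set \<Rightarrow> bool" where
  "encodes f n X \<longleftrightarrow> (\<forall>a<n. f a \<noteq> 0 \<longleftrightarrow> a \<in> X)"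

text \<open>Four parallel vectors hold the chosen vertices, the covered vertices, the supported vertices
  and the forbidden vertices of a node of the search tree.\<close>

definition frame :: "((nat \<times> nat) \<times> (nat \<times> nat)) set \<Rightarrow> nat \<Rightarrow> (nat \<Rightarrow> nat \<Rightarrow> nat) \<Rightarrow> nat set \<times> nat set \<Rightarrow> bool" where
  "frame Q n g = (\<lambda>(I, F). encodes (g 0) n I \<and> encodes (g 1) n (neighbours Q `` I) \<and>
     encodes (g 2) n (supports Q `` I) \<and> encodes (g 3) n F)"

definition stack :: "((nat \<times> nat) \<times> (nat \<times> nat)) set \<Rightarrow> nat \<Rightarrow> ram_state \<Rightarrow> (nat set \<times> nat set) list \<Rightarrow> bool" where
  "stack Q n s fs \<longleftrightarrow> reg s 8 = length fs * n \<and>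
     (\<forall>i<length fs. frame Q n (\<lambda>A a. arr s (18 + A) (i * n + a)) (fs ! i))"

definition current :: "((nat \<times> nat) \<times> (nat \<times> nat)) set \<Rightarrow> nat \<Rightarrow> ram_state \<Rightarrow> nat set \<times> nat set \<Rightarrow> bool" where
  "current Q n s f \<longleftrightarrow> frame Q n (\<lambda>A. arr s (14 + A)) f"

lemma frame_cong:
  assumes "frame Q n g f" "\<And>A a. A < 4 \<Longrightarrow> a < n \<Longrightarrow> h A a = g A a"
  shows "frame Q n h f"
  using assms by (simp add: frame_def encodes_def split: prod.splits)

lemma pop_frame_sem:
  assumes "stack Q n s (fs @ [f])" "reg s 7 = n"
  shows "stack Q n (sem pop_frame s) fs" "current Q n (sem pop_frame s) f"
proof -
  let ?c = "Do (Add 3 8 10) ;;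
     Do (Load 11 18 3) ;; Do (Store 14 10 11) ;; Do (Load 11 19 3) ;; Do (Store 15 10 11) ;;
     Do (Load 11 20 3) ;; Do (Store 16 10 11) ;; Do (Load 11 21 3) ;; Do (Store 17 10 11)"
  let ?s = "set_reg 8 (length fs * n) s"
  have t: "sem pop_frame s = sem (For 10 7 ?c) ?s"
    using assms by (simp add: pop_frame_def stack_def del: sem.simps(5))
  have fr: "reg (sem (For 10 7 ?c) ?s) 8 = length fs * n"
    "\<And>A. A \<notin> {14, 15, 16, 17} \<Longrightarrow> arr (sem (For 10 7 ?c) ?s) A = arr s A"
    by (auto simp: sem_reg_frame sem_arr_frame simp del: sem.simps)
  then show "stack Q n (sem pop_frame s) fs"
    using assms unfolding t stack_def
    by (auto simp: nth_append less_Suc_eq simp del: sem.simps elim!: frame_cong)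
  have "\<forall>a<reg ?s 7. \<forall>A\<in>{0, 1, 2, 3}. arr (sem (For 10 7 ?c) ?s) (14 + A) a = arr s (18 + A) (length fs * n + a)"
    by (rule For_rule[where P = "\<lambda>k t. \<forall>a<k. \<forall>A\<in>{0, 1, 2, 3}. arr t (14 + A) a = arr s (18 + A) (length fs * n + a)"])
      (auto simp: less_Suc_eq)
  then have "arr (sem pop_frame s) (14 + A) a = arr s (18 + A) (length fs * n + a)" if "A < 4" "a < n" for A a
    using that assms(2) unfolding t by (auto simp: numeral_eq_Suc less_Suc_eq simp del: sem.simps)
  moreover have "frame Q n (\<lambda>A a. arr s (18 + A) (length fs * n + a)) f"
    using assms(1) by (auto simp: stack_def)
  ultimately show "current Q n (sem pop_frame s) f"
    unfolding current_def by (auto elim!: frame_cong)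
qed

definition listed :: "nat list \<Rightarrow> ram_state \<Rightarrow> bool" where
  "listed L s \<longleftrightarrow> reg s 9 = length L \<and> (\<forall>i<length L. arr s 22 i = L ! i)"

lemma collect_undecided_sem:
  assumes "reg s 7 = n" "reg s 4 = 0"
  shows "listed (filter (\<lambda>a. arr s 15 a = 0) [0..<n]) (sem collect_undecided s)"
proof -
  let ?c = "Do (Load 11 15 10) ;;
     Branch (Equal 11 4) (Do (Store 22 9 10) ;; Do (Const 11 1) ;; Do (Add 9 9 11)) Nop"
  let ?s = "set_reg 9 0 s"
  have "listed (filter (\<lambda>a. arr s 15 a = 0) [0..<reg ?s 7]) (sem (For 10 7 ?c) ?s)"
    by (rule For_rule[where P = "\<lambda>k t. listed (filter (\<lambda>a. arr s 15 a = 0) [0..<k]) t"])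
      (use assms in \<open>auto simp: listed_def nth_append less_Suc_eq\<close>)
  then show ?thesis using assms by (simp add: collect_undecided_def del: sem.simps(5))
qed

lemma check_support_sem:
  assumes "reg s 4 = 0"
  shows "reg (sem check_support s) 11 \<noteq> 0 \<longleftrightarrow>
    reg s 11 \<noteq> 0 \<and> (\<forall>a<reg s 7. arr s 14 a \<noteq> 0 \<or> arr s 16 a \<noteq> 0)"
  unfolding check_support_def
  by (rule For_rule[where P = "\<lambda>k t. reg t 11 \<noteq> 0 \<longleftrightarrow>
      reg s 11 \<noteq> 0 \<and> (\<forall>a<k. arr s 14 a \<noteq> 0 \<or> arr s 16 a \<noteq> 0)"])
    (use assms in \<open>auto simp: less_Suc_eq\<close>)

lemma check_model_sem:
  assumes "ready ql Q n s" "reg s 16 = 1" "encodes (arr s 14) n I"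
  shows "reg (sem check_model s) 11 \<noteq> 0 \<longleftrightarrow>
    reg s 11 \<noteq> 0 \<and> red_model Q ({..<n} - I) ({..<n} - I)"
proof -
  let ?M = "{..<n} - I"
  let ?q = "\<lambda>i. ((arr s 2 i, arr s 6 (arr s 3 i)), (arr s 4 i, arr s 6 (arr s 5 i)))"
  let ?T = "\<lambda>k x. if k = 0 then arr s 14 x \<noteq> 0 else arr s 14 x = 0"
  have "reg (sem check_model s) 11 \<noteq> 0 \<longleftrightarrow> reg s 11 \<noteq> 0 \<and>
      (\<forall>i<reg s 5. ?T (arr s 2 i) (arr s 6 (arr s 3 i)) \<or> ?T (arr s 4 i) (arr s 6 (arr s 5 i)))"
    unfolding check_model_def
  proof (rule For_rule[where P = "\<lambda>k t. reg t 11 \<noteq> 0 \<longleftrightarrow> reg s 11 \<noteq> 0 \<and>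
        (\<forall>i<k. ?T (arr s 2 i) (arr s 6 (arr s 3 i)) \<or> ?T (arr s 4 i) (arr s 6 (arr s 5 i)))"], goal_cases)
    case (5 k t)
    have "reg t 4 = 0" "reg t 16 = 1" "\<And>A. arr t A = arr s A"
      using 5(4,5) assms(2) ready_simps(2)[OF assms(1)] by auto
    then have "reg (sem (Do (Load 12 3 10) ;; Do (Load 12 6 12) ;; Do (Load 12 14 12) ;; Do (Load 14 2 10) ;;
        Branch (Less 4 14) (Do (Sub 12 16 12)) Nop ;;
        Do (Load 13 5 10) ;; Do (Load 13 6 13) ;; Do (Load 13 14 13) ;; Do (Load 14 4 10) ;;
        Branch (Less 4 14) (Do (Sub 13 16 13)) Nop ;;
        Do (Add 12 12 13) ;; Branch (Equal 12 4) (Do (Const 11 0)) Nop) t) 11 =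
      (if ?T (arr s 2 k) (arr s 6 (arr s 3 k)) \<or> ?T (arr s 4 k) (arr s 6 (arr s 5 k)) then reg t 11 else 0)"
      using 5(3) by (cases "arr s 2 k = 0"; cases "arr s 4 k = 0") simp_all
    then show ?case using 5(2) by (simp add: less_Suc_eq del: sem.simps) blast
  qed auto
  moreover have "?T k (arr s 6 a) \<longleftrightarrow> item_true ?M ?M (k, arr s 6 a)" for k a
  proof -
    have "arr s 6 a < n" using assms(1) by (simp add: ready_def)
    then show ?thesis using assms(3) unfolding encodes_def by (auto simp: item_true_def)
  qed
  moreover have "red_model Q ?M ?M \<longleftrightarrow>
      (\<forall>i<reg s 5. item_true ?M ?M (fst (?q i)) \<or> item_true ?M ?M (snd (?q i)))"
  proof -
    have "q \<in> Q \<longleftrightarrow> (\<exists>i<reg s 5. q = ?q i)" for q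
      using assms(1) unfolding ready_def
      by (cases q) (auto simp: index_pairs_iff[of ql s])
    then show ?thesis unfolding red_model_def by fastforce
  qed
  ultimately show ?thesis by simp
qed

definition model_list :: "nat \<Rightarrow> (nat \<Rightarrow> nat) \<Rightarrow> nat set \<Rightarrow> nat list" where
  "model_list n w J = map w (filter (\<lambda>a. a \<notin> J) [0..<n])"

lemma emit_model_sem:
  assumes "reg s 4 = 0" "reg s 16 = 1" "reg s 7 = n" "encodes (arr s 14) n I"
  defines "xs \<equiv> model_list n (arr s 7) I"
  shows "output_of (sem emit_model s) = output_of s @ length xs # xs"
proof -
  let ?c = "Do (Load 13 14 10) ;;
       Branch (Equal 13 4) (Do (Load 13 7 10) ;; Do (Store 1 12 13) ;; Do (Add 12 12 16)) Nop"
  let ?s = "set_reg 12 (reg s 1 + 1) s"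
  let ?xs = "\<lambda>k. map (arr s 7) (filter (\<lambda>a. arr s 14 a = 0) [0..<k])"
  let ?t = "sem (For 10 7 ?c) ?s"
  have "reg ?t 12 = reg s 1 + 1 + length (?xs (reg ?s 7)) \<and>
      (\<forall>i<reg s 1. arr ?t 1 i = arr s 1 i) \<and>
      (\<forall>i<length (?xs (reg ?s 7)). arr ?t 1 (reg s 1 + 1 + i) = ?xs (reg ?s 7) ! i)"
    by (rule For_rule[where P = "\<lambda>k t. reg t 12 = reg s 1 + 1 + length (?xs k) \<and>
        (\<forall>i<reg s 1. arr t 1 i = arr s 1 i) \<and>
        (\<forall>i<length (?xs k). arr t 1 (reg s 1 + 1 + i) = ?xs k ! i)"])
      (use assms(1,2) in \<open>auto simp: nth_append less_Suc_eq\<close>)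
  moreover have xs: "?xs n = xs"
    unfolding xs_def model_list_def using assms(4) by (intro map_cong filter_cong) (auto simp: encodes_def)
  moreover have "reg ?t 1 = reg s 1" "reg ?t 16 = 1"
    using assms(2) by (simp_all add: sem_reg_frame del: sem.simps)
  ultimately have t: "reg ?t 12 = reg s 1 + 1 + length xs" "\<And>i. i < reg s 1 \<Longrightarrow> arr ?t 1 i = arr s 1 i"
    "\<And>i. i < length xs \<Longrightarrow> arr ?t 1 (reg s 1 + 1 + i) = xs ! i" "reg ?t 1 = reg s 1" "reg ?t 16 = 1"
    using assms(3) by (simp_all del: sem.simps)
  have e: "sem emit_model s = set_reg 1 (reg s 1 + 1 + length xs)
      (set_arr 1 (reg s 1) (length xs) (set_reg 13 (length xs) (set_reg 13 (1 + length xs) ?t)))"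
    unfolding emit_model_def using assms(2) t(1,4,5) by (simp del: sem.simps(5))
  have "[0..<reg s 1 + 1 + length xs] = [0..<reg s 1] @ reg s 1 # map (\<lambda>i. reg s 1 + 1 + i) [0..<length xs]"
  proof -
    have "[0..<reg s 1 + 1 + length xs] = [0..<reg s 1] @ [reg s 1..<reg s 1 + (1 + length xs)]"
      using upt_add_eq_append[of 0 "reg s 1" "1 + length xs"] by (simp add: add.assoc)
    also have "[reg s 1..<reg s 1 + (1 + length xs)] = reg s 1 # [reg s 1 + 1..<length xs + (reg s 1 + 1)]"
      by (simp add: upt_conv_Cons ac_simps Suc_eq_plus1)
    also have "[reg s 1 + 1..<length xs + (reg s 1 + 1)] = map (\<lambda>i. reg s 1 + 1 + i) [0..<length xs]"
      unfolding map_add_upt[symmetric] by (simp add: add.commute)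
    finally show ?thesis .
  qed
  then show ?thesis
    unfolding e output_of_def using t by (auto intro!: nth_equalityI simp del: sem.simps upt_Suc)
qed

lemma choose_vertex_sem:
  assumes "ready ql Q n s" "listed L s" "L \<noteq> []" "set L \<subseteq> {..<n}" "distinct L"
  defines "t \<equiv> sem choose_vertex s" and "deg \<equiv> \<lambda>u. length (filter (\<lambda>w. (u, w) \<in> neighbours Q) L)"
  shows "reg t 17 \<in> set L" "\<And>u. u \<in> set L \<Longrightarrow> deg (reg t 17) \<le> deg u" "reg t 16 = 1"
proof -
  let ?c = "Do (Load 15 22 14) ;; get 15 13 12 15 ;; when_nz 15 (Do (Add 13 13 16))"
  let ?d = "Do (Load 12 22 10) ;; Do (Const 13 0) ;; For 14 9 ?c ;;
     Branch (Less 13 11) (Do (Copy 11 13) ;; Do (Copy 17 12)) Nop"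
  let ?s = "set_reg 11 (n + 1) (set_reg 16 1 s)"
  have L: "reg s 9 = length L" "\<And>i. i < length L \<Longrightarrow> arr s 22 i = L ! i" "\<And>i. i < length L \<Longrightarrow> L ! i < n"
    using assms(2,4) by (auto simp: listed_def subset_iff)
  have inner: "reg (sem (For 14 9 ?c) t) 13 = deg u"
    if t: "ready ql Q n t" "reg t 12 = u" "u < n" "reg t 13 = 0" "reg t 16 = 1" "reg t 9 = length L"
      "arr t 22 = arr s 22" for t u
  proof -
    have "reg (sem (For 14 9 ?c) t) 13 = length (filter (\<lambda>w. (u, w) \<in> neighbours Q) (take (reg t 9) L))"
      by (rule For_rule[where P = "\<lambda>k t. reg t 13 = length (filter (\<lambda>w. (u, w) \<in> neighbours Q) (take k L))"])
        (use t L ready_simps[OF t(1)] in \<open>auto simp: take_Suc_conv_app_nth\<close>)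
    then show ?thesis using t by (simp add: deg_def)
  qed
  have degn: "deg u < n + 1" for u
  proof -
    have "deg u \<le> length L" by (simp add: deg_def)
    also have "\<dots> \<le> n" using assms(4,5) card_mono[of "{..<n}" "set L"] by (simp add: distinct_card)
    finally show ?thesis by simp
  qed
  let ?P = "\<lambda>k t. if k = 0 then reg t 11 = n + 1 else
    reg t 17 \<in> set (take k L) \<and> reg t 11 = deg (reg t 17) \<and> (\<forall>u\<in>set (take k L). reg t 11 \<le> deg u)"
  have "?P (reg ?s 9) (sem (For 10 9 ?d) ?s)"
  proof (rule For_rule[where P = ?P])
    fix k and t :: ram_state
    assume a: "k < reg ?s 9" "?P k t" "reg t 10 = k" "\<And>r. r \<notin> regs (For 10 9 ?d) \<Longrightarrow> reg t r = reg ?s r"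
      "\<And>A. A \<notin> arrs ?d \<Longrightarrow> arr t A = arr ?s A"
    have k: "k < length L" using a(1) L by simp
    let ?t = "set_reg 13 0 (set_reg 12 (L ! k) t)"
    have t22: "arr t 22 = arr s 22" by (simp add: a(5))
    have "ready ql Q n ?t" by (rule ready_cong[OF assms(1)]) (auto simp: a(4,5))
    then have d: "reg (sem (For 14 9 ?c) ?t) 13 = deg (L ! k)"
      using k L by (intro inner) (auto simp: a(4,5))
    have fr: "reg (sem (For 14 9 ?c) ?t) r = reg ?t r" if "r \<in> {11, 12, 17}" for r
      using that by (auto simp: sem_reg_frame simp del: sem.simps)
    have *: "sem ?d t = (if deg (L ! k) < reg t 11
        then set_reg 17 (L ! k) (set_reg 11 (deg (L ! k)) (sem (For 14 9 ?c) ?t)) else sem (For 14 9 ?c) ?t)"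
      using k L(2) a(3) d fr by (simp add: t22 del: sem.simps(5))
    have tk: "set (take (Suc k) L) = insert (L ! k) (set (take k L))"
      using k by (simp add: take_Suc_conv_app_nth)
    show "?P (Suc k) (bump 10 (sem ?d t))"
      unfolding * tk using a(2) fr degn[of "L ! k"] by (auto split: if_splits simp del: sem.simps)
  qed auto
  moreover have t: "t = sem (For 10 9 ?d) ?s"
    unfolding t_def choose_vertex_def using assms(1) by (simp add: ready_def del: sem.simps(5))
  ultimately show "reg t 17 \<in> set L" "\<And>u. u \<in> set L \<Longrightarrow> deg (reg t 17) \<le> deg u"
    using assms(3) L(1) by (auto simp del: sem.simps)
  show "reg t 16 = 1" unfolding t by (simp add: sem_reg_frame del: sem.simps)
qed

lemma push_frame_sem:
  assumes "ready ql Q n s" "stack Q n s fs" "current Q n s (I, F)" "reg s 12 = u" "u < n" "reg s 16 = 1"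
  shows "stack Q n (sem push_frame s) (fs @ [(insert u I, F)])"
proof -
  let ?c = "Do (Add 18 8 11) ;; Do (Load 14 14 11) ;; Do (Store 18 18 14) ;;
       Do (Load 14 15 11) ;; get 15 13 12 11 ;; Do (Add 14 14 15) ;; Do (Store 19 18 14) ;;
       Do (Load 14 16 11) ;; get 15 12 12 11 ;; Do (Add 14 14 15) ;; Do (Store 20 18 14) ;;
       Do (Load 14 17 11) ;; Do (Store 21 18 14)"
  let ?b = "length fs * n"
  let ?t = "sem (For 11 7 ?c) s"
  note rs = ready_simps[OF assms(1)]
  have b: "reg s 8 = ?b" using assms(2) by (simp add: stack_def)
  let ?P = "\<lambda>k t. (\<forall>a<k. arr t 18 (?b + a) = arr s 14 a \<and> arr t 19 (?b + a) = arr s 15 a + arr s 13 (u * n + a) \<and>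
      arr t 20 (?b + a) = arr s 16 a + arr s 12 (u * n + a) \<and> arr t 21 (?b + a) = arr s 17 a) \<and>
      (\<forall>A\<in>{18, 19, 20, 21}. \<forall>p<?b. arr t A p = arr s A p)"
  have P: "?P (reg s 7) ?t"
    by (rule For_rule[where P = ?P]) (use rs assms b in \<open>auto simp: less_Suc_eq\<close>)
  have fr: "reg ?t 8 = ?b" "reg ?t 12 = u" "reg ?t 16 = 1" "reg ?t 7 = n"
    using assms(4,6) b rs(1) by (simp_all add: sem_reg_frame del: sem.simps)
  let ?t' = "sem push_frame s"
  have t': "reg ?t' 8 = ?b + n" "arr ?t' A = (if A = 18 then (arr ?t 18)(?b + u := 1) else arr ?t A)" for A
    unfolding push_frame_def using fr by (simp_all del: sem.simps(5))
  have old: "frame Q n (\<lambda>A a. arr ?t' (18 + A) (i * n + a)) (fs ! i)" if i: "i < length fs" for i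
  proof (rule frame_cong)
    show "frame Q n (\<lambda>A a. arr s (18 + A) (i * n + a)) (fs ! i)"
      using assms(2) i by (simp add: stack_def)
    fix A a :: nat assume A: "A < 4" "a < n"
    have "(i + 1) * n \<le> ?b" using i by (intro mult_right_mono) auto
    then have "i * n + a < ?b" using A(2) by (simp add: algebra_simps)
    moreover have "18 + A \<in> {18, 19, 20, 21}" using A(1) by auto
    ultimately have "arr ?t (18 + A) (i * n + a) = arr s (18 + A) (i * n + a)" using P by blast
    then show "arr ?t' (18 + A) (i * n + a) = arr s (18 + A) (i * n + a)"
      unfolding t' using \<open>i * n + a < ?b\<close> by (auto simp del: sem.simps)
  qed
  have "frame Q n (\<lambda>A a. arr ?t' (18 + A) (?b + a)) (insert u I, F)"
    using P assms(3,5) rs(1,4,5) unfolding t' current_def frame_def encodes_def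
    by (auto simp del: sem.simps)
  then show ?thesis
    using old t'(1) unfolding stack_def by (auto simp: nth_append less_Suc_eq simp del: sem.simps)
qed

lemma expand_node_sem:
  assumes "ready ql Q n s" "listed L s" "set L \<subseteq> {..<n}" "distinct L" "reg s 17 = v" "v < n" "reg s 16 = 1"
    "stack Q n s fs" "current Q n s (I, F)"
  shows "stack Q n (sem expand_node s)
    (fs @ children (I, F) (filter (\<lambda>u. (v, u) \<in> neighbours Q \<and> u \<notin> F) L))"
proof -
  let ?d = "Do (Load 12 22 10) ;; get 13 13 17 12 ;; Do (Load 14 17 12) ;;
     when_nz 13 (Branch (Equal 14 4) (push_frame ;; Do (Store 17 12 16)) Nop)"
  let ?us = "\<lambda>k. filter (\<lambda>u. (v, u) \<in> neighbours Q \<and> u \<notin> F) (take k L)"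
  \<comment> \<open>Besides the stack, the invariant follows the forbidden vector of the current
    frame, which has grown by the vertices already branched on.\<close>
  let ?P = "\<lambda>k t. stack Q n t (fs @ children (I, F) (?us k)) \<and> current Q n t (I, F \<union> set (?us k))"
  have L: "reg s 9 = length L" "\<And>i. i < length L \<Longrightarrow> arr s 22 i = L ! i" "\<And>i. i < length L \<Longrightarrow> L ! i < n"
    using assms(2,3) by (auto simp: listed_def subset_iff)
  have pr: "regs push_frame = {2, 3, 8, 11, 14, 15, 18}" "arrs push_frame = {18, 19, 20, 21}"
    by (auto simp: push_frame_def)
  have "?P (reg s 9) (sem (For 10 9 ?d) s)"
  proof (rule For_rule[where P = ?P])
    fix k and t :: ram_state
    assume a: "k < reg s 9" "?P k t" "reg t 10 = k" "\<And>r. r \<notin> regs (For 10 9 ?d) \<Longrightarrow> reg t r = reg s r"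
      "\<And>A. A \<notin> arrs ?d \<Longrightarrow> arr t A = arr s A"
    have k: "k < length L" using a(1) L by simp
    let ?u = "L ! k"
    have rt: "ready ql Q n t" by (rule ready_cong[OF assms(1)]) (auto simp: a(4,5) pr)
    have u: "?u < n" "arr t 22 k = ?u" "reg t 17 = v" "reg t 16 = 1" "reg t 4 = 0"
      using L k assms(5,7) ready_simps(2)[OF assms(1)] by (auto simp: a(4,5) pr)
    \<comment> \<open>Distinctness of \<open>L\<close> ensures that the enlarged vector still tells
      whether \<open>?u\<close> lies in the original \<open>F\<close>.\<close>
    have nu: "?u \<notin> set (take k L)"
      using assms(4) k by (metis distinct_take id_take_nth_drop not_distinct_conv_prefix order_refl take_Suc_conv_app_nth)
    have us: "?us (Suc k) = ?us k @ (if (v, ?u) \<in> neighbours Q \<and> ?u \<notin> F then [?u] else [])"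
      using k by (simp add: take_Suc_conv_app_nth)
    have F: "arr t 17 ?u = 0 \<longleftrightarrow> ?u \<notin> F"
      using a(2) u(1) nu by (auto simp: current_def frame_def encodes_def)
    let ?t = "set_reg 14 (arr t 17 ?u) (set_reg 13 (arr t 13 (v * n + ?u)) (set_reg 3 (v * n + ?u)
        (set_reg 3 (v * n) (set_reg 12 ?u t))))"
    have e: "sem ?d t = (if (v, ?u) \<in> neighbours Q \<and> ?u \<notin> F then set_arr 17 ?u 1 (sem push_frame ?t) else ?t)"
    proof -
      have "reg (sem push_frame x) 12 = reg x 12" "reg (sem push_frame x) 16 = reg x 16" for x
        by (auto simp: sem_reg_frame pr)
      moreover have "0 < arr t 13 (v * n + ?u) \<longleftrightarrow> (v, ?u) \<in> neighbours Q"
        using ready_simps(5)[OF rt assms(6) u(1)] by (cases "arr t 13 (v * n + ?u) = 0") auto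
      moreover have "arr t 8 v = v * n" using ready_simps(3)[OF rt assms(6)] .
      ultimately show ?thesis
        using a(3) u F by simp
    qed
    have rt': "ready ql Q n ?t" by (rule ready_cong[OF rt]) auto
    have st': "stack Q n ?t (fs @ children (I, F) (?us k))" "current Q n ?t (I, F \<union> set (?us k))"
      using a(2) by (auto simp: stack_def current_def)
    show "?P (Suc k) (bump 10 (sem ?d t))"
    proof (cases "(v, ?u) \<in> neighbours Q \<and> ?u \<notin> F")
      case True
      have "stack Q n (sem push_frame ?t) ((fs @ children (I, F) (?us k)) @ [(insert ?u I, F \<union> set (?us k))])"
        using u by (intro push_frame_sem[OF rt' st']) auto
      then have "stack Q n (bump 10 (sem ?d t)) (fs @ children (I, F) (?us (Suc k)))"
        unfolding us e using True by (simp add: children_snoc stack_def)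
      moreover have "current Q n (bump 10 (sem ?d t)) (I, F \<union> set (?us (Suc k)))"
      proof -
        have "arr (sem push_frame ?t) A = arr t A" if "A \<in> {14, 15, 16, 17}" for A
          using that by (auto simp: sem_arr_frame pr)
        then show ?thesis
          using True a(2) unfolding us e by (auto simp: current_def frame_def encodes_def)
      qed
      ultimately show ?thesis by blast
    next
      case False
      then have "?us (Suc k) = ?us k" unfolding us by auto
      then show ?thesis unfolding e using False st' by (auto simp: stack_def current_def)
    qed
  qed (use assms(8,9) pr in \<open>auto simp: stack_def current_def\<close>)
  then show ?thesis unfolding expand_node_def using L(1) by (simp del: sem.simps)
qed


section \<open>The search\<close>

lemma output_of_cong: "reg t 1 = reg s 1 \<Longrightarrow> arr t 1 = arr s 1 \<Longrightarrow> output_of t = output_of s"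
  by (simp add: output_of_def)

lemma leaf_sem:
  assumes "ready ql Q n s" "current Q n s (I, F)" "0 \<in> I" "I \<subseteq> {..<n}"
  defines "xs \<equiv> model_list n (arr s 7) I"
  shows "output_of (sem leaf s) =
    (if reg s 6 = 0 \<and> good Q n I then output_of s @ length xs # xs else output_of s)"
proof -
  define s1 where "s1 = set_reg 11 (1 - reg s 6) (set_reg 16 1 s)"
  define s2 where "s2 = sem check_support s1"
  define s3 where "s3 = sem check_model s2"
  have e: "sem leaf s = sem (when_nz 11 emit_model) s3"
    by (simp add: leaf_def s1_def s2_def s3_def)
  have fr1: "reg s1 r = reg s r" "arr s1 = arr s" "reg s1 16 = 1" if "r \<notin> {11, 16}" for r
    using that by (auto simp: s1_def)
  have fr2: "reg s2 r = reg s1 r" "arr s2 A = arr s1 A" if "r \<notin> {2, 10, 11, 12, 13}" for r A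
    using that unfolding s2_def by (auto simp: check_support_def sem_reg_frame sem_arr_frame simp del: sem.simps)
  have fr3: "reg s3 r = reg s2 r" "arr s3 A = arr s2 A" if "r \<notin> {2, 10, 11, 12, 13, 14}" for r A
    using that unfolding s3_def by (auto simp: check_model_def sem_reg_frame sem_arr_frame simp del: sem.simps)
  have a: "arr s1 = arr s" "arr s2 = arr s" "arr s3 = arr s"
    using fr1(2)[of 0] fr2(2)[of 0] fr3(2)[of 0] by auto
  have r2: "ready ql Q n s2"
    by (rule ready_cong[OF assms(1)]) (auto simp: fr1 fr2 a)
  have z: "reg s1 4 = 0" "reg s2 16 = 1" "reg s3 4 = 0" "reg s3 16 = 1" "reg s3 7 = n" "reg s1 7 = n"
    using ready_simps(1,2)[OF assms(1)] by (simp_all add: fr1 fr2 fr3 s1_def)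
  have enc: "encodes (arr s 14) n I" "encodes (arr s 16) n (supports Q `` I)"
    using assms(2) by (auto simp: current_def frame_def)
  have "reg s3 11 \<noteq> 0 \<longleftrightarrow> reg s2 11 \<noteq> 0 \<and> red_model Q ({..<n} - I) ({..<n} - I)"
    unfolding s3_def by (rule check_model_sem[OF r2 z(2)]) (simp add: a enc)
  also have "reg s2 11 \<noteq> 0 \<longleftrightarrow> reg s 6 = 0 \<and> (\<forall>a<n. a \<in> I \<or> a \<in> supports Q `` I)"
    using check_support_sem[OF z(1)] enc unfolding s2_def[symmetric] a z encodes_def
    by (auto simp: s1_def)
  finally have ok: "reg s3 11 \<noteq> 0 \<longleftrightarrow> reg s 6 = 0 \<and> good Q n I"
    using assms(3,4) unfolding good_def by blast
  have o3: "output_of s3 = output_of s"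
    by (rule output_of_cong) (simp_all add: a fr1 fr2 fr3)
  have "output_of (sem emit_model s3) = output_of s3 @ length xs # xs"
    unfolding xs_def using emit_model_sem[OF z(3,4,5)] enc(1) by (simp add: a)
  then show ?thesis unfolding e using ok o3 z(3) by auto
qed

definition visit_node :: cmd where
  "visit_node = pop_frame ;; collect_undecided"

definition branch_node :: cmd where
  "branch_node = choose_vertex ;; expand_node"

text \<open>The pieces are compiled separately because \<open>visit_node\<close> writes register 9,
  which is a loop bound in \<open>branch_node\<close>.\<close>

definition search_step :: prog where
  "search_step = Seq (compile visit_node) (Cond (Equal 9 4) (compile leaf) (compile branch_node))"

text \<open>\<open>u\<close> says that no empty clause or rule was read. The equation counts, for
  each \<open>J\<close>, its outputs and the pending nodes responsible for it. A constant total of 1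
  for good \<open>J\<close>, and of 0 otherwise, gives soundness, completeness and freedom from
  repetition at once.\<close>

definition search_inv ::
  "((nat \<times> nat) \<times> (nat \<times> nat)) list \<Rightarrow> ((nat \<times> nat) \<times> (nat \<times> nat)) set \<Rightarrow> nat \<Rightarrow> bool \<Rightarrow>
   (nat set \<times> nat set) list \<times> nat set list \<Rightarrow> ram_state \<Rightarrow> bool" where
  "search_inv ql Q n u = (\<lambda>(fs, outs) s. ready ql Q n s \<and> (reg s 6 = 0 \<longleftrightarrow> u) \<and> stack Q n s fs \<and>
     (\<forall>(I, F)\<in>set fs. 0 \<in> I \<and> I \<subseteq> {..<n} \<and> I \<inter> F = {}) \<and>
     output_of s = code_atom_lists (map (model_list n (arr s 7)) outs) \<and>
     (if u then \<forall>J. count_list outs J + length (filter (\<lambda>f. J \<in> extensions Q n f) fs) =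
          (if good Q n J then 1 else 0) else outs = []))"

definition search_potential ::
  "((nat \<times> nat) \<times> (nat \<times> nat)) set \<Rightarrow> nat \<Rightarrow> real \<Rightarrow> (nat set \<times> nat set) list \<times> nat set list \<Rightarrow> real" where
  "search_potential Q n B = (\<lambda>(fs, outs). B * (\<Sum>(I, F)\<leftarrow>fs. potential (card (undecided Q n I))))"

lemma visit_node_sem:
  assumes "ready ql Q n s" "stack Q n s (gs @ [(I, F)])"
  defines "t \<equiv> sem visit_node s"
  shows "ready ql Q n t" "stack Q n t gs" "current Q n t (I, F)" "output_of t = output_of s"
    "arr t 7 = arr s 7" "reg t 6 = reg s 6"
    "\<exists>L. listed L t \<and> distinct L \<and> set L = undecided Q n I"
proof -
  define s1 where "s1 = sem pop_frame s"
  have t: "t = sem collect_undecided s1" by (simp add: t_def s1_def visit_node_def)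
  have fr1: "reg s1 r = reg s r" if "r \<notin> {2, 3, 8, 10, 11}" for r
    using that unfolding s1_def by (auto simp: pop_frame_def sem_reg_frame simp del: sem.simps)
  have fa1: "arr s1 A = arr s A" if "A \<notin> {14, 15, 16, 17}" for A
    using that unfolding s1_def by (auto simp: pop_frame_def sem_arr_frame simp del: sem.simps)
  have fr2: "reg t r = reg s1 r" if "r \<notin> {2, 9, 10, 11}" for r
    using that unfolding t by (auto simp: collect_undecided_def sem_reg_frame simp del: sem.simps)
  have fa2: "arr t A = arr s1 A" if "A \<noteq> 22" for A
    using that unfolding t by (auto simp: collect_undecided_def sem_arr_frame simp del: sem.simps)
  note fr = fr1 fa1 fr2 fa2
  show "ready ql Q n t"
    by (rule ready_cong[OF assms(1)]) (auto simp: fr)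
  have pop: "stack Q n s1 gs" "current Q n s1 (I, F)"
    unfolding s1_def using pop_frame_sem[OF assms(2)] ready_simps(1)[OF assms(1)] by auto
  then show "stack Q n t gs"
    unfolding stack_def by (auto simp: fr2 fa2 elim!: frame_cong)
  show "current Q n t (I, F)"
    using pop(2) unfolding current_def by (rule frame_cong) (auto simp: fa2)
  show "output_of t = output_of s" by (rule output_of_cong) (simp_all add: fr)
  show "arr t 7 = arr s 7" "reg t 6 = reg s 6" by (simp_all add: fr)
  let ?L = "filter (\<lambda>a. arr s1 15 a = 0) [0..<n]"
  have "listed ?L t"
    unfolding t using ready_simps(1,2)[OF assms(1)] by (intro collect_undecided_sem) (simp_all add: fr)
  moreover have "set ?L = undecided Q n I"
    using pop(2) by (auto simp: current_def frame_def encodes_def undecided_def)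
  ultimately show "\<exists>L. listed L t \<and> distinct L \<and> set L = undecided Q n I"
    using distinct_filter[OF distinct_upt[of 0 n]] by blast
qed

lemma branch_node_sem:
  assumes "ready ql Q n s" "stack Q n s gs" "current Q n s (I, F)"
    and L: "listed L s" "distinct L" "set L = undecided Q n I" "L \<noteq> []"
  defines "t \<equiv> sem branch_node s"
  shows "ready ql Q n t" "output_of t = output_of s" "arr t 7 = arr s 7" "reg t 6 = reg s 6"
    "\<exists>v us. stack Q n t (gs @ children (I, F) us) \<and> v \<in> undecided Q n I \<and>
       (\<forall>u\<in>undecided Q n I. card {w \<in> undecided Q n I. (v, w) \<in> neighbours Q} \<le>
          card {w \<in> undecided Q n I. (u, w) \<in> neighbours Q}) \<and>
       distinct us \<and> set us = {w \<in> undecided Q n I. (v, w) \<in> neighbours Q} - F"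
proof -
  define s1 where "s1 = sem choose_vertex s"
  have t: "t = sem expand_node s1" by (simp add: t_def s1_def branch_node_def)
  have fr1: "reg s1 r = reg s r" if "r \<notin> {2, 3, 10, 11, 12, 13, 14, 15, 16, 17}" for r
    using that unfolding s1_def by (auto simp: choose_vertex_def sem_reg_frame simp del: sem.simps)
  have fa1: "arr s1 A = arr s A" for A
    unfolding s1_def by (auto simp: choose_vertex_def sem_arr_frame simp del: sem.simps)
  have fr2: "reg t r = reg s1 r" if "r \<notin> {2, 3, 8, 10, 11, 12, 13, 14, 15, 18}" for r
    using that unfolding t by (auto simp: expand_node_def push_frame_def sem_reg_frame simp del: sem.simps)
  have fa2: "arr t A = arr s1 A" if "A \<notin> {17, 18, 19, 20, 21}" for A
    using that unfolding t by (auto simp: expand_node_def push_frame_def sem_arr_frame simp del: sem.simps)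
  note fr = fr1 fa1 fr2 fa2
  show "ready ql Q n t"
    by (rule ready_cong[OF assms(1)]) (auto simp: fr)
  have r1: "ready ql Q n s1"
    by (rule ready_cong[OF assms(1)]) (auto simp: fr)
  show "output_of t = output_of s" by (rule output_of_cong) (simp_all add: fr)
  show "arr t 7 = arr s 7" "reg t 6 = reg s 6" by (simp_all add: fr)
  have Ln: "set L \<subseteq> {..<n}" using L(3) by (auto simp: undecided_def)
  define v where "v = reg s1 17"
  note ch = choose_vertex_sem[OF assms(1) L(1,4) Ln L(2), folded s1_def, folded v_def]
  have len: "length (filter (\<lambda>w. (u, w) \<in> neighbours Q) L) =
      card {w \<in> undecided Q n I. (u, w) \<in> neighbours Q}" for u
    using L(2,3) distinct_card[of "filter (\<lambda>w. (u, w) \<in> neighbours Q) L"] by (simp flip: L(3))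
  let ?us = "filter (\<lambda>u. (v, u) \<in> neighbours Q \<and> u \<notin> F) L"
  have "stack Q n t (gs @ children (I, F) ?us)"
    unfolding t
  proof (rule expand_node_sem[OF r1 _ Ln L(2)])
    show "listed L s1" using L(1) by (simp add: listed_def fr)
    show "reg s1 17 = v" "v < n" "reg s1 16 = 1" using ch Ln by (auto simp: v_def)
    show "stack Q n s1 gs" "current Q n s1 (I, F)"
      using assms(2,3) by (simp_all add: stack_def current_def fr)
  qed
  moreover have "distinct ?us" "set ?us = {w \<in> undecided Q n I. (v, w) \<in> neighbours Q} - F"
    using L by auto
  moreover have "v \<in> undecided Q n I" using ch(1) L(3) by simp
  ultimately show "\<exists>v us. stack Q n t (gs @ children (I, F) us) \<and> v \<in> undecided Q n I \<and>
       (\<forall>u\<in>undecided Q n I. card {w \<in> undecided Q n I. (v, w) \<in> neighbours Q} \<le>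
          card {w \<in> undecided Q n I. (u, w) \<in> neighbours Q}) \<and>
       distinct us \<and> set us = {w \<in> undecided Q n I. (v, w) \<in> neighbours Q} - F"
    using ch(2) L(3) unfolding len by blast
qed

lemma set_children:
  assumes "(I', F') \<in> set (children (I, F) us)"
  shows "\<exists>u\<in>set us. I' = insert u I" "F' \<subseteq> F \<union> set us" "I \<inter> F = {} \<Longrightarrow> distinct us \<Longrightarrow>
    set us \<inter> (I \<union> F) = {} \<Longrightarrow> I' \<inter> F' = {}"
proof -
  obtain i where i: "i < length us" "I' = insert (us ! i) I" "F' = F \<union> set (take i us)"
    using assms by (auto simp: children_def)
  then show "\<exists>u\<in>set us. I' = insert u I" "F' \<subseteq> F \<union> set us"
    by (auto dest: in_set_takeD)
  assume a: "I \<inter> F = {}" "distinct us" "set us \<inter> (I \<union> F) = {}"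
  have "us ! i \<notin> set (take i us)"
    using i(1) a(2) by (auto simp: in_set_conv_nth nth_eq_iff_index_eq)
  moreover have "us ! i \<in> set us" using i(1) by simp
  moreover have "set (take i us) \<subseteq> set us" by (rule set_take_subset)
  ultimately show "I' \<inter> F' = {}"
    using i(2,3) a(1,3) by blast
qed

lemma potential_children:
  assumes "v \<in> undecided Q n I"
    and "\<forall>u\<in>undecided Q n I. card {w \<in> undecided Q n I. (v, w) \<in> neighbours Q} \<le>
          card {w \<in> undecided Q n I. (u, w) \<in> neighbours Q}"
    and "distinct us" "set us \<subseteq> {w \<in> undecided Q n I. (v, w) \<in> neighbours Q}"
  defines "j \<equiv> card (undecided Q n I)"
  shows "(real j + 1)\<^sup>2 + (\<Sum>(I, F)\<leftarrow>children (I, F) us. potential (card (undecided Q n I))) \<le> potential j"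
proof -
  define s where "s = card {w \<in> undecided Q n I. (v, w) \<in> neighbours Q}"
  have fin: "finite (undecided Q n I)" by (simp add: undecided_def)
  have "v \<in> {w \<in> undecided Q n I. (v, w) \<in> neighbours Q}" using assms(1) by (simp add: neighbours_def)
  then have s1: "1 \<le> s" "s \<le> j"
    using fin unfolding s_def j_def by (auto simp: Suc_le_eq card_gt_0_iff One_nat_def intro!: card_mono)
  have each: "potential (card (undecided Q n I')) \<le> potential (j - s)"
    if I': "(I', F') \<in> set (children (I, F) us)" for I' F'
  proof -
    obtain u where u: "u \<in> set us" "I' = insert u I" using set_children(1)[OF I'] by blast
    then have "u \<in> undecided Q n I" using assms(4) by blast
    then show ?thesis
      using assms(2) card_undecided_insert[of u Q n I] unfolding u(2) s_def j_def
      by (intro potential_mono) (auto intro!: diff_le_mono2)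
  qed
  have len: "length (children (I, F) us) = length us" by (simp add: children_def)
  have "(\<Sum>(I, F)\<leftarrow>children (I, F) us. potential (card (undecided Q n I))) \<le>
      (\<Sum>f\<leftarrow>children (I, F) us. potential (j - s))"
    by (rule sum_list_mono) (use each in auto)
  also have "\<dots> = real (length us) * potential (j - s)" by (simp add: sum_list_triv len)
  also have "\<dots> \<le> real s * potential (j - s)"
  proof -
    have "length us = card (set us)" using assms(3) by (simp add: distinct_card)
    also have "\<dots> \<le> s" unfolding s_def using fin assms(4) by (intro card_mono) auto
    finally show ?thesis by (intro mult_right_mono potential_nonneg) simp
  qed
  finally show ?thesis using potential_branch[OF s1] by linarith
qed

text \<open>The 2 pays for the tests of the loop and of the conditional. A branching node costs
  O(j^2) for the degrees and O(nj) for its frames, a leaf O(n + r); one product covers both, so a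
  single potential serves both cases.\<close>

lemma search_cost:
  assumes "\<rho> 7 = n" "\<rho> 5 = r" "\<rho> 9 = j"
  shows "2 + cost visit_node \<rho> + cost branch_node \<rho> \<le> 400 * ((n + r + 1) * (j + 1)\<^sup>2)"
    "2 + cost visit_node \<rho> + cost leaf \<rho> \<le> 400 * ((n + r + 1) * (j + 1)\<^sup>2)"
proof -
  let ?X = "(n + r + 1) * (j + 1)\<^sup>2"
  have X: "?X = n * (j * j) + r * (j * j) + j * j + 2 * (n * j) + 2 * (r * j) + 2 * j + n + r + 1"
    by (simp add: power2_eq_square algebra_simps)
  define x where "x = ?X"
  have le: "j * j \<le> x" "n * j \<le> x" "j \<le> x" "n \<le> x" "r \<le> x" "1 \<le> x"
    unfolding x_def X by simp_all
  have "2 + cost visit_node \<rho> + cost branch_node \<rho> \<le> 60 + 60 * n + 100 * j + 60 * (j * j) + 60 * (n * j)"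
    unfolding visit_node_def branch_node_def pop_frame_def collect_undecided_def choose_vertex_def
      expand_node_def push_frame_def
    by (simp add: assms algebra_simps)
  also have "\<dots> \<le> 400 * x" using le by linarith
  finally show "2 + cost visit_node \<rho> + cost branch_node \<rho> \<le> 400 * ?X" unfolding x_def .
  have "2 + cost visit_node \<rho> + cost leaf \<rho> \<le> 60 + 60 * n + 60 * r"
    unfolding visit_node_def leaf_def pop_frame_def collect_undecided_def check_support_def
      check_model_def emit_model_def
    by (simp add: assms algebra_simps)
  also have "\<dots> \<le> 400 * x" using le by linarith
  finally show "2 + cost visit_node \<rho> + cost leaf \<rho> \<le> 400 * ?X" unfolding x_def .
qed

lemma search_step_exec:
  assumes inv: "search_inv ql Q n u (fs, outs) s" and "holds (Less 4 8) s"
  defines "B \<equiv> 400 * real (n + length ql + 1)"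
  shows "\<exists>t s' x. exec search_step s t s' \<and> search_inv ql Q n u x s' \<and>
    1 + real t + search_potential Q n B x \<le> search_potential Q n B (fs, outs)"
proof -
  have rd: "ready ql Q n s" and st: "stack Q n s fs" using inv by (auto simp: search_inv_def)
  have "fs \<noteq> []" using assms(2) st ready_simps(2)[OF rd] by (auto simp: stack_def)
  then obtain gs I F where fs: "fs = gs @ [(I, F)]" by (metis prod.exhaust rev_exhaust)
  have I: "0 \<in> I" "I \<subseteq> {..<n}" "I \<inter> F = {}" using inv by (auto simp: search_inv_def fs)
  define s1 where "s1 = sem visit_node s"
  note vis = visit_node_sem[OF rd st[unfolded fs], folded s1_def]
  obtain L where L: "listed L s1" "distinct L" "set L = undecided Q n I" using vis(7) by blast
  define j where "j = card (undecided Q n I)"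
  have j: "reg s1 9 = j" using L by (simp add: listed_def j_def flip: distinct_card)
  have r5: "reg s1 5 = length ql" using vis(1) by (simp add: ready_def stored_def)
  define \<rho> where "\<rho> = (\<lambda>r::nat. if r = 7 then n else if r = 5 then length ql else j)"
  have "\<exists>t\<le>cost visit_node \<rho>. exec (compile visit_node) s t (sem visit_node s)"
    using ready_simps(1)[OF rd]
    by (intro exec_compile) (auto simp: visit_node_def pop_frame_def collect_undecided_def \<rho>_def)
  then obtain t1 where t1: "t1 \<le> cost visit_node \<rho>" "exec (compile visit_node) s t1 s1"
    unfolding s1_def by blast
  have z: "reg s1 4 = 0" "reg s1 7 = n" using ready_simps(1,2)[OF vis(1)] by auto
  have pot: "search_potential Q n B (fs, outs) = search_potential Q n B (gs, outs) + B * potential j"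
    by (simp add: search_potential_def fs j_def algebra_simps)
  have cnt: "if u then \<forall>J. count_list outs J + length (filter (\<lambda>f. J \<in> extensions Q n f) gs) +
      (if J \<in> extensions Q n (I, F) then 1 else 0) = (if good Q n J then 1 else 0) else outs = []"
  proof -
    have len: "length (filter (\<lambda>f. J \<in> extensions Q n f) fs) = length (filter (\<lambda>f. J \<in> extensions Q n f) gs) +
        (if J \<in> extensions Q n (I, F) then 1 else 0)" for J
      by (simp add: fs)
    have "if u then \<forall>J. count_list outs J + length (filter (\<lambda>f. J \<in> extensions Q n f) fs) =
        (if good Q n J then 1 else 0) else outs = []"
      using inv by (simp add: search_inv_def del: filter.simps filter_append)
    then show ?thesis by (simp only: len add.assoc)
  qed
  have \<rho>: "\<rho> 7 = n" "\<rho> 5 = length ql" "\<rho> 9 = j" by (simp_all add: \<rho>_def)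
  have bound: "1 + real (t1 + (1 + t2)) \<le> B * (real j + 1)\<^sup>2"
    if "2 + cost visit_node \<rho> + t2 \<le> 400 * ((n + length ql + 1) * (j + 1)\<^sup>2)" for t2
  proof -
    have "1 + (t1 + (1 + t2)) \<le> 400 * ((n + length ql + 1) * (j + 1)\<^sup>2)" using that t1(1) by simp
    then have "real (1 + (t1 + (1 + t2))) \<le> real (400 * ((n + length ql + 1) * (j + 1)\<^sup>2))"
      by (rule of_nat_mono)
    then show ?thesis by (simp add: B_def algebra_simps)
  qed
  show ?thesis
  proof (cases "L = []")
    case True
    then have j0: "j = 0" and u0: "undecided Q n I = {}" using L by (auto simp: j_def)
    define s2 where "s2 = sem leaf s1"
    have "\<exists>t\<le>cost leaf \<rho>. exec (compile leaf) s1 t (sem leaf s1)"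
      using z r5 by (intro exec_compile)
        (auto simp: leaf_def check_support_def check_model_def emit_model_def \<rho>_def)
    then obtain t2 where t2: "t2 \<le> cost leaf \<rho>" "exec (compile leaf) s1 t2 s2"
      unfolding s2_def by blast
    have "exec search_step s (t1 + (1 + t2)) s2"
      unfolding search_step_def using j j0 z by (intro exec.Seq[OF t1(2)] exec.CondTrue[OF _ t2(2)]) simp
    moreover define outs' where "outs' = (if u \<and> good Q n I then outs @ [I] else outs)"
    have fr: "reg s2 r = reg s1 r" if "r \<in> {4, 5, 6, 7, 8}" for r
      using that unfolding s2_def
      by (auto simp: leaf_def check_support_def check_model_def emit_model_def sem_reg_frame simp del: sem.simps)
    have fa: "arr s2 A = arr s1 A" if "A \<noteq> 1" for A
      using that unfolding s2_def
      by (auto simp: leaf_def check_support_def check_model_def emit_model_def sem_arr_frame simp del: sem.simps)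
    have "search_inv ql Q n u (gs, outs') s2"
    proof -
      have "ready ql Q n s2" by (rule ready_cong[OF vis(1)]) (auto simp: fr fa)
      moreover have u: "reg s1 6 = 0 \<longleftrightarrow> u" using inv vis(6) by (simp add: search_inv_def)
      moreover have "stack Q n s2 gs"
        using vis(2) unfolding stack_def by (auto simp: fr fa elim!: frame_cong)
      moreover have "output_of s2 = code_atom_lists (map (model_list n (arr s2 7)) outs')"
      proof -
        have "output_of s1 = code_atom_lists (map (model_list n (arr s1 7)) outs)"
          using inv vis(4,5) by (simp add: search_inv_def)
        then show ?thesis
          using leaf_sem[OF vis(1,3) I(1,2)] u
          unfolding s2_def[symmetric] outs'_def by (simp add: fa code_atom_lists_def)
      qed
      moreover have "if u then \<forall>J. count_list outs' J + length (filter (\<lambda>f. J \<in> extensions Q n f) gs) =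
          (if good Q n J then 1 else 0) else outs' = []"
        using cnt unfolding outs'_def extensions_leaf[OF u0 I] by (auto split: if_splits)
      ultimately show ?thesis
        using inv by (auto simp: search_inv_def fs fr)
    qed
    moreover have "1 + real (t1 + (1 + t2)) + search_potential Q n B (gs, outs') \<le> search_potential Q n B (fs, outs)"
    proof -
      have "1 + real (t1 + (1 + t2)) \<le> B"
        using bound[of t2] search_cost(2)[OF \<rho>] t2(1) j0 by simp
      then show ?thesis unfolding pot j0 potential_0 by (simp add: search_potential_def)
    qed
    ultimately show ?thesis by blast
  next
    case False
    then have "j \<noteq> 0" using L unfolding j_def by (metis card_0_eq finite_set set_empty)
    define s2 where "s2 = sem branch_node s1"
    have "\<exists>t\<le>cost branch_node \<rho>. exec (compile branch_node) s1 t (sem branch_node s1)"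
      using z j by (intro exec_compile)
        (auto simp: branch_node_def choose_vertex_def expand_node_def push_frame_def \<rho>_def)
    then obtain t2 where t2: "t2 \<le> cost branch_node \<rho>" "exec (compile branch_node) s1 t2 s2"
      unfolding s2_def by blast
    have "exec search_step s (t1 + (1 + t2)) s2"
      unfolding search_step_def using j \<open>j \<noteq> 0\<close> z
      by (intro exec.Seq[OF t1(2)] exec.CondFalse[OF _ t2(2)]) simp
    moreover note br = branch_node_sem[OF vis(1-3) L False, folded s2_def]
    obtain v us where v: "stack Q n s2 (gs @ children (I, F) us)" "v \<in> undecided Q n I"
      "\<forall>u\<in>undecided Q n I. card {w \<in> undecided Q n I. (v, w) \<in> neighbours Q} \<le>
          card {w \<in> undecided Q n I. (u, w) \<in> neighbours Q}"
      "distinct us" "set us = {w \<in> undecided Q n I. (v, w) \<in> neighbours Q} - F"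
      using br(5) by blast
    have usI: "set us \<inter> (I \<union> F) = {}" using v(5) by (auto simp: undecided_def neighbours_def)
    have "search_inv ql Q n u (gs @ children (I, F) us, outs) s2"
    proof -
      have kids: "0 \<in> I' \<and> I' \<subseteq> {..<n} \<and> I' \<inter> F' = {}" if "(I', F') \<in> set (children (I, F) us)" for I' F'
        using set_children(1,3)[OF that] I v(4,5) usI by (auto simp: undecided_def)
      \<comment> \<open>Every extension meets the neighbourhood of \<open>v\<close>, so none is lost
        in passing from the node to its children.\<close>
      have "J \<inter> set us \<noteq> {}" if "J \<in> extensions Q n (I, F)" for J
      proof -
        have "good Q n J" "I \<subseteq> J" "J \<inter> F = {}" using that by (auto simp: extensions_def)
        then show ?thesis using good_meets_neighbourhood[of Q n J I v] v(2,5) by blast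
      qed
      then have len: "length (filter (\<lambda>f. J \<in> extensions Q n f) (children (I, F) us)) =
          (if J \<in> extensions Q n (I, F) then 1 else 0)" for J
        using count_children[OF v(4), of F J Q n I] usI by (auto simp: Int_Un_distrib)
      have "if u then \<forall>J. count_list outs J + length (filter (\<lambda>f. J \<in> extensions Q n f) (gs @ children (I, F) us)) =
          (if good Q n J then 1 else 0) else outs = []"
        using cnt by (simp only: filter_append length_append len add.assoc)
      moreover have "\<forall>(I, F)\<in>set (gs @ children (I, F) us). 0 \<in> I \<and> I \<subseteq> {..<n} \<and> I \<inter> F = {}"
        using inv kids by (auto simp: search_inv_def fs)
      moreover have "output_of s2 = code_atom_lists (map (model_list n (arr s2 7)) outs)" "reg s2 6 = 0 \<longleftrightarrow> u"
        using inv br(2-4) vis(4-6) by (simp_all add: search_inv_def)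
      ultimately show ?thesis
        using br(1) v(1) unfolding search_inv_def by simp
    qed
    moreover have "1 + real (t1 + (1 + t2)) + search_potential Q n B (gs @ children (I, F) us, outs)
        \<le> search_potential Q n B (fs, outs)"
    proof -
      have "1 + real (t1 + (1 + t2)) \<le> B * (real j + 1)\<^sup>2"
        using bound[of t2] search_cost(1)[OF \<rho>] t2(1) by simp
      moreover have "B * ((real j + 1)\<^sup>2 + (\<Sum>(I, F)\<leftarrow>children (I, F) us. potential (card (undecided Q n I)))) \<le> B * potential j"
        unfolding j_def using v(2-5) by (intro mult_left_mono potential_children) (auto simp: B_def)
      ultimately show ?thesis unfolding pot by (simp add: search_potential_def algebra_simps)
    qed
    ultimately show ?thesis by blast
  qed
qed

lemma search_exec:
  assumes "search_inv ql Q n u (fs, outs) s"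
  shows "\<exists>t s' outs'. exec (While (Less 4 8) search_step) s t s' \<and> search_inv ql Q n u ([], outs') s' \<and>
    real t \<le> 1 + search_potential Q n (400 * real (n + length ql + 1)) (fs, outs)"
proof -
  let ?B = "400 * real (n + length ql + 1)"
  have nonneg: "0 \<le> search_potential Q n ?B x" for x
    by (cases x) (auto simp: search_potential_def intro!: mult_nonneg_nonneg sum_list_nonneg potential_nonneg)
  obtain t s' x where t: "exec (While (Less 4 8) search_step) s t s'" "search_inv ql Q n u x s'"
    "\<not> holds (Less 4 8) s'" "real t \<le> 1 + search_potential Q n ?B (fs, outs)"
    using exec_While_potential[where invar = "search_inv ql Q n u" and pot = "search_potential Q n ?B" and b = "Less 4 8",
        OF assms nonneg] search_step_exec by (metis surj_pair)
  obtain fs' outs' where x: "x = (fs', outs')" by (cases x)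
  \<comment> \<open>For \<open>n = 0\<close> a zero stack pointer would not imply an empty stack;
    the numbers in array 6 lie below \<open>n\<close>, which excludes this.\<close>
  have "n > 0" using t(2) by (auto simp: x search_inv_def ready_def)
  then have "fs' = []" using t(2,3) ready_simps(2)[of ql Q n s'] by (auto simp: x search_inv_def stack_def)
  then show ?thesis using t x by blast
qed


section \<open>Enumerating the answers\<close>

text \<open>The root comes from \<open>push_frame\<close> too: arrays 14 to 17 are still zero and
  represent a node without chosen vertices, to which the vertex 0 is added.\<close>

definition start_search :: cmd where
  "start_search = build_graph ;; Do (Const 12 0) ;; Do (Const 16 1) ;; push_frame"

definition enumerate :: prog where
  "enumerate = Seq (compile number_atoms) (Seq (compile start_search) (While (Less 4 8) search_step))"

definition parsed :: "((nat \<times> nat) \<times> (nat \<times> nat)) list \<Rightarrow> ram_state \<Rightarrow> bool" where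
  "parsed ql s \<longleftrightarrow> stored ql s \<and> sym (set ql) \<and> reg s 1 = 0 \<and> reg s 4 = 0 \<and> reg s 7 = 0 \<and>
     reg s 8 = 0 \<and> (\<forall>A\<ge>6. \<forall>i. arr s A i = 0)"

lemma supports_bounded: "rel f n = supports Q \<Longrightarrow> supports Q \<subseteq> {..<n} \<times> {..<n}"
  by (auto simp: rel_def)

lemma start_search_sem:
  assumes "parsed ql s"
  defines "t \<equiv> sem start_search (sem number_atoms s)" and "n \<equiv> card ((snd \<circ> fst) ` set ql)"
  shows "reg (sem number_atoms s) 7 = Suc n" "reg (sem number_atoms s) 5 = length ql"
    "\<exists>Q. search_inv ql Q (Suc n) (reg s 6 = 0) ([({0}, {})], []) t"
proof -
  define s1 where "s1 = sem number_atoms s"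
  define s2 where "s2 = sem build_graph s1"
  have pz: "arr s A i = 0" if "A \<ge> 6" for A i using assms(1) that by (simp add: parsed_def)
  have p: "stored ql s" "sym (set ql)" "reg s 1 = 0" "reg s 4 = 0" "reg s 7 = 0" "reg s 8 = 0"
    using assms(1) by (auto simp: parsed_def)
  have fr1: "reg s1 r = reg s r" if "r \<notin> {2, 7, 10, 11, 12}" for r
    using that unfolding s1_def by (auto simp: number_atoms_def index_atoms_def sem_reg_frame simp del: sem.simps)
  have fa1: "arr s1 A = arr s A" if "A \<notin> {6, 7}" for A
    using that unfolding s1_def by (auto simp: number_atoms_def index_atoms_def sem_arr_frame simp del: sem.simps)
  let ?v = "arr s1 6" and ?w = "arr s1 7" and ?X = "(snd \<circ> fst) ` set ql"
  have ia: "indexed ?X (reg (sem index_atoms s) 7) (arr (sem index_atoms s) 6) (arr (sem index_atoms s) 7)"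
    using p pz by (intro index_atoms_sem) auto
  then have "n = reg (sem index_atoms s) 7"
    unfolding n_def using bij_betw_same_card by (fastforce simp: indexed_def)
  then have ix: "indexed ?X n ?v ?w" and N: "reg s1 7 = Suc n"
    using ia by (simp_all add: s1_def number_atoms_def)
  show "reg (sem number_atoms s) 7 = Suc n" using N by (simp add: s1_def)
  show "reg (sem number_atoms s) 5 = length ql" using p(1) fr1[of 5] by (simp add: s1_def stored_def)
  have vN: "?v a < reg s1 7" for a
  proof (cases "a \<in> ?X")
    case True
    then have "?v a \<in> {1..n}" using ix bij_betwE unfolding indexed_def by blast
    then show ?thesis by (simp add: N)
  next
    case False
    then have "?v a = 0" using ix unfolding indexed_def by blast
    then show ?thesis by (simp add: N)
  qed
  have st1: "stored ql s1" using p(1) by (simp add: stored_def fr1 fa1)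
  define Q where "Q = index_pairs ?v ql"
  have z1: "reg s1 4 = 0" using p by (simp add: fr1)
  note bg = build_graph_sem[OF st1 z1 vN _ p(2), folded s2_def Q_def, unfolded N]
  have fr2: "reg s2 r = reg s1 r" if "r \<notin> {2, 3, 10, 11, 12, 13, 14, 15, 16}" for r
    using that unfolding s2_def
    by (auto simp: build_graph_def set_offsets_def diagonal_def read_pairs_def warshall_def mark_mutual_def
        compose_supports_def symmetrize_def sem_reg_frame simp del: sem.simps)
  have fa2: "arr s2 A = arr s1 A" if "A \<notin> {8, 9, 10, 11, 12, 13}" for A
    using that unfolding s2_def
    by (auto simp: build_graph_def set_offsets_def diagonal_def read_pairs_def warshall_def mark_mutual_def
        compose_supports_def symmetrize_def sem_arr_frame simp del: sem.simps)
  define s3 where "s3 = set_reg 16 1 (set_reg 12 0 s2)"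
  have t: "t = sem push_frame s3"
    by (simp add: t_def s1_def s2_def s3_def start_search_def)
  have "ready ql Q (Suc n) s2"
    unfolding ready_def using bg pz st1 ix vN N z1 Q_def
    by (simp add: fr2 fa2 fa1 stored_def)
  then have rd: "ready ql Q (Suc n) s3"
    by (rule ready_cong) (auto simp: s3_def)
  have "current Q (Suc n) s3 ({}, {})"
    using pz by (simp add: current_def frame_def encodes_def s3_def fa1 fa2)
  moreover have "stack Q (Suc n) s3 []"
    using p by (simp add: stack_def s3_def fr1 fr2)
  ultimately have "stack Q (Suc n) t ([] @ [({0}, {})])"
    unfolding t by (intro push_frame_sem[OF rd]) (auto simp: s3_def)
  moreover have fr3: "reg t r = reg s3 r" if "r \<notin> {2, 3, 8, 11, 14, 15, 18}" for r
    using that unfolding t by (auto simp: push_frame_def sem_reg_frame simp del: sem.simps)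
  have fa3: "arr t A = arr s3 A" if "A \<notin> {18, 19, 20, 21}" for A
    using that unfolding t by (auto simp: push_frame_def sem_arr_frame simp del: sem.simps)
  have "ready ql Q (Suc n) t" by (rule ready_cong[OF rd]) (auto simp: fr3 fa3)
  moreover have "reg t 6 = reg s 6" "output_of t = []"
    using p by (simp_all add: fr1 fr2 fr3 s3_def output_of_def)
  \<comment> \<open>Good sets contain 0 by definition, so the root is responsible for all of
    them.\<close>
  moreover have "J \<in> extensions Q (Suc n) ({0}, {}) \<longleftrightarrow> good Q (Suc n) J" for J
    by (auto simp: extensions_def good_def)
  ultimately have "search_inv ql Q (Suc n) (reg s 6 = 0) ([({0}, {})], []) t"
    by (simp add: search_inv_def code_atom_lists_def)
  then show "\<exists>Q. search_inv ql Q (Suc n) (reg s 6 = 0) ([({0}, {})], []) t" by blast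
qed

lemma start_cost:
  assumes "\<rho> 7 = n" "\<rho> 5 = r" "n > 0"
  shows "cost number_atoms \<rho> \<le> 100 * (r + 1)" "cost start_search \<rho> \<le> 400 * n ^ 3 + 400 * r"
proof -
  show "cost number_atoms \<rho> \<le> 100 * (r + 1)"
    by (simp add: number_atoms_def index_atoms_def assms algebra_simps)
  have le: "1 \<le> n ^ 3" "n \<le> n ^ 3" "n * n \<le> n ^ 3"
    using assms(3) by (simp_all add: power3_eq_cube One_nat_def Suc_le_eq)
  have "cost start_search \<rho> \<le> 60 + 100 * n + 100 * (n * n) + 60 * n ^ 3 + 60 * r"
    unfolding start_search_def build_graph_def set_offsets_def diagonal_def read_pairs_def warshall_def
      mark_mutual_def compose_supports_def symmetrize_def push_frame_def
    by (simp add: assms algebra_simps power3_eq_cube)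
  also have "\<dots> \<le> 400 * n ^ 3 + 400 * r" using le by linarith
  finally show "cost start_search \<rho> \<le> 400 * n ^ 3 + 400 * r" .
qed

text \<open>The constant collects 400 * 729 for the graph, 400 * 2 * 71 for the search, and small
  terms.\<close>

lemma enumerate_exec:
  assumes "parsed ql s"
  defines "n \<equiv> card ((snd \<circ> fst) ` set ql)"
  shows "\<exists>t s' Q outs. exec enumerate s t s' \<and> search_inv ql Q (Suc n) (reg s 6 = 0) ([], outs) s' \<and>
    real t \<le> 400000 * real (length ql + 1) * growth ^ n"
proof -
  define s1 where "s1 = sem number_atoms s"
  define s2 where "s2 = sem start_search s1"
  let ?r = "length ql"
  define \<rho> where "\<rho> = (\<lambda>r::nat. if r = 7 then Suc n else ?r)"
  note ss = start_search_sem[OF assms(1), folded n_def s1_def s2_def]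
  have "\<exists>t\<le>cost number_atoms \<rho>. exec (compile number_atoms) s t (sem number_atoms s)"
    using assms(1) by (intro exec_compile)
      (auto simp: number_atoms_def index_atoms_def \<rho>_def parsed_def stored_def)
  then obtain t1 where t1: "t1 \<le> cost number_atoms \<rho>" "exec (compile number_atoms) s t1 s1"
    unfolding s1_def by blast
  have "\<exists>t\<le>cost start_search \<rho>. exec (compile start_search) s1 t (sem start_search s1)"
    using ss(1,2) by (intro exec_compile)
      (auto simp: start_search_def build_graph_def set_offsets_def diagonal_def read_pairs_def warshall_def
        mark_mutual_def compose_supports_def symmetrize_def push_frame_def \<rho>_def)
  then obtain t2 where t2: "t2 \<le> cost start_search \<rho>" "exec (compile start_search) s1 t2 s2"
    unfolding s2_def by blast
  obtain Q where Q: "search_inv ql Q (Suc n) (reg s 6 = 0) ([({0}, {})], []) s2" using ss(3) by blast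
  obtain t3 s' outs where t3: "exec (While (Less 4 8) search_step) s2 t3 s'"
    "search_inv ql Q (Suc n) (reg s 6 = 0) ([], outs) s'"
    "real t3 \<le> 1 + search_potential Q (Suc n) (400 * real (Suc n + ?r + 1)) ([({0}, {})], [])"
    using search_exec[OF Q] by blast
  have "exec enumerate s (t1 + (t2 + t3)) s'"
    unfolding enumerate_def by (intro exec.Seq[OF t1(2)] exec.Seq[OF t2(2)] t3(1))
  moreover have "real (t1 + (t2 + t3)) \<le> 400000 * real (?r + 1) * growth ^ n"
  proof -
    let ?g = "growth ^ n" and ?R = "real (?r + 1)"
    have g: "1 \<le> ?g" using growth_bounds by simp
    have \<rho>: "\<rho> 7 = Suc n" "\<rho> 5 = ?r" "Suc n > 0" by (auto simp: \<rho>_def)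
    \<comment> \<open>Every atom comes from a stored pair, so the number of pairs absorbs
      \<open>n\<close> in the linear factor.\<close>
    have nr: "n \<le> ?r" unfolding n_def by (metis card_image_le card_length finite_set le_trans)
    have Rg: "?R \<le> ?R * ?g" "?g \<le> ?R * ?g" using g by auto
    have b1: "real t1 \<le> 100 * ?R"
      using t1(1) start_cost(1)[OF \<rho>] by linarith
    have b2: "real t2 \<le> 291600 * ?g + 400 * ?R"
    proof -
      have "t2 \<le> 400 * Suc n ^ 3 + 400 * ?r" using t2(1) start_cost(2)[OF \<rho>] by linarith
      then have "real t2 \<le> real (400 * Suc n ^ 3 + 400 * ?r)" by (rule of_nat_mono)
      also have "\<dots> = 400 * (real n + 1) ^ 3 + 400 * real ?r" by (simp add: add.commute)
      finally show ?thesis using cube_le_growth[of n] by simp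
    qed
    have b3: "real t3 \<le> 1 + 56800 * (?R * ?g)"
    proof -
      have "card (undecided Q (Suc n) {0}) \<le> card {1..n}"
        by (rule card_mono) (auto simp: undecided_def neighbours_def One_nat_def Suc_le_eq)
      then have "potential (card (undecided Q (Suc n) {0})) \<le> potential n" by (intro potential_mono) simp
      then have P: "potential (card (undecided Q (Suc n) {0})) \<le> 71 * ?g"
        using potential_le[of n] by linarith
      have "search_potential Q (Suc n) (400 * real (Suc n + ?r + 1)) ([({0}, {})], []) =
          400 * real (Suc n + ?r + 1) * potential (card (undecided Q (Suc n) {0}))"
        by (simp add: search_potential_def)
      also have "\<dots> \<le> 400 * (2 * ?R) * (71 * ?g)"
        using nr by (intro mult_mono P mult_left_mono) (auto intro: potential_nonneg)
      finally show ?thesis using t3(3) by (simp add: algebra_simps)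
    qed
    have b4: "1 \<le> ?R * ?g" using Rg g by linarith
    have "a + (b + c) \<le> 400000 * x" if "a \<le> 100 * R" "b \<le> 291600 * g + 400 * R"
      "c \<le> 1 + 56800 * x" "R \<le> x" "g \<le> x" "1 \<le> x" for a b c x R g :: real
      using that by linarith
    from this[OF b1 b2 b3 Rg b4] have "real (t1 + (t2 + t3)) \<le> 400000 * (?R * ?g)"
      by (simp only: of_nat_add)
    then show ?thesis by (simp only: mult.assoc)
  qed
  ultimately show ?thesis using t3(2) by blast
qed

section \<open>Translating good sets back into minimal models\<close>

lemma item_true_index:
  assumes "inj_on v X" "M \<subseteq> X" "N \<subseteq> X" "a \<in> X"
  shows "item_true (v ` M) (v ` N) (k, v a) \<longleftrightarrow> item_true M N (k, a)"
  using assms by (simp add: item_true_def inj_on_image_mem_iff)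

lemma red_model_index:
  assumes "sym (set ql)" "inj_on v X" "X = (snd \<circ> fst) ` set ql" "M \<subseteq> X" "N \<subseteq> X"
  shows "red_model (index_pairs v ql) (v ` M) (v ` N) \<longleftrightarrow> red_model (set ql) M N"
proof -
  have "item_true (v ` M) (v ` N) (k, v a) = item_true M N (k, a) \<and>
      item_true (v ` M) (v ` N) (l, v b) = item_true M N (l, b)" if ab: "((k, a), (l, b)) \<in> set ql" for k a l b
  proof -
    have "((l, b), (k, a)) \<in> set ql" using ab assms(1) by (meson symD)
    then have "a \<in> X" "b \<in> X" using ab unfolding assms(3) by force+
    then show ?thesis using item_true_index[OF assms(2,4,5)] by blast
  qed
  then show ?thesis unfolding red_model_def index_pairs_def by fastforce
qed

text \<open>Renumbering by the injection \<open>v\<close> preserves minimality, so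
  \<open>minimal_red_model_iff\<close> applies. There the supporter is any number outside the model;
  the bound on \<open>supports\<close> places it among the vertices and hence in the
  complement.\<close>

lemma good_iff_minimal:
  assumes "sym (set ql)" "X = (snd \<circ> fst) ` set ql" "indexed X n v w" "M \<subseteq> X"
    and "supports (index_pairs v ql) \<subseteq> {..<Suc n} \<times> {..<Suc n}"
  shows "good (index_pairs v ql) (Suc n) ({..<Suc n} - v ` M) \<longleftrightarrow> minimal (red_model (set ql) M) M"
proof -
  let ?Q = "index_pairs v ql"
  have v: "inj_on v X" "v ` X = {1..n}" using assms(3) by (auto simp: indexed_def bij_betw_def)
  have vM: "v ` M \<subseteq> {1..n}" using assms(4) v(2) by blast
  have "minimal (red_model (set ql) M) M \<longleftrightarrow> minimal (red_model ?Q (v ` M)) (v ` M)"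
  proof -
    have "(\<exists>N'. N' \<subset> v ` M \<and> red_model ?Q (v ` M) N') \<longleftrightarrow> (\<exists>N. N \<subset> M \<and> red_model (set ql) M N)"
    proof
      assume "\<exists>N'. N' \<subset> v ` M \<and> red_model ?Q (v ` M) N'"
      then obtain N where "N \<subset> M" "red_model ?Q (v ` M) (v ` N)"
        by (metis psubsetE psubsetI subset_imageE)
      then show "\<exists>N. N \<subset> M \<and> red_model (set ql) M N"
        using red_model_index[OF assms(1) v(1) assms(2,4), of N] assms(4) by blast
    next
      assume "\<exists>N. N \<subset> M \<and> red_model (set ql) M N"
      then obtain N where N: "N \<subset> M" "red_model (set ql) M N" by blast
      then have "red_model ?Q (v ` M) (v ` N)"
        using red_model_index[OF assms(1) v(1) assms(2,4), of N] assms(4) by blast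
      moreover have "v ` N \<subset> v ` M"
        using N(1) v(1) assms(4) by (meson image_strict_mono inj_on_subset)
      ultimately show "\<exists>N'. N' \<subset> v ` M \<and> red_model ?Q (v ` M) N'" by blast
    qed
    then show ?thesis
      using red_model_index[OF assms(1) v(1) assms(2,4,4)] unfolding minimal_def by blast
  qed
  also have "\<dots> \<longleftrightarrow> red_model ?Q (v ` M) (v ` M) \<and> (\<forall>a\<in>v ` M. \<exists>x. x \<notin> v ` M \<and> (x, a) \<in> supports ?Q)"
  proof (rule minimal_red_model_iff)
    show "sym ?Q" using assms(1) by (rule sym_index_pairs)
    show "finite (v ` M)" "0 \<notin> v ` M" using vM finite_subset by auto
  qed
  also have "\<dots> \<longleftrightarrow> good ?Q (Suc n) ({..<Suc n} - v ` M)"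
  proof -
    define J where "J = {..<Suc n} - v ` M"
    have J: "{..<Suc n} - J = v ` M" "0 \<in> J" "J \<subseteq> {..<Suc n}" using vM by (auto simp: J_def)
    have "(\<exists>x. x \<notin> v ` M \<and> (x, a) \<in> supports ?Q) \<longleftrightarrow> (\<exists>x\<in>J. (x, a) \<in> supports ?Q)" for a
      unfolding J_def using assms(5) by auto
    moreover have "a \<in> v ` M \<longleftrightarrow> a < Suc n \<and> a \<notin> J" for a
      unfolding J_def using vM by auto
    ultimately have "(\<forall>a\<in>v ` M. \<exists>x. x \<notin> v ` M \<and> (x, a) \<in> supports ?Q) \<longleftrightarrow>
        (\<forall>a<Suc n. a \<notin> J \<longrightarrow> (\<exists>x\<in>J. (x, a) \<in> supports ?Q))"
      by (simp only: Ball_def imp_conjL)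
    then show ?thesis using J(2,3) unfolding J_def[symmetric] good_def J(1) by blast
  qed
  finally show ?thesis by blast
qed

text \<open>Dropping atoms that occur in no pair affects no item. Enumerating subsets of the
  numbered atoms therefore misses no minimal model.\<close>

lemma minimal_red_model_atoms:
  assumes "sym (set ql)" "minimal (red_model (set ql) M) M"
  shows "M \<subseteq> (snd \<circ> fst) ` set ql"
proof -
  let ?X = "(snd \<circ> fst) ` set ql"
  have "red_model (set ql) M (M \<inter> ?X)"
  proof -
    have "item_true M (M \<inter> ?X) x \<or> item_true M (M \<inter> ?X) y" if xy: "(x, y) \<in> set ql" for x y
    proof -
      have "(y, x) \<in> set ql" using xy assms(1) by (meson symD)
      then have "snd x \<in> ?X" "snd y \<in> ?X" using xy by force+
      moreover have "item_true M M x \<or> item_true M M y"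
        using assms(2) xy by (auto simp: minimal_def red_model_def)
      ultimately show ?thesis by (auto simp: item_true_def)
    qed
    then show ?thesis by (auto simp: red_model_def)
  qed
  then show ?thesis using assms(2) unfolding minimal_def by blast
qed

lemma distinct_if_count_le_1: "(\<And>x. count_list xs x \<le> 1) \<Longrightarrow> distinct xs"
proof (induction xs)
  case (Cons a xs)
  have "count_list xs x \<le> 1" for x using Cons.prems[of x] by (auto split: if_splits)
  moreover have "a \<notin> set xs" using Cons.prems[of a] by (auto simp: count_list_0_iff)
  ultimately show ?case using Cons.IH by simp
qed simp

lemma set_model_list: "set (model_list n w J) = w ` ({..<n} - J)"
  by (auto simp: model_list_def)

lemma distinct_model_list:
  assumes "inj_on w ({..<n} - J)"
  shows "distinct (model_list n w J)"
proof -
  have "set (filter (\<lambda>a. a \<notin> J) [0..<n]) = {..<n} - J" by auto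
  then show ?thesis using assms by (simp add: model_list_def distinct_map)
qed

lemma output_family:
  assumes "search_inv ql Q (Suc n) u ([], outs) s" "sym (set ql)" "u"
  shows "lists_family (map (model_list (Suc n) (arr s 7)) outs) {M. minimal (red_model (set ql) M) M}"
proof -
  define X where "X = (snd \<circ> fst) ` set ql"
  define v where "v = arr s 6"
  define w where "w = arr s 7"
  have rd: "ready ql Q (Suc n) s" and count: "count_list outs J = (if good Q (Suc n) J then 1 else 0)" for J
    using assms(1,3) by (auto simp: search_inv_def)
  have ix: "indexed X n v w" and Q: "Q = index_pairs v ql"
    and sb: "supports (index_pairs v ql) \<subseteq> {..<Suc n} \<times> {..<Suc n}"
    using rd supports_bounded[of "arr s 12"] unfolding ready_def X_def v_def w_def by auto
  have outs: "set outs = {J. good Q (Suc n) J}"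
  proof -
    have "J \<in> set outs \<longleftrightarrow> good Q (Suc n) J" for J
      using count[of J] count_list_0_iff[of outs J] by (auto split: if_splits)
    then show ?thesis by blast
  qed
  have dist: "distinct outs" using count by (intro distinct_if_count_le_1) simp
  have bij: "bij_betw v X {1..n}" and wv: "\<And>a. a \<in> X \<Longrightarrow> w (v a) = a" using ix by (auto simp: indexed_def)
  have vw: "w i \<in> X \<and> v (w i) = i" if "i \<in> {1..n}" for i
  proof -
    have "i \<in> v ` X" using bij that by (simp only: bij_betw_def)
    then obtain a where "i = v a" "a \<in> X" by (rule imageE)
    then show ?thesis using wv[of a] by (simp only: simp_thms)
  qed
  have winj: "inj_on w {1..n}" using vw by (intro inj_on_inverseI[where g = v]) blast
  have J: "{..<Suc n} - J \<subseteq> {1..n}" if "good Q (Suc n) J" for J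
    using that by (auto simp: good_def Suc_le_eq One_nat_def intro: gr0I)
  note set_ml = set_model_list[of "Suc n" w]
  have "distinct (model_list (Suc n) w J)" if "good Q (Suc n) J" for J
    using inj_on_subset[OF winj J[OF that]] by (rule distinct_model_list)
  moreover have "inj_on (\<lambda>J. set (model_list (Suc n) w J)) (set outs)"
  proof (rule inj_onI)
    fix J K assume a: "J \<in> set outs" "K \<in> set outs" "set (model_list (Suc n) w J) = set (model_list (Suc n) w K)"
    have g: "good Q (Suc n) J" "good Q (Suc n) K" using a(1,2) unfolding outs by simp_all
    have "{..<Suc n} - J = {..<Suc n} - K"
      using a(3) inj_on_image_eq_iff[OF winj J[OF g(1)] J[OF g(2)]] by (simp only: set_ml)
    moreover have "J \<subseteq> {..<Suc n}" "K \<subseteq> {..<Suc n}" using g unfolding good_def by blast+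
    ultimately show "J = K" by blast
  qed
  moreover have "(\<lambda>J. set (model_list (Suc n) w J)) ` set outs = {M. minimal (red_model (set ql) M) M}"
  proof (intro equalityI subsetI)
    fix M assume "M \<in> (\<lambda>J. set (model_list (Suc n) w J)) ` set outs"
    then obtain K where K: "good Q (Suc n) K" "M = w ` ({..<Suc n} - K)" by (auto simp: outs set_ml)
    have "M \<subseteq> X" unfolding K(2) using J[OF K(1)] vw by blast
    moreover have "v ` M = {..<Suc n} - K"
    proof -
      have "v ` M = id ` ({..<Suc n} - K)"
        unfolding K(2) image_image by (rule image_cong) (use J[OF K(1)] vw in auto)
      then show ?thesis by simp
    qed
    moreover have "{..<Suc n} - ({..<Suc n} - K) = K" using K(1) by (auto simp: good_def)
    ultimately show "M \<in> {M. minimal (red_model (set ql) M) M}"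
      using good_iff_minimal[OF assms(2) X_def ix _ sb, of M] K(1) unfolding Q by simp
  next
    fix M assume "M \<in> {M. minimal (red_model (set ql) M) M}"
    then have min: "minimal (red_model (set ql) M) M" by simp
    then have MX: "M \<subseteq> X" unfolding X_def by (rule minimal_red_model_atoms[OF assms(2)])
    then have "good Q (Suc n) ({..<Suc n} - v ` M)"
      using good_iff_minimal[OF assms(2) X_def ix _ sb, of M] min unfolding Q by simp
    moreover have "M = w ` ({..<Suc n} - ({..<Suc n} - v ` M))"
    proof -
      have "v ` M \<subseteq> {1..n}" using MX bij unfolding bij_betw_def by blast
      then have "{..<Suc n} - ({..<Suc n} - v ` M) = v ` M" by auto
      moreover have "w ` v ` M = id ` M"
        unfolding image_image by (rule image_cong) (use MX wv in auto)
      ultimately show ?thesis by simp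
    qed
    ultimately show "M \<in> (\<lambda>J. set (model_list (Suc n) w J)) ` set outs"
      unfolding outs set_ml by blast
  qed
  ultimately show ?thesis
    using dist outs unfolding lists_family_def w_def[symmetric] by (auto simp: distinct_map comp_def image_image)
qed


section \<open>Reading the input\<close>

text \<open>Both orders are stored to obtain the symmetry on which the graph rests. A single item is
  a disjunction with itself; storing it twice lets the parser write two pairs for every nonempty
  rule.\<close>

fun pairs_of :: "(nat \<times> nat) list \<Rightarrow> ((nat \<times> nat) \<times> (nat \<times> nat)) list" where
  "pairs_of [] = []"
| "pairs_of [x] = [(x, x), (x, x)]"
| "pairs_of (x # y # zs) = [(x, y), (y, x)]"

text \<open>Registers 21 and 22 keep the first item, 23 and 24 the latest one; for a single item
  they agree and yield its pair with itself. Register 20 tells whether there is an item yet.\<close>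

definition push_item :: cmd where
  "push_item = Do (Copy 23 25) ;; Do (Copy 24 26) ;;
     Branch (Equal 20 4) (Do (Copy 21 25) ;; Do (Copy 22 26)) Nop ;; Do (Copy 20 27)"

abbreviation "read_cell x \<equiv> Do (Load x 0 19) ;; Do (Add 19 19 27)"

text \<open>Lists have at most two entries, so two conditional reads replace a loop and the cost is
  constant.\<close>

definition read_list :: "nat \<Rightarrow> cmd" where
  "read_list k = read_cell 28 ;; Do (Const 25 k) ;; when_nz 28
     (read_cell 26 ;; push_item ;; Branch (Less 27 28) (read_cell 26 ;; push_item) Nop)"

definition read_head :: cmd where
  "read_head = Do (Const 25 1) ;; read_cell 26 ;; push_item"

definition read_clause :: cmd where
  "read_clause = read_cell 28 ;; when_nz 28 (read_cell 25 ;; read_cell 26 ;; push_item ;;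
     Branch (Less 27 28) (read_cell 25 ;; read_cell 26 ;; push_item) Nop)"

definition end_rule :: cmd where
  "end_rule = Branch (Equal 20 4) (Do (Copy 6 27))
     (Do (Store 2 5 21) ;; Do (Store 3 5 22) ;; Do (Store 4 5 23) ;; Do (Store 5 5 24) ;; Do (Add 5 5 27) ;;
      Do (Store 2 5 23) ;; Do (Store 3 5 24) ;; Do (Store 4 5 21) ;; Do (Store 5 5 22) ;; Do (Add 5 5 27))"

text \<open>The number of rules is not part of the input, but every rule occupies at least one cell.
  The input length thus bounds the number of rounds, and the rounds behind the last rule are
  idle.\<close>

definition parser :: "cmd \<Rightarrow> cmd" where
  "parser c = For 10 0 (Branch (Less 19 0) (Do (Const 20 0) ;; Do (Const 27 1) ;; c ;; end_rule) Nop)"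

definition held :: "(nat \<times> nat) list \<Rightarrow> ram_state \<Rightarrow> bool" where
  "held q s \<longleftrightarrow> (if q = [] then reg s 20 = 0 else
     reg s 20 \<noteq> 0 \<and> hd q = (reg s 21, reg s 22) \<and> last q = (reg s 23, reg s 24))"

lemma push_item_sem:
  assumes "held q s" "reg s 4 = 0" "reg s 27 = 1"
  shows "held (q @ [(reg s 25, reg s 26)]) (sem push_item s)"
  using assms by (cases q) (auto simp: held_def push_item_def)

lemma push_item_frame [simp]:
  "r \<notin> {20, 21, 22, 23, 24} \<Longrightarrow> reg (sem push_item s) r = reg s r"
  "arr (sem push_item s) = arr s"
  by (auto simp: push_item_def)

text \<open>\<open>scans c u q\<close>: running \<open>c\<close> in front of the cells \<open>u\<close> consumes them and appends the items
  \<open>q\<close> to those held for the current rule, of which there are at most two.\<close>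

definition scans :: "cmd \<Rightarrow> nat list \<Rightarrow> (nat \<times> nat) list \<Rightarrow> bool" where
  "scans c u q \<longleftrightarrow> regs c \<subseteq> {19, 20, 21, 22, 23, 24, 25, 26, 28} \<and> arrs c = {} \<and>
     (\<forall>s p. reg s 4 = 0 \<longrightarrow> reg s 27 = 1 \<longrightarrow> held p s \<longrightarrow> length (p @ q) \<le> 2 \<longrightarrow>
       (\<forall>i<length u. arr s 0 (reg s 19 + i) = u ! i) \<longrightarrow>
       held (p @ q) (sem c s) \<and> reg (sem c s) 19 = reg s 19 + length u)"

lemma scansD:
  assumes "scans c u q" "reg s 4 = 0" "reg s 27 = 1" "held p s" "length (p @ q) \<le> 2"
    "\<And>i. i < length u \<Longrightarrow> arr s 0 (reg s 19 + i) = u ! i"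
  shows "held (p @ q) (sem c s)" "reg (sem c s) 19 = reg s 19 + length u"
  using assms unfolding scans_def by blast+

lemma scans_frame:
  assumes "scans c u q"
  shows "r \<notin> {19, 20, 21, 22, 23, 24, 25, 26, 28} \<Longrightarrow> reg (sem c s) r = reg s r"
    "arr (sem c s) A = arr s A"
  using assms sem_reg_frame[of r c s] sem_arr_frame[of A c s] unfolding scans_def by auto

lemma scans_Then:
  assumes c: "scans c u q" and d: "scans d u' q'"
  shows "scans (c ;; d) (u @ u') (q @ q')"
proof -
  have "held (p @ q @ q') (sem (c ;; d) s) \<and> reg (sem (c ;; d) s) 19 = reg s 19 + length (u @ u')"
    if s: "reg s 4 = 0" "reg s 27 = 1" "held p s" "length (p @ q @ q') \<le> 2"
      "\<forall>i<length (u @ u'). arr s 0 (reg s 19 + i) = (u @ u') ! i" for s p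
  proof -
    have i: "arr s 0 (reg s 19 + i) = u ! i" if "i < length u" for i
      using s(5) that by (auto simp: nth_append)
    have h: "held (p @ q) (sem c s)" "reg (sem c s) 19 = reg s 19 + length u"
      using scansD[OF c s(1-3) _ i] s(4) by auto
    have i': "arr (sem c s) 0 (reg (sem c s) 19 + i) = u' ! i" if "i < length u'" for i
      using s(5)[rule_format, of "length u + i"] that by (simp add: scans_frame[OF c] h add.assoc)
    have "reg (sem c s) 4 = 0" "reg (sem c s) 27 = 1" using s(1,2) by (simp_all add: scans_frame[OF c])
    from scansD[OF d this h(1) _ i'] s(4) h(2) show ?thesis by simp
  qed
  then show ?thesis using c d unfolding scans_def by simp
qed

lemma scans_read_head: "scans read_head [a] [(1, a)]"
  unfolding scans_def
proof (intro conjI allI impI)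
  fix s p
  assume s: "reg s 4 = 0" "reg s 27 = 1" "held p s" "\<forall>i<length [a]. arr s 0 (reg s 19 + i) = [a] ! i"
  let ?s = "set_reg 19 (reg s 19 + 1) (set_reg 26 a (set_reg 25 1 s))"
  have e: "sem read_head s = sem push_item ?s" using s by (simp add: read_head_def)
  have "held p ?s" using s(3) by (simp add: held_def)
  then show "held (p @ [(1, a)]) (sem read_head s)"
    unfolding e using push_item_sem[of p ?s] s by simp
  show "reg (sem read_head s) 19 = reg s 19 + length [a]" unfolding e by simp
qed (auto simp: read_head_def push_item_def)

lemma scans_read_list:
  assumes "length xs \<le> 2"
  shows "scans (read_list k) (length xs # xs) (map (Pair k) xs)"
  unfolding scans_def
proof (intro conjI allI impI)
  fix s p
  assume s: "reg s 4 = 0" "reg s 27 = 1" "held p s" and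
    u: "\<forall>i<length (length xs # xs). arr s 0 (reg s 19 + i) = (length xs # xs) ! i"
  have l: "arr s 0 (reg s 19) = length xs" using u by force
  have x: "arr s 0 (reg s 19 + 1 + i) = xs ! i" if "i < length xs" for i
    using u[rule_format, of "Suc i"] that by (simp add: Suc_eq_plus1 ac_simps)
  let ?s0 = "set_reg 25 k (set_reg 19 (reg s 19 + 1) (set_reg 28 (length xs) s))"
  let ?s1 = "set_reg 19 (reg s 19 + 1 + 1) (set_reg 26 (xs ! 0) ?s0)"
  let ?s2 = "set_reg 19 (reg s 19 + 1 + 1 + 1) (set_reg 26 (xs ! 1) (sem push_item ?s1))"
  have h: "held p ?s0" "held p ?s1" using s(3) by (simp_all add: held_def)
  have h1: "held (p @ [(k, xs ! 0)]) (sem push_item ?s1)"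
    using push_item_sem[OF h(2)] s by simp
  then have "held (p @ [(k, xs ! 0)]) ?s2" by (simp add: held_def)
  then have h2: "held ((p @ [(k, xs ! 0)]) @ [(k, xs ! 1)]) (sem push_item ?s2)"
    using push_item_sem[of "p @ [(k, xs ! 0)]" ?s2] s by simp
  consider "xs = []" | a where "xs = [a]" | a b where "xs = [a, b]"
    using assms by (cases xs; cases "tl xs"; auto simp: numeral_2_eq_2)
  then have "held (p @ map (Pair k) xs) (sem (read_list k) s) \<and>
      reg (sem (read_list k) s) 19 = reg s 19 + length (length xs # xs)"
  proof cases
    case 1
    then have "sem (read_list k) s = ?s0" using s l by (simp add: read_list_def)
    then show ?thesis using h 1 by simp
  next
    case 2
    have "sem (read_list k) s = sem push_item ?s1"
      using s l x[of 0] 2 by (simp add: read_list_def)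
    then show ?thesis using h1 2 by simp
  next
    case 3
    have "sem (read_list k) s = sem push_item ?s2"
      using s l x[of 0] x[of 1] 3 by (simp add: read_list_def)
    then show ?thesis using h2 3 by simp
  qed
  then show "held (p @ map (Pair k) xs) (sem (read_list k) s)"
    "reg (sem (read_list k) s) 19 = reg s 19 + length (length xs # xs)" by blast+
qed (auto simp: read_list_def push_item_def)

fun lit_item :: "lit \<Rightarrow> nat \<times> nat" where
  "lit_item (Pos a) = (1, a)"
| "lit_item (Neg a) = (0, a)"

lemma code_lit_item: "code_lit l = [fst (lit_item l), snd (lit_item l)]"
  by (cases l) auto

lemma scans_read_clause:
  assumes "length xs \<le> 2"
  shows "scans read_clause (length xs # concat (map code_lit xs)) (map lit_item xs)"
  unfolding scans_def
proof (intro conjI allI impI)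
  fix s p
  assume s: "reg s 4 = 0" "reg s 27 = 1" "held p s" and
    u: "\<forall>i<length (length xs # concat (map code_lit xs)).
      arr s 0 (reg s 19 + i) = (length xs # concat (map code_lit xs)) ! i"
  have l: "arr s 0 (reg s 19) = length xs" using u by force
  let ?x = "lit_item (xs ! 0)" and ?y = "lit_item (xs ! 1)"
  let ?s0 = "set_reg 19 (reg s 19 + 1) (set_reg 28 (length xs) s)"
  let ?s1 = "set_reg 19 (reg s 19 + 1 + 1 + 1) (set_reg 26 (snd ?x) (set_reg 19 (reg s 19 + 1 + 1) (set_reg 25 (fst ?x) ?s0)))"
  let ?s2 = "set_reg 19 (reg s 19 + 1 + 1 + 1 + 1 + 1) (set_reg 26 (snd ?y) (set_reg 19 (reg s 19 + 1 + 1 + 1 + 1) (set_reg 25 (fst ?y) (sem push_item ?s1))))"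
  have h: "held p ?s0" "held p ?s1" using s(3) by (simp_all add: held_def)
  have h1: "held (p @ [?x]) (sem push_item ?s1)"
    using push_item_sem[OF h(2)] s by simp
  then have "held (p @ [?x]) ?s2" by (simp add: held_def)
  then have h2: "held ((p @ [?x]) @ [?y]) (sem push_item ?s2)"
    using push_item_sem[of "p @ [?x]" ?s2] s by simp
  consider "xs = []" | a where "xs = [a]" | a b where "xs = [a, b]"
    using assms by (cases xs; cases "tl xs"; auto simp: numeral_2_eq_2)
  then have "held (p @ map lit_item xs) (sem read_clause s) \<and>
      reg (sem read_clause s) 19 = reg s 19 + length (length xs # concat (map code_lit xs))"
  proof cases
    case 1
    then have "sem read_clause s = ?s0" using s l by (simp add: read_clause_def)
    then show ?thesis using h 1 by simp
  next
    case 2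
    have "arr s 0 (reg s 19 + 1) = fst ?x" "arr s 0 (reg s 19 + 1 + 1) = snd ?x"
      using u[rule_format, of 1] u[rule_format, of 2] 2 by (simp_all add: code_lit_item One_nat_def numeral_eq_Suc)
    then have "sem read_clause s = sem push_item ?s1"
      using s l 2 by (simp add: read_clause_def)
    then show ?thesis using h1 2 by (simp add: code_lit_item)
  next
    case 3
    have "arr s 0 (reg s 19 + 1) = fst ?x" "arr s 0 (reg s 19 + 1 + 1) = snd ?x"
      "arr s 0 (reg s 19 + 1 + 1 + 1) = fst ?y" "arr s 0 (reg s 19 + 1 + 1 + 1 + 1) = snd ?y"
      using u[rule_format, of 1] u[rule_format, of 2] u[rule_format, of 3] u[rule_format, of 4] 3
      by (simp_all add: code_lit_item One_nat_def numeral_eq_Suc)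
    then have "sem read_clause s = sem push_item ?s2"
      using s l 3 by (simp add: read_clause_def)
    then show ?thesis using h2 3 by (simp add: code_lit_item)
  qed
  then show "held (p @ map lit_item xs) (sem read_clause s)"
    "reg (sem read_clause s) 19 = reg s 19 + length (length xs # concat (map code_lit xs))" by blast+
qed (auto simp: read_clause_def push_item_def)

lemma end_rule_sem:
  assumes "stored ql s" "held q s" "length q \<le> 2" "reg s 4 = 0" "reg s 27 = 1"
  shows "stored (ql @ pairs_of q) (sem end_rule s)"
    "reg (sem end_rule s) 6 \<noteq> 0 \<longleftrightarrow> reg s 6 \<noteq> 0 \<or> q = []"
    "reg (sem end_rule s) 19 = reg s 19"
proof -
  consider "q = []" | x where "q = [x]" | x y where "q = [x, y]"
    using assms(3) by (cases q; cases "tl q"; auto simp: numeral_2_eq_2)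
  then show "stored (ql @ pairs_of q) (sem end_rule s)"
  proof cases
    case 1
    then show ?thesis using assms by (simp add: held_def end_rule_def stored_def)
  next
    case 2
    then show ?thesis using assms
      by (auto simp: held_def end_rule_def stored_def nth_append less_Suc_eq One_nat_def)
  next
    case 3
    then show ?thesis using assms
      by (auto simp: held_def end_rule_def stored_def nth_append less_Suc_eq One_nat_def)
  qed
  show "reg (sem end_rule s) 6 \<noteq> 0 \<longleftrightarrow> reg s 6 \<noteq> 0 \<or> q = []" "reg (sem end_rule s) 19 = reg s 19"
    using assms(2,4,5) by (auto simp: held_def end_rule_def split: if_splits)
qed

lemma parser_sem:
  fixes f :: "'r \<Rightarrow> nat list" and g :: "'r \<Rightarrow> (nat \<times> nat) list"
  assumes rs: "\<And>r. r \<in> set rs \<Longrightarrow> scans c (f r) (g r)" "\<And>r. r \<in> set rs \<Longrightarrow> length (g r) \<le> 2"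
    "\<And>r. f r \<noteq> []"
    and c: "regs c \<subseteq> {19, 20, 21, 22, 23, 24, 25, 26, 28}" "arrs c = {}"
  defines "s \<equiv> init_state (concat (map f rs))" and "ql \<equiv> \<lambda>rs. concat (map (\<lambda>r. pairs_of (g r)) rs)"
  shows "stored (ql rs) (sem (parser c) s)"
    "reg (sem (parser c) s) 6 \<noteq> 0 \<longleftrightarrow> (\<exists>r\<in>set rs. g r = [])"
proof -
  let ?inp = "concat (map f rs)"
  let ?b = "Do (Const 20 0) ;; Do (Const 27 1) ;; c ;; end_rule"
  let ?d = "Branch (Less 19 0) ?b Nop"
  let ?P = "\<lambda>k t. reg t 19 = length (concat (map f (take k rs))) \<and> stored (ql (take k rs)) t \<and>
    (reg t 6 \<noteq> 0 \<longleftrightarrow> (\<exists>r\<in>set (take k rs). g r = []))"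
  have s: "reg s r = (if r = 0 then length ?inp else 0)" "i < length ?inp \<Longrightarrow> arr s 0 i = ?inp ! i" for r i
    by (simp_all add: s_def init_state_def)
  have er: "regs end_rule = {5, 6}" "arrs end_rule = {2, 3, 4, 5}" by (auto simp: end_rule_def)
  have "?P (reg s 0) (sem (For 10 0 ?d) s)"
  proof (rule For_rule[where P = ?P])
    show "10 \<notin> regs ?d" "0 \<notin> regs (For 10 0 ?d)" using c er by auto
    show "?P 0 (set_reg 10 0 s)" using s(1) by (simp add: stored_def ql_def)
    fix k and t :: ram_state
    assume a: "k < reg s 0" "?P k t" "reg t 10 = k" "\<And>r. r \<notin> regs (For 10 0 ?d) \<Longrightarrow> reg t r = reg s r"
      "\<And>A. A \<notin> arrs ?d \<Longrightarrow> arr t A = arr s A"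
    have "0 \<notin> regs c" "4 \<notin> regs c" using c(1) by auto
    then have t: "reg t 0 = length ?inp" "reg t 4 = 0" "arr t 0 = arr s 0"
      using a(4)[of 0] a(4)[of 4] a(5)[of 0] c(2) er s(1) by auto
    show "?P (Suc k) (bump 10 (sem ?d t))"
    proof (cases "k < length rs")
      case False
      then have tk: "take k rs = rs" "take (Suc k) rs = rs" by auto
      then have "sem ?d t = t" using a(2) t by simp
      then show ?thesis using a(2) unfolding tk by (simp add: stored_def)
    next
      case True
      let ?r = "rs ! k"
      have r: "?r \<in> set rs" using True by simp
      have tk: "take (Suc k) rs = take k rs @ [?r]" using True by (simp add: take_Suc_conv_app_nth)
      have inp: "?inp = concat (map f (take k rs)) @ f ?r @ concat (map f (drop (Suc k) rs))"
        using id_take_nth_drop[OF True] by (metis concat.simps(2) concat_append list.simps(9) map_append)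
      have "reg t 19 < length ?inp" using a(2) rs(3)[of ?r] by (simp add: inp)
      then have e: "sem ?d t = sem ?b t" using t(1) by (simp del: sem.simps(1-3))
      define t1 where "t1 = set_reg 27 1 (set_reg 20 0 t)"
      define t2 where "t2 = sem c t1"
      have e2: "sem ?d t = sem end_rule t2" unfolding e by (simp add: t1_def t2_def)
      have cell: "arr t1 0 (reg t1 19 + i) = f ?r ! i" if "i < length (f ?r)" for i
      proof -
        have "reg t1 19 = length (concat (map f (take k rs)))" using a(2) by (simp add: t1_def)
        moreover have "arr t1 0 = arr s 0" using t(3) by (simp add: t1_def)
        ultimately show ?thesis using s(2) that unfolding inp by (simp add: nth_append)
      qed
      have t1: "reg t1 4 = 0" "reg t1 27 = 1" "held [] t1" using t by (auto simp: t1_def held_def)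
      have sc: "held (g ?r) t2" "reg t2 19 = reg t1 19 + length (f ?r)"
        using scansD[OF rs(1)[OF r] t1 _ cell] rs(2)[OF r] by (auto simp: t2_def)
      note fr = scans_frame[OF rs(1)[OF r], where s = t1, folded t2_def]
      have "stored (ql (take k rs)) t2" using a(2) by (simp add: stored_def fr t1_def)
      moreover have "reg t2 4 = 0" "reg t2 27 = 1" using t1 by (simp_all add: fr)
      moreover have "reg t2 6 = reg t 6" by (simp add: fr t1_def)
      ultimately have "stored (ql (take k rs) @ pairs_of (g ?r)) (sem end_rule t2)"
        "reg (sem end_rule t2) 6 \<noteq> 0 \<longleftrightarrow> reg t 6 \<noteq> 0 \<or> g ?r = []"
        "reg (sem end_rule t2) 19 = reg t 19 + length (f ?r)"
        using end_rule_sem[OF _ sc(1) rs(2)[OF r]] sc(2) by (auto simp: t1_def)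
      then show ?thesis using a(2) unfolding e2 tk by (auto simp: ql_def stored_def)
    qed
  qed simp
  moreover have "take (reg s 0) rs = rs"
  proof -
    have "length rs \<le> length ?inp"
      using rs(3) by (induction rs) (auto simp: Suc_le_eq add_strict_increasing)
    then show ?thesis using s(1) by simp
  qed
  ultimately show "stored (ql rs) (sem (parser c) s)"
    "reg (sem (parser c) s) 6 \<noteq> 0 \<longleftrightarrow> (\<exists>r\<in>set rs. g r = [])"
    unfolding parser_def by simp_all
qed

section \<open>From stored pairs to families of answers\<close>

lemma sym_pairs: "sym (set (concat (map (\<lambda>r. pairs_of (g r)) rs)))"
proof -
  have "(y, x) \<in> set (pairs_of q)" if "(x, y) \<in> set (pairs_of q)" for x y q
    using that by (cases q rule: pairs_of.cases) auto
  then show ?thesis by (auto intro!: symI)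
qed

text \<open>An empty list yields no pair and would pass as satisfied although an empty clause is
  false; register 6 records this case separately.\<close>

lemma pairs_of_short:
  assumes "length q \<le> 2"
  shows "(\<forall>(x, y)\<in>set (pairs_of q). P x \<or> P y) \<longleftrightarrow> q = [] \<or> (\<exists>x\<in>set q. P x)"
    "fst ` set (pairs_of q) = set q" "length (pairs_of q) \<le> 2 * length q"
  using assms by (cases q rule: pairs_of.cases; auto)+

lemma red_model_pairs:
  assumes "\<And>r. r \<in> set rs \<Longrightarrow> length (g r) \<le> 2" "\<And>r. r \<in> set rs \<Longrightarrow> g r \<noteq> []"
  shows "red_model (set (concat (map (\<lambda>r. pairs_of (g r)) rs))) M N \<longleftrightarrow>
    (\<forall>r\<in>set rs. \<exists>x\<in>set (g r). item_true M N x)"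
proof -
  have "red_model (set (concat (map (\<lambda>r. pairs_of (g r)) rs))) M N \<longleftrightarrow>
      (\<forall>r\<in>set rs. \<forall>(x, y)\<in>set (pairs_of (g r)). item_true M N x \<or> item_true M N y)"
    by (auto simp: red_model_def)
  also have "\<dots> \<longleftrightarrow> (\<forall>r\<in>set rs. \<exists>x\<in>set (g r). item_true M N x)"
    using assms pairs_of_short(1)[of _ "item_true M N"] by (intro ball_cong refl) simp
  finally show ?thesis .
qed

text \<open>The common form of the three problems: \<open>M\<close> stays fixed for the evaluation
  of \<open>not\<close>-items while \<open>N\<close> varies.\<close>

definition answers :: "('r \<Rightarrow> (nat \<times> nat) list) \<Rightarrow> 'r list \<Rightarrow> nat set set" where
  "answers g rs = {M. minimal (\<lambda>N. \<forall>r\<in>set rs. \<exists>x\<in>set (g r). item_true M N x) M}"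

text \<open>The bound \<open>4 * m + 3\<close> is shaped by disjunctive programs: \<open>m\<close>
  atoms and three length cells for each of at most \<open>m + 1\<close> rules.\<close>

lemma parse_and_enumerate:
  fixes f :: "'r \<Rightarrow> nat list" and g :: "'r \<Rightarrow> (nat \<times> nat) list"
  assumes rs: "\<And>r. r \<in> set rs \<Longrightarrow> scans c (f r) (g r)" "\<And>r. r \<in> set rs \<Longrightarrow> length (g r) \<le> 2"
    "\<And>r. f r \<noteq> []"
    and c: "regs c \<subseteq> {19, 20, 21, 22, 23, 24, 25, 26, 28}" "arrs c = {}" "bounds c = {}" "counters_ok c"
    and cost: "\<And>\<rho>. cost c \<rho> \<le> 100"
  defines "m \<equiv> \<Sum>r\<leftarrow>rs. length (g r)" and "n \<equiv> card (\<Union>r\<in>set rs. snd ` set (g r))"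
  assumes len: "length (concat (map f rs)) \<le> 4 * m + 3"
  shows "\<exists>t. computes_all (Seq (compile (parser c)) enumerate) (concat (map f rs)) (answers g rs) t \<and>
    time_bound 2000000 m n t"
proof -
  let ?inp = "concat (map f rs)" and ?ql = "concat (map (\<lambda>r. pairs_of (g r)) rs)"
  define s where "s = init_state ?inp"
  define s1 where "s1 = sem (parser c) s"
  have ps: "stored ?ql s1" "reg s1 6 \<noteq> 0 \<longleftrightarrow> (\<exists>r\<in>set rs. g r = [])"
    unfolding s1_def s_def by (rule parser_sem; (rule rs c(1,2); assumption?))+
  have pc: "regs (parser c) \<subseteq> {2, 5, 6, 10, 27} \<union> {19, 20, 21, 22, 23, 24, 25, 26, 28}" "arrs (parser c) \<subseteq> {2, 3, 4, 5}"
    using c(1,2) by (auto simp: parser_def end_rule_def)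
  have z: "reg s1 r = 0" if "r \<in> {1, 4, 7, 8}" for r
  proof -
    have "r \<notin> regs (parser c)" using that pc(1) by auto
    then show ?thesis using that by (auto simp: s1_def s_def init_state_def sem_reg_frame)
  qed
  have za: "arr s1 A i = 0" if "A \<ge> 6" for A i
  proof -
    have "A \<notin> arrs (parser c)" using that pc(2) by auto
    then show ?thesis using that by (auto simp: s1_def s_def init_state_def sem_arr_frame)
  qed
  have "parsed ?ql s1"
    using ps(1) sym_pairs z za by (auto simp: parsed_def)
  then obtain t2 s2 Q outs where t2: "exec enumerate s1 t2 s2"
    "search_inv ?ql Q (Suc (card ((snd \<circ> fst) ` set ?ql))) (reg s1 6 = 0) ([], outs) s2"
    "real t2 \<le> 400000 * real (length ?ql + 1) * growth ^ card ((snd \<circ> fst) ` set ?ql)"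
    using enumerate_exec by blast
  have "\<exists>t\<le>cost (parser c) (\<lambda>_. length ?inp). exec (compile (parser c)) s t (sem (parser c) s)"
    using c by (intro exec_compile) (auto simp: parser_def end_rule_def s_def init_state_def)
  then obtain t1 where t1: "t1 \<le> cost (parser c) (\<lambda>_. length ?inp)" "exec (compile (parser c)) s t1 s1"
    unfolding s1_def by blast
  have n: "card ((snd \<circ> fst) ` set ?ql) = n"
  proof -
    have "(snd \<circ> fst) ` set ?ql = (\<Union>r\<in>set rs. snd ` fst ` set (pairs_of (g r)))"
      by (auto simp: image_UN image_image comp_def)
    also have "\<dots> = (\<Union>r\<in>set rs. snd ` set (g r))"
      using pairs_of_short(2) rs(2) by (intro SUP_cong) auto
    finally show ?thesis by (simp add: n_def)
  qed
  note t2 = t2[unfolded n]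
  have m: "length ?ql \<le> 2 * m"
    using rs(2) unfolding m_def by (induction rs) (auto intro!: add_mono pairs_of_short(3))
  have "exec (Seq (compile (parser c)) enumerate) s (t1 + t2) s2"
    by (rule exec.Seq[OF t1(2) t2(1)])
  moreover have "output_of s2 = code_atom_lists (map (model_list (Suc n) (arr s2 7)) outs)"
    using t2(2) by (simp add: search_inv_def)
  moreover have "lists_family (map (model_list (Suc n) (arr s2 7)) outs) (answers g rs)"
  proof (cases "\<exists>r\<in>set rs. g r = []")
    case True
    then have "reg s1 6 \<noteq> 0" using ps(2) by simp
    then have "outs = []" using t2(2) by (simp add: search_inv_def)
    moreover have "answers g rs = {}"
    proof -
      have "\<not> (\<forall>r\<in>set rs. \<exists>x\<in>set (g r). item_true M N x)" for M N
        using True by (metis empty_iff list.set(1))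
      then show ?thesis by (simp only: answers_def minimal_def) blast
    qed
    ultimately show ?thesis by (simp add: lists_family_def)
  next
    case False
    then have "red_model (set ?ql) M = (\<lambda>N. \<forall>r\<in>set rs. \<exists>x\<in>set (g r). item_true M N x)" for M
      by (intro ext red_model_pairs rs(2)) blast+
    then have "answers g rs = {M. minimal (red_model (set ?ql) M) M}" by (simp only: answers_def)
    moreover have "reg s1 6 = 0" using ps(2) False by simp
    ultimately show ?thesis
      using output_family[OF t2(2) sym_pairs] by simp
  qed
  ultimately have "computes_all (Seq (compile (parser c)) enumerate) ?inp (answers g rs) (t1 + t2)"
    unfolding computes_all_def s_def by blast
  moreover have "time_bound 2000000 m n (t1 + t2)"
    unfolding time_bound_def growth_power
  proof
    assume "0 < m"
    let ?x = "real m * growth ^ n"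
    have g: "1 \<le> growth ^ n" using growth_bounds by simp
    have mx: "real m \<le> ?x" using mult_left_mono[OF g, of "real m"] by simp
    have "cost (parser c) (\<lambda>_. length ?inp) \<le> 2 + length ?inp * 130"
      using cost[of "\<lambda>_. length ?inp"] by (simp add: parser_def end_rule_def)
    also have "\<dots> \<le> 2 + (4 * m + 3) * 130" using len by simp
    also have "\<dots> \<le> 1000 * m" using \<open>0 < m\<close> by simp
    finally have "t1 \<le> 1000 * m" using t1(1) by linarith
    then have b1: "real t1 \<le> 1000 * real m" by linarith
    have "real t2 \<le> 400000 * (real (length ?ql + 1) * growth ^ n)"
      using t2(3) by (simp only: mult.assoc)
    also have "\<dots> \<le> 400000 * (3 * real m * growth ^ n)"
      using m \<open>0 < m\<close> by (intro mult_left_mono mult_right_mono) auto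
    finally have b2: "real t2 \<le> 1200000 * ?x" by simp
    have "a + b \<le> 2000000 * x" if "a \<le> 1000 * y" "b \<le> 1200000 * x" "y \<le> x" "0 \<le> x" for a b x y :: real
      using that by linarith
    from this[OF b1 b2 mx] g show "real (t1 + t2) \<le> 2000000 * ?x" by simp
  qed
  ultimately show ?thesis by blast
qed

text \<open>Only the empty clause or rule has weight 0, and without repetitions it occurs at most
  once. This bounds the number of rules in terms of the size, as the estimate of the code length
  requires.\<close>

lemma length_le_weight:
  fixes w :: "'a \<Rightarrow> nat"
  assumes "distinct ys" "\<And>y. y \<in> set ys \<Longrightarrow> w y = 0 \<Longrightarrow> y = e"
  shows "length ys \<le> (\<Sum>y\<leftarrow>ys. w y) + 1"
proof -
  have "length ys \<le> (\<Sum>y\<leftarrow>ys. w y) + (if e \<in> set ys then 1 else 0)"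
    using assms
  proof (induction ys)
    case (Cons y ys)
    then have IH: "length ys \<le> (\<Sum>y\<leftarrow>ys. w y) + (if e \<in> set ys then 1 else 0)" by simp
    show ?case
    proof (cases "w y = 0")
      case True
      then have "y = e" using Cons.prems(2) by simp
      then show ?thesis using IH Cons.prems(1) True by simp
    next
      case False
      then show ?thesis using IH by (auto split: if_splits)
    qed
  qed simp
  also have "\<dots> \<le> (\<Sum>y\<leftarrow>ys. w y) + 1" by simp
  finally show ?thesis .
qed


section \<open>Minimal models, stable models and answer sets\<close>

lemma item_true_lit_item: "item_true M N (lit_item l) \<longleftrightarrow> lit_true N l"
  by (cases l) (auto simp: item_true_def)

lemma snd_lit_item: "snd (lit_item l) = lit_atom l"
  by (cases l) auto

text \<open>Positive literals become head items and negative ones body items. Without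
  \<open>not\<close>-items the truth of an item does not depend on \<open>M\<close>, so the general
  condition is ordinary minimality.\<close>

lemma minimal_models_cnf:
  assumes "t_cnf 2 T" "lists_family xss T"
  shows "\<exists>t. computes_all (Seq (compile (parser read_clause)) enumerate) (code_cnf xss)
      {M. minimal (cnf_model T) M} t \<and> time_bound 2000000 (cnf_size T) (card (cnf_atoms T)) t"
proof -
  let ?f = "\<lambda>xs. length xs # concat (map code_lit xs)" and ?g = "map lit_item"
  have d: "distinct xs" if "xs \<in> set xss" for xs using assms(2) that by (auto simp: lists_family_def)
  have T: "T = set ` set xss" "distinct (map set xss)" using assms(2) by (auto simp: lists_family_def)
  have l: "length xs \<le> 2" if "xs \<in> set xss" for xs
    using that d[OF that] assms(1) T(1) by (auto simp: t_cnf_def distinct_card[symmetric])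
  have lc: "map card (map set xss) = map length xss" using d by (auto simp: distinct_card)
  have "sum_list (map card (map set xss)) = sum card (set (map set xss))"
    by (rule sum_list_distinct_conv_sum_set[OF T(2)])
  then have m: "(\<Sum>xs\<leftarrow>xss. length (?g xs)) = cnf_size T"
    unfolding lc by (simp add: cnf_size_def T(1))
  have n: "(\<Union>xs\<in>set xss. snd ` set (?g xs)) = cnf_atoms T"
    by (auto simp: cnf_atoms_def T(1) snd_lit_item image_image)
  have "length (map set xss) \<le> (\<Sum>y\<leftarrow>map set xss. card y) + 1"
    by (rule length_le_weight[OF T(2), of card "{}"]) auto
  then have lx: "length xss \<le> cnf_size T + 1" unfolding lc using m by simp
  have "length (concat (map ?f xss)) = length xss + 2 * (\<Sum>xs\<leftarrow>xss. length (?g xs))"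
    by (induction xss) (auto simp: length_concat comp_def code_lit_item sum_list_triv)
  then have len: "length (concat (map ?f xss)) \<le> 4 * (\<Sum>xs\<leftarrow>xss. length (?g xs)) + 3"
    using lx m by simp
  have "cnf_model T = (\<lambda>N. \<forall>xs\<in>set xss. \<exists>x\<in>set (?g xs). item_true M N x)" for M
    by (auto simp: cnf_model_def T(1) item_true_lit_item)
  then have a: "answers ?g xss = {M. minimal (cnf_model T) M}" unfolding answers_def by metis
  have c: "regs read_clause \<subseteq> {19, 20, 21, 22, 23, 24, 25, 26, 28}" "arrs read_clause = {}"
    "bounds read_clause = {}" "counters_ok read_clause" and cost: "cost read_clause \<rho> \<le> 100" for \<rho>
    by (auto simp: read_clause_def push_item_def)
  have "\<exists>t. computes_all (Seq (compile (parser read_clause)) enumerate) (concat (map ?f xss)) (answers ?g xss) t \<and>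
    time_bound 2000000 (\<Sum>xs\<leftarrow>xss. length (?g xs)) (card (\<Union>xs\<in>set xss. snd ` set (?g xs))) t"
    by (rule parse_and_enumerate[where f = ?f and g = ?g, OF scans_read_clause[OF l] _ _ c cost len])
      (simp_all add: l)
  then show ?thesis unfolding a m n code_cnf_def .
qed

lemma reduct_eq_image:
  "reduct P M = (\<lambda>r. Rule (hd_of r) (pos_of r) {}) ` {r \<in> P. neg_of r \<inter> M = {}}" (is "_ = ?f ` ?R")
proof (intro equalityI subsetI)
  fix x assume "x \<in> reduct P M"
  then obtain h B C where "x = Rule h B {}" "Rule h B C \<in> P" "C \<inter> M = {}" unfolding reduct_def by blast
  then show "x \<in> ?f ` ?R" by (intro image_eqI[of _ _ "Rule h B C"]) simp_all
next
  fix x assume "x \<in> ?f ` ?R"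
  then obtain r where "r \<in> P" "neg_of r \<inter> M = {}" "x = ?f r" by blast
  then show "x \<in> reduct P M" unfolding reduct_def by (cases r) auto
qed

lemma normal_model_reduct:
  "normal_model (reduct P M) N \<longleftrightarrow> (\<forall>r\<in>P. neg_of r \<inter> M = {} \<longrightarrow> pos_of r \<subseteq> N \<longrightarrow> hd_of r \<in> N)"
  unfolding reduct_eq_image by (auto simp: normal_model_def body_true_def)

lemma disj_model_reduct:
  "disj_model (reduct P M) N \<longleftrightarrow> (\<forall>r\<in>P. neg_of r \<inter> M = {} \<longrightarrow> pos_of r \<subseteq> N \<longrightarrow> hd_of r \<inter> N \<noteq> {})"
  unfolding reduct_eq_image by (auto simp: disj_model_def body_true_def)

text \<open>The reduct is a definite program, whose models are closed under intersection; a minimal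
  model is therefore least.\<close>

lemma stable_model_iff_minimal: "stable_model P M \<longleftrightarrow> minimal (normal_model (reduct P M)) M"
proof
  assume "stable_model P M"
  then show "minimal (normal_model (reduct P M)) M"
    unfolding stable_model_def least_def minimal_def by blast
next
  assume min: "minimal (normal_model (reduct P M)) M"
  have "M \<subseteq> N" if "normal_model (reduct P M) N" for N
  proof -
    have "normal_model (reduct P M) (M \<inter> N)"
      unfolding normal_model_reduct
    proof (intro ballI impI)
      fix r assume r: "r \<in> P" "neg_of r \<inter> M = {}" "pos_of r \<subseteq> M \<inter> N"
      have "normal_model (reduct P M) M" using min by (simp only: minimal_def)
      then show "hd_of r \<in> M \<inter> N" using that r by (simp add: normal_model_reduct)
    qed
    then show ?thesis using min unfolding minimal_def by blast
  qed
  then show "stable_model P M" using min unfolding stable_model_def least_def minimal_def by blast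
qed

definition normal_items :: "nat \<times> nat list \<times> nat list \<Rightarrow> (nat \<times> nat) list" where
  "normal_items = (\<lambda>(a, bs, cs). [(1, a)] @ map (Pair 0) bs @ map (Pair 2) cs)"

definition disj_items :: "nat list \<times> nat list \<times> nat list \<Rightarrow> (nat \<times> nat) list" where
  "disj_items = (\<lambda>(as, bs, cs). map (Pair 1) as @ map (Pair 0) bs @ map (Pair 2) cs)"

lemma stable_models_normal:
  assumes "normal_program 2 P" "lists_normal rs P"
  shows "\<exists>t. computes_all (Seq (compile (parser (read_head ;; read_list 0 ;; read_list 2))) enumerate)
      (code_normal rs) {M. stable_model P M} t \<and>
    time_bound 2000000 (normal_size P) (card (normal_atoms P)) t"
proof -
  let ?f = "\<lambda>(a, bs, cs). a # code_atom_lists [bs, cs]" and ?g = normal_items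
  let ?h = "\<lambda>(a, bs, cs). Rule a (set bs) (set cs)"
  have d: "distinct bs \<and> distinct cs" if "(a, bs, cs) \<in> set rs" for a bs cs
    using assms(2) that by (auto simp: lists_normal_def Let_def)
  have P: "P = ?h ` set rs" "distinct (map ?h rs)" using assms(2) by (auto simp: lists_normal_def Let_def)
  have l: "1 + length bs + length cs \<le> 2" if "(a, bs, cs) \<in> set rs" for a bs cs
  proof -
    have "Rule a (set bs) (set cs) \<in> P" using that P(1) by force
    then show ?thesis using assms(1) d[OF that] by (fastforce simp: normal_program_def distinct_card)
  qed
  then have l2: "length (?g r) \<le> 2" if "r \<in> set rs" for r
    using that by (cases r) (auto simp: normal_items_def One_nat_def)
  let ?w = "\<lambda>r. 1 + card (pos_of r) + card (neg_of r)"
  have w: "map ?w (map ?h rs) = map (\<lambda>r. length (?g r)) rs"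
    using d by (auto simp: normal_items_def distinct_card)
  have "sum_list (map ?w (map ?h rs)) = sum ?w (set (map ?h rs))"
    by (rule sum_list_distinct_conv_sum_set[OF P(2)])
  then have m: "(\<Sum>r\<leftarrow>rs. length (?g r)) = normal_size P"
    unfolding w by (simp add: normal_size_def P(1))
  have n: "(\<Union>r\<in>set rs. snd ` set (?g r)) = normal_atoms P"
    unfolding normal_atoms_def P(1) by (fastforce simp: normal_items_def image_Un image_image)
  \<comment> \<open>The head gives every rule weight at least 1, so each code is bounded by its own
    weight and no rule has to be set aside as empty.\<close>
  have "length (?f r) \<le> 4 * length (?g r)" for r
    by (cases r) (simp add: code_atom_lists_def normal_items_def)
  then have "(\<Sum>r\<leftarrow>rs. length (?f r)) \<le> (\<Sum>r\<leftarrow>rs. 4 * length (?g r))"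
    by (intro sum_list_mono) blast
  then have len: "length (concat (map ?f rs)) \<le> 4 * (\<Sum>r\<leftarrow>rs. length (?g r)) + 3"
    by (simp add: length_concat comp_def sum_list_const_mult)
  have "normal_model (reduct P M) = (\<lambda>N. \<forall>r\<in>set rs. \<exists>x\<in>set (?g r). item_true M N x)" for M
  proof
    fix N
    have "(\<exists>x\<in>set (?g r). item_true M N x) \<longleftrightarrow>
        (neg_of (?h r) \<inter> M = {} \<longrightarrow> pos_of (?h r) \<subseteq> N \<longrightarrow> hd_of (?h r) \<in> N)" for r
      by (cases r) (auto simp: normal_items_def item_true_def ball_Un bex_Un)
    then show "normal_model (reduct P M) N = (\<forall>r\<in>set rs. \<exists>x\<in>set (?g r). item_true M N x)"
      unfolding normal_model_reduct P(1) by simp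
  qed
  then have a: "answers ?g rs = {M. stable_model P M}"
    unfolding answers_def stable_model_iff_minimal by simp
  have sc: "scans (read_head ;; read_list 0 ;; read_list 2) (?f r) (?g r)" if "r \<in> set rs" for r
  proof -
    obtain a bs cs where r: "r = (a, bs, cs)" by (cases r)
    then have "length bs \<le> 2" "length cs \<le> 2" using l[of a bs cs] that by auto
    then show ?thesis
      using scans_Then[OF scans_read_head[of a] scans_Then[OF scans_read_list[of bs 0] scans_read_list[of cs 2]]]
      by (simp add: r code_atom_lists_def normal_items_def)
  qed
  have c: "regs (read_head ;; read_list 0 ;; read_list 2) \<subseteq> {19, 20, 21, 22, 23, 24, 25, 26, 28}" "arrs (read_head ;; read_list 0 ;; read_list 2) = {}"
    "bounds (read_head ;; read_list 0 ;; read_list 2) = {}" "counters_ok (read_head ;; read_list 0 ;; read_list 2)" and cost: "cost (read_head ;; read_list 0 ;; read_list 2) \<rho> \<le> 100" for \<rho>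
    by (auto simp: read_list_def read_head_def push_item_def)
  have "\<exists>t. computes_all (Seq (compile (parser (read_head ;; read_list 0 ;; read_list 2))) enumerate)
      (concat (map ?f rs)) (answers ?g rs) t \<and>
    time_bound 2000000 (\<Sum>r\<leftarrow>rs. length (?g r)) (card (\<Union>r\<in>set rs. snd ` set (?g r))) t"
    by (rule parse_and_enumerate[where f = ?f and g = ?g, OF sc l2 _ c cost len]) (auto simp: code_atom_lists_def)
  then show ?thesis unfolding a m n code_normal_def .
qed

lemma answer_sets_disj:
  assumes "disj_program 2 P" "lists_disj rs P"
  shows "\<exists>t. computes_all (Seq (compile (parser (read_list 1 ;; read_list 0 ;; read_list 2))) enumerate)
      (code_disj rs) {M. answer_set P M} t \<and>
    time_bound 2000000 (disj_size P) (card (disj_atoms P)) t"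
proof -
  let ?f = "\<lambda>(as, bs, cs). code_atom_lists [as, bs, cs]" and ?g = disj_items
  let ?h = "\<lambda>(as, bs, cs). Rule (set as) (set bs) (set cs)"
  have d: "distinct as \<and> distinct bs \<and> distinct cs" if "(as, bs, cs) \<in> set rs" for as bs cs
    using assms(2) that by (auto simp: lists_disj_def Let_def)
  have P: "P = ?h ` set rs" "distinct (map ?h rs)" using assms(2) by (auto simp: lists_disj_def Let_def)
  have l: "length as + length bs + length cs \<le> 2" if "(as, bs, cs) \<in> set rs" for as bs cs
  proof -
    have "Rule (set as) (set bs) (set cs) \<in> P" using that P(1) by force
    then show ?thesis using assms(1) d[OF that] by (fastforce simp: disj_program_def distinct_card)
  qed
  then have l2: "length (?g r) \<le> 2" if "r \<in> set rs" for r
    using that by (cases r) (auto simp: disj_items_def add.assoc)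
  let ?w = "\<lambda>r. card (hd_of r) + card (pos_of r) + card (neg_of r)"
  have w: "map ?w (map ?h rs) = map (\<lambda>r. length (?g r)) rs"
    using d by (auto simp: disj_items_def distinct_card)
  have "sum_list (map ?w (map ?h rs)) = sum ?w (set (map ?h rs))"
    by (rule sum_list_distinct_conv_sum_set[OF P(2)])
  then have m: "(\<Sum>r\<leftarrow>rs. length (?g r)) = disj_size P"
    unfolding w by (simp add: disj_size_def P(1))
  have n: "(\<Union>r\<in>set rs. snd ` set (?g r)) = disj_atoms P"
    unfolding disj_atoms_def P(1) by (fastforce simp: disj_items_def image_Un image_image)
  have "length (map ?h rs) \<le> (\<Sum>y\<leftarrow>map ?h rs. ?w y) + 1"
    by (rule length_le_weight[OF P(2), of ?w "Rule {} {} {}"]) auto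
  then have lr: "length rs \<le> (\<Sum>r\<leftarrow>rs. length (?g r)) + 1" unfolding w by simp
  have "length (?f r) = 3 + length (?g r)" for r
    by (cases r) (simp add: code_atom_lists_def disj_items_def)
  then have "length (concat (map ?f rs)) = (\<Sum>r\<leftarrow>rs. 3 + length (?g r))"
    by (simp only: length_concat map_map comp_def)
  also have "\<dots> = 3 * length rs + (\<Sum>r\<leftarrow>rs. length (?g r))" by (induction rs) auto
  finally have len: "length (concat (map ?f rs)) \<le> 4 * (\<Sum>r\<leftarrow>rs. length (?g r)) + 3"
    using lr by simp
  have "disj_model (reduct P M) = (\<lambda>N. \<forall>r\<in>set rs. \<exists>x\<in>set (?g r). item_true M N x)" for M
  proof
    fix N
    have "(\<exists>x\<in>set (?g r). item_true M N x) \<longleftrightarrow>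
        (neg_of (?h r) \<inter> M = {} \<longrightarrow> pos_of (?h r) \<subseteq> N \<longrightarrow> hd_of (?h r) \<inter> N \<noteq> {})" for r
      by (cases r) (auto simp: disj_items_def item_true_def ball_Un bex_Un)
    then show "disj_model (reduct P M) N = (\<forall>r\<in>set rs. \<exists>x\<in>set (?g r). item_true M N x)"
      unfolding disj_model_reduct P(1) by simp
  qed
  then have a: "answers ?g rs = {M. answer_set P M}"
    unfolding answers_def answer_set_def by simp
  have sc: "scans (read_list 1 ;; read_list 0 ;; read_list 2) (?f r) (?g r)" if "r \<in> set rs" for r
  proof -
    obtain as bs cs where r: "r = (as, bs, cs)" by (cases r)
    then have "length as \<le> 2" "length bs \<le> 2" "length cs \<le> 2" using l[of as bs cs] that by auto
    then show ?thesis
      using scans_Then[OF scans_read_list[of as 1] scans_Then[OF scans_read_list[of bs 0] scans_read_list[of cs 2]]]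
      by (simp add: r code_atom_lists_def disj_items_def)
  qed
  have c: "regs (read_list 1 ;; read_list 0 ;; read_list 2) \<subseteq> {19, 20, 21, 22, 23, 24, 25, 26, 28}" "arrs (read_list 1 ;; read_list 0 ;; read_list 2) = {}"
    "bounds (read_list 1 ;; read_list 0 ;; read_list 2) = {}" "counters_ok (read_list 1 ;; read_list 0 ;; read_list 2)" and cost: "cost (read_list 1 ;; read_list 0 ;; read_list 2) \<rho> \<le> 100" for \<rho>
    by (auto simp: read_list_def push_item_def)
  have "\<exists>t. computes_all (Seq (compile (parser (read_list 1 ;; read_list 0 ;; read_list 2))) enumerate)
      (concat (map ?f rs)) (answers ?g rs) t \<and>
    time_bound 2000000 (\<Sum>r\<leftarrow>rs. length (?g r)) (card (\<Union>r\<in>set rs. snd ` set (?g r))) t"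
    by (rule parse_and_enumerate[where f = ?f and g = ?g, OF sc l2 _ c cost len]) (auto simp: code_atom_lists_def)
  then show ?thesis unfolding a m n code_disj_def .
qed

theorem theorem2p1:
  shows "(\<exists>c K. \<forall>T xss. t_cnf 2 T \<and> lists_family xss T \<longrightarrow>
            (\<exists>t. computes_all c (code_cnf xss) {M. minimal (cnf_model T) M} t \<and>
                 time_bound K (cnf_size T) (card (cnf_atoms T)) t))
       \<and> (\<exists>c K. \<forall>P rs. normal_program 2 P \<and> lists_normal rs P \<longrightarrow>
            (\<exists>t. computes_all c (code_normal rs) {M. stable_model P M} t \<and>
                 time_bound K (normal_size P) (card (normal_atoms P)) t))
       \<and> (\<exists>c K. \<forall>P rs. disj_program 2 P \<and> lists_disj rs P \<longrightarrow>
            (\<exists>t. computes_all c (code_disj rs) {M. answer_set P M} t \<and>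
                 time_bound K (disj_size P) (card (disj_atoms P)) t))
       \<and> (\<forall>n::nat. 3 powr (real n / 3) = root 3 3 ^ n)
       \<and> 1.4422 \<le> root 3 3 \<and> root 3 3 < 1.4423"
  using minimal_models_cnf stable_models_normal answer_sets_disj growth_power growth_bounds by blast

end
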